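(* Let $\Sigma_2=\{0,1\}^{\mathbb{Z}}$ with the product topology and let $\sigma:\Sigma_2\to\Sigma_2$ be the shift, $\sigma(s)_n=s_{n+1}$. Let $\mu$ be a $\sigma$-invariant ergodic Borel probability measure on $\Sigma_2$ whose support contains a periodic point of $\sigma$ other than the constant sequences $0^\infty$ and $1^\infty$. Then for $\mu$-almost every $s\in\Sigma_2$ the square tiled staircase $T_s$ is recurrent.
   Context: The square tiled staircase $T_s$. For $s\in\Sigma_2$, $T_s$ consists of unit squares in the plane with sides parallel to the axes, labelled by $\mathbb{Z}$: the $(n+1)$st square is placed immediately above the $n$th square if $s_n=0$, and immediately to the right of the $n$th square if $s_n=1$. Common edges of adjacent squares are identified, and pairs of boundary edges which are a horizontal or vertical translation of one another are identified by that translation: that is, for each maximal horizontal row of consecutive squares the left edge of its first square is identified with the right edge of its last square, and for each maximal vertical column of consecutive squares the bottom edge of its first square is identified with the top edge of its last square (when the row or column is finite). The result is a translation surface; the corners of the squares are its (possibly) singular points. Straight-line flow. For $\theta\in\mathbb{S}^1$, $\psi_t$ denotes the unit speed straight-line flow on $T_s$ in direction $\theta$ (defined on points whose orbit does not hit a corner); its phase space is $T_s\times\{\theta\}$ with the invariant measure given by area. Recurrence. $T_s$ is recurrent in the direction $\theta$ if for every measurable set $A$ of positive measure in the phase space, the orbit of almost every point of $A$ returns to $A$ (at arbitrarily large times). $T_s$ is recurrent if it is recurrent in the direction $\theta$ for (Lebesgue) almost every $\theta\in\mathbb{S}^1$. *)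

theory Defs
  imports "HOL-Analysis.Analysis" "HOL-Probability.Probability_Measure"
begin

section \<open>Shift-invariant measures on bi-infinite binary sequences\<close>

text \<open>
  A sequence \<open>s :: int \<Rightarrow> bool\<close> stands for an element of \<open>{0,1}\<^sup>\<int>\<close>, with \<open>False\<close> for the
  symbol 0 and \<open>True\<close> for the symbol 1. The type carries the product of the discrete topologies,
  so \<open>borel\<close> is the usual Borel sigma-algebra.
\<close>

definition shift :: "(int \<Rightarrow> bool) \<Rightarrow> int \<Rightarrow> bool" where
  "shift s = (\<lambda>n. s (n + 1))"

definition shift_invariant :: "(int \<Rightarrow> bool) measure \<Rightarrow> bool" where
  "shift_invariant M \<longleftrightarrow> distr M M shift = M"

definition shift_ergodic :: "(int \<Rightarrow> bool) measure \<Rightarrow> bool" where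
  "shift_ergodic M \<longleftrightarrow>
    (\<forall>A\<in>sets M. shift -` A \<inter> space M = A \<longrightarrow> emeasure M A = 0 \<or> emeasure M (space M - A) = 0)"

definition measure_support :: "'a::topological_space measure \<Rightarrow> 'a set" where
  "measure_support M = {x. \<forall>U. open U \<longrightarrow> x \<in> U \<longrightarrow> emeasure M U > 0}"

definition periodic_point :: "(int \<Rightarrow> bool) \<Rightarrow> bool" where
  "periodic_point s \<longleftrightarrow> (\<exists>n>0. (shift ^^ n) s = s)"


section \<open>The square tiled staircase\<close>

text \<open>
  The point with coordinates \<open>p\<close> (relative to the lower left corner) of the square with label \<open>n\<close>
  is the pair \<open>(n, p)\<close>; the staircase is a quotient of the disjoint union of these closed squares.
\<close>

definition unit_square :: "(real \<times> real) set" where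
  "unit_square = {0..1} \<times> {0..1}"

text \<open>
  \<open>finite_row s m n\<close>: the squares \<open>m, \<dots>, n\<close> form a maximal horizontal row (possibly of length one);
  \<open>finite_column\<close> is the vertical analogue.
\<close>

definition finite_row :: "(int \<Rightarrow> bool) \<Rightarrow> int \<Rightarrow> int \<Rightarrow> bool" where
  "finite_row s m n \<longleftrightarrow> m \<le> n \<and> \<not> s (m - 1) \<and> (\<forall>k. m \<le> k \<and> k < n \<longrightarrow> s k) \<and> \<not> s n"

definition finite_column :: "(int \<Rightarrow> bool) \<Rightarrow> int \<Rightarrow> int \<Rightarrow> bool" where
  "finite_column s m n \<longleftrightarrow> m \<le> n \<and> s (m - 1) \<and> (\<forall>k. m \<le> k \<and> k < n \<longrightarrow> \<not> s k) \<and> s n"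

text \<open>
  The right edge of square \<open>n\<close> is glued to the left edge of square \<open>m\<close>, respectively the top edge
  of square \<open>n\<close> to the bottom edge of square \<open>m\<close>: either the squares are adjacent in the plane, or
  these edges are the two ends of one finite row, respectively column. An edge bounding an infinite
  row or column stays unglued.
\<close>

definition glued_right :: "(int \<Rightarrow> bool) \<Rightarrow> int \<Rightarrow> int \<Rightarrow> bool" where
  "glued_right s n m \<longleftrightarrow> (s n \<and> m = n + 1) \<or> finite_row s m n"

definition glued_top :: "(int \<Rightarrow> bool) \<Rightarrow> int \<Rightarrow> int \<Rightarrow> bool" where
  "glued_top s n m \<longleftrightarrow> (\<not> s n \<and> m = n + 1) \<or> finite_column s m n"

definition edge_gluing :: "(int \<Rightarrow> bool) \<Rightarrow> ((int \<times> real \<times> real) \<times> (int \<times> real \<times> real)) set" where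
  "edge_gluing s =
    {((n, 1, y), (m, 0, y)) | n m y. y \<in> {0..1} \<and> glued_right s n m} \<union>
    {((n, x, 1), (m, x, 0)) | n m x. x \<in> {0..1} \<and> glued_top s n m}"

definition identified :: "(int \<Rightarrow> bool) \<Rightarrow> ((int \<times> real \<times> real) \<times> (int \<times> real \<times> real)) set" where
  "identified s = (edge_gluing s \<union> (edge_gluing s)\<inverse>)\<^sup>*"

type_synonym surface_point = "(int \<times> real \<times> real) set"

definition surface_class :: "(int \<Rightarrow> bool) \<Rightarrow> int \<times> real \<times> real \<Rightarrow> surface_point" where
  "surface_class s q = identified s `` {q}"

definition staircase :: "(int \<Rightarrow> bool) \<Rightarrow> surface_point set" where
  "staircase s = (UNIV \<times> unit_square) // identified s"

definition corners :: "(int \<Rightarrow> bool) \<Rightarrow> surface_point set" where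
  "corners s = surface_class s ` (UNIV \<times> {0, 1} \<times> {0, 1})"


section \<open>Area and the straight-line flow\<close>

text \<open>
  Area on the staircase is the image of the sum of the Lebesgue measures on the squares; a set is
  measurable iff its preimage in each square is Lebesgue measurable.
\<close>

definition squares_area :: "(int \<times> real \<times> real) measure" where
  "squares_area = count_space UNIV \<Otimes>\<^sub>M lebesgue_on unit_square"

definition staircase_area :: "(int \<Rightarrow> bool) \<Rightarrow> surface_point measure" where
  "staircase_area s =
    distr squares_area
      (sigma (staircase s)
        {A. A \<subseteq> staircase s \<and> surface_class s -` A \<inter> space squares_area \<in> sets squares_area})
      (surface_class s)"

text \<open>
  A trajectory in direction \<open>\<theta>\<close> avoids the corners and, immediately after and immediately before
  every time, runs along a straight segment with velocity \<open>\<theta>\<close> in one of the closed squares. (Where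
  it crosses an edge, the two segments lie in the two squares glued along it.) It is unit speed when
  \<open>\<theta>\<close> is a unit vector.
\<close>

definition is_trajectory ::
    "(int \<Rightarrow> bool) \<Rightarrow> real \<times> real \<Rightarrow> (real \<Rightarrow> surface_point) \<Rightarrow> bool" where
  "is_trajectory s \<theta> \<gamma> \<longleftrightarrow>
    (\<forall>t. \<gamma> t \<in> staircase s - corners s \<and>
      (\<exists>\<epsilon>>0. \<exists>n p. \<forall>h\<in>{0..\<epsilon>}.
        p + h *\<^sub>R \<theta> \<in> unit_square \<and> \<gamma> (t + h) = surface_class s (n, p + h *\<^sub>R \<theta>)) \<and>
      (\<exists>\<epsilon>>0. \<exists>n p. \<forall>h\<in>{-\<epsilon>..0}.
        p + h *\<^sub>R \<theta> \<in> unit_square \<and> \<gamma> (t + h) = surface_class s (n, p + h *\<^sub>R \<theta>)))"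

definition flow_domain :: "(int \<Rightarrow> bool) \<Rightarrow> real \<times> real \<Rightarrow> surface_point set" where
  "flow_domain s \<theta> = {x. \<exists>\<gamma>. is_trajectory s \<theta> \<gamma> \<and> \<gamma> 0 = x}"

definition straight_line_flow ::
    "(int \<Rightarrow> bool) \<Rightarrow> real \<times> real \<Rightarrow> real \<Rightarrow> surface_point \<Rightarrow> surface_point" where
  "straight_line_flow s \<theta> t x = (THE y. \<exists>\<gamma>. is_trajectory s \<theta> \<gamma> \<and> \<gamma> 0 = x \<and> \<gamma> t = y)"



section \<open>Recurrence\<close>

definition recurrent_in_direction :: "(int \<Rightarrow> bool) \<Rightarrow> real \<times> real \<Rightarrow> bool" where
  "recurrent_in_direction s \<theta> \<longleftrightarrow>
    (\<forall>A\<in>sets (staircase_area s). emeasure (staircase_area s) A > 0 \<longrightarrow>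
      (AE x in staircase_area s. x \<in> A \<longrightarrow>
        x \<in> flow_domain s \<theta> \<and> (\<forall>T. \<exists>t>T. straight_line_flow s \<theta> t x \<in> A)))"

text \<open>The unit circle with its Lebesgue measure is parametrised by the angle.\<close>

definition recurrent :: "(int \<Rightarrow> bool) \<Rightarrow> bool" where
  "recurrent s \<longleftrightarrow>
    (AE \<alpha> in lebesgue_on {0..<2 * pi}. recurrent_in_direction s (cos \<alpha>, sin \<alpha>))"

end

theory Submission
  imports Defs "HOL-Analysis.Kronecker_Approximation_Theorem"
begin

text \<open>
  The flow of slope \<open>1 / a\<close> is a suspension of the map of \<open>[0,1) \<times> \<int>\<close> that rotates the first
  coordinate by \<open>a\<close> and permutes the labels. For a periodic word \<open>p\<close> this map covers a finite extension
  of the rotation, which is ergodic for almost every \<open>a\<close>: at infinitely many scales \<open>1 / K\<close> the first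
  \<open>K\<close> multiples of \<open>a\<close> are both dense and well separated, so that the values of an invariant function
  near one point propagate over the whole circle. The label displacement is bounded and has mean zero,
  hence in the periodic staircase almost no orbit passes a given place for the last time, and the
  measure of the orbits that do not come back within \<open>n\<close> steps tends to 0. By ergodicity of \<open>\<mu>\<close>, almost every \<open>s\<close>
  contains arbitrarily long pieces of \<open>p\<close> arbitrarily far to the left and to the right. A wandering set
  of the flow on \<open>T\<^sub>s\<close> would have to cross these pieces to escape to infinity, so it is null.
\<close>

section \<open>Skew products over a rotation\<close>

text \<open>The area is infinite and, inside long constant blocks of \<open>s\<close>, one step of
  the map can change the label by any amount, so neither Poincare recurrence nor the mean-zero
  argument applies to \<open>s\<close> directly. Both are confined to copies of the periodic word
  \<open>p\<close>: there a step changes the label by at most \<open>step_bound\<close>, so no orbit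
  jumps over a copy. How much measure can cross a copy for the last time depends on the length of
  the copy and not on its position. Long copies are therefore taken beyond any prescribed finite
  region, and the disjoint images of a wandering part of that region must fit into a set as small as
  desired. Ergodicity of the finite extension rests on equality alone: the fibre of an invariant set
  over \<open>x\<close> changes by a permutation that depends only on
  \<open>\<lfloor>x + a\<rfloor>\<close>, so equal fibres stay equal as long as no integer separates
  the two points. The passage to the flow treats each height \<open>y\<close> of the squares
  separately, looks only for returns to that height, and integrates over \<open>y\<close>.
  Directions that point down use the inverse map.\<close>

definition unit_interval :: "real measure" where
  "unit_interval = restrict_space lborel {0..<1}"

definition strip :: "int set \<Rightarrow> (real \<times> int) measure" where
  "strip I = unit_interval \<Otimes>\<^sub>M count_space I"

text \<open>A line of slope \<open>1 / a\<close> that enters a square through its bottom edge at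
  abscissa \<open>fst z\<close> has crossed \<open>\<lfloor>fst z + a\<rfloor>\<close> vertical
  edges, counted with sign, one unit higher. Leaving the label map \<open>g\<close> open makes the
  staircase, its finite quotient, the slide along the flow and the translation of labels instances
  of one construction.\<close>

definition skew :: "real \<Rightarrow> (int \<Rightarrow> int \<Rightarrow> int) \<Rightarrow> real \<times> int \<Rightarrow> real \<times> int" where
  "skew a g z = (frac (fst z + a), g \<lfloor>fst z + a\<rfloor> (snd z))"

definition measure_preserving :: "'a measure \<Rightarrow> ('a \<Rightarrow> 'a) \<Rightarrow> bool" where
  "measure_preserving M T \<longleftrightarrow> T \<in> measurable M M \<and> distr M M T = M"

lemma space_unit_interval [simp]: "space unit_interval = {0..<1}"
  by (simp add: unit_interval_def space_restrict_space)

lemma space_strip [simp]: "space (strip I) = {0..<1} \<times> I"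
  by (simp add: strip_def space_pair_measure)

lemma sets_unit_interval: "A \<in> sets unit_interval \<longleftrightarrow> A \<in> sets borel \<and> A \<subseteq> {0..<1}"
  by (subst unit_interval_def) (auto simp: sets_restrict_space_iff)

lemma emeasure_unit_interval:
  "A \<in> sets unit_interval \<Longrightarrow> emeasure unit_interval A = emeasure lborel A"
  by (simp add: unit_interval_def emeasure_restrict_space sets_restrict_space_iff)

lemma prob_space_unit_interval: "prob_space unit_interval"
  by (rule prob_spaceI, subst emeasure_unit_interval) (auto simp: sets_unit_interval)

interpretation unit_interval: prob_space unit_interval
  by (rule prob_space_unit_interval)

lemma sigma_finite_count_space_int: "sigma_finite_measure (count_space (I :: int set))"
  by (rule sigma_finite_measure_count_space_countable) simp

lemma measurable_unit_interval [measurable_cong]: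
  "sets unit_interval = sets (restrict_space borel {0..<1})"
  by (simp add: unit_interval_def sets_restrict_space)

lemma measurable_into_unit_interval:
  assumes "f \<in> borel_measurable M" "\<And>x. x \<in> space M \<Longrightarrow> f x \<in> {0..<1}"
  shows "f \<in> measurable M unit_interval"
proof -
  have "f \<in> measurable M (restrict_space borel {0..<1})"
    using assms by (intro measurable_restrict_space2) auto
  then show ?thesis
    by (simp add: measurable_cong_sets[OF refl measurable_unit_interval])
qed

lemma measurable_fst_strip [measurable]: "fst \<in> borel_measurable (strip I)"
proof -
  have "fst \<in> measurable (strip I) unit_interval"
    unfolding strip_def by simp
  then have "fst \<in> measurable (strip I) (restrict_space borel {0..<1})"
    by (simp add: measurable_cong_sets[OF refl measurable_unit_interval])
  then show ?thesis
    by (rule measurable_restrict_space2_iff[THEN iffD1, THEN conjunct1])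
qed

lemma measurable_snd_strip [measurable]: "snd \<in> measurable (strip I) (count_space UNIV)"
proof -
  have "snd \<in> measurable (strip I) (count_space I)"
    unfolding strip_def by simp
  then show ?thesis
    by (rule measurable_compose) simp
qed

lemma measurable_floor_count [measurable]:
  "f \<in> borel_measurable M \<Longrightarrow> (\<lambda>x. \<lfloor>f x :: real\<rfloor>) \<in> measurable M (count_space UNIV)"
  by measurable

text \<open>\<open>f\<close> cuts the space into countably many measurable pieces, and on each of
  them only \<open>h\<close> varies.\<close>

lemma measurable_discrete2:
  fixes f :: "'a \<Rightarrow> 'b::countable" and h :: "'a \<Rightarrow> 'c::countable"
  assumes [measurable]: "f \<in> measurable M (count_space UNIV)" "h \<in> measurable M (count_space UNIV)"
  shows "(\<lambda>x. g (f x) (h x)) \<in> measurable M (count_space UNIV)"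
proof (rule measurable_compose_countable[of "\<lambda>i x. g i (h x)" M _ f])
  show "(\<lambda>x. g i (h x)) \<in> measurable M (count_space UNIV)" for i
    by (rule measurable_compose[OF assms(2)]) simp
qed (rule assms(1))

lemma borel_measurable_frac [measurable]:
  "f \<in> borel_measurable M \<Longrightarrow> (\<lambda>x. frac (f x :: real)) \<in> borel_measurable M"
  unfolding frac_def
  by (intro borel_measurable_diff measurable_compose[OF _ borel_measurable_real_floor])

lemma measurable_skew:
  assumes "\<And>j k. k \<in> I \<Longrightarrow> g j k \<in> I"
  shows "skew a g \<in> measurable (strip I) (strip I)"
proof -
  have 1: "(\<lambda>z. frac (fst z + a)) \<in> measurable (strip I) unit_interval"
    by (rule measurable_into_unit_interval) (auto simp: frac_lt_1)
  have fl: "(\<lambda>z. \<lfloor>fst z + a\<rfloor>) \<in> measurable (strip I) (count_space UNIV)"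
    by measurable
  have g: "(\<lambda>z. g \<lfloor>fst z + a\<rfloor> (snd z)) \<in> measurable (strip I) (count_space UNIV)"
    using measurable_discrete2[OF fl measurable_snd_strip, of g] .
  have 2: "(\<lambda>z. g \<lfloor>fst z + a\<rfloor> (snd z)) \<in> measurable (strip I) (count_space I)"
  proof (rule measurableI)
    fix z assume "z \<in> space (strip I)"
    then show "g \<lfloor>fst z + a\<rfloor> (snd z) \<in> space (count_space I)"
      using assms by auto
  next
    fix A show "(\<lambda>z. g \<lfloor>fst z + a\<rfloor> (snd z)) -` A \<inter> space (strip I) \<in> sets (strip I)"
      by (rule measurable_sets[OF g]) simp
  qed
  show ?thesis
    using measurable_Pair[OF 1 2] unfolding skew_def strip_def[symmetric] 
    by (simp add: strip_def)
qed

lemma nn_integral_unit_interval: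
  "f \<in> borel_measurable borel \<Longrightarrow>
    (\<integral>\<^sup>+x. f x \<partial>unit_interval) = (\<integral>\<^sup>+x. f x * indicator {0..<1} x \<partial>lborel)"
  by (simp add: unit_interval_def nn_integral_restrict_space)

text \<open>The rotation is the translation by \<open>b = frac a\<close> left of
  \<open>1 - b\<close> and by \<open>b - 1\<close> right of it; the two images \<open>[b, 1)\<close>
  and \<open>[0, b)\<close> partition the interval again.\<close>

lemma nn_integral_rotation:
  assumes [measurable]: "f \<in> borel_measurable borel"
  shows "(\<integral>\<^sup>+x. f (frac (x + a)) \<partial>unit_interval) = (\<integral>\<^sup>+x. f x \<partial>unit_interval)"
proof -
  define b where "b = frac a"
  have b: "0 \<le> b" "b < 1" by (auto simp: b_def frac_lt_1)
  have fr: "frac (x + a) = (if x < 1 - b then x + b else x + b - 1)" if "x \<in> {0..<1}" for x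
  proof -
    have "frac x = x" using that by (simp add: frac_eq)
    then show ?thesis using that unfolding frac_add b_def by auto
  qed
  have "(\<integral>\<^sup>+x. f (frac (x + a)) \<partial>unit_interval) =
      (\<integral>\<^sup>+x. f (frac (x + a)) * indicator {0..<1} x \<partial>lborel)"
    by (rule nn_integral_unit_interval) measurable
  also have "\<dots> = (\<integral>\<^sup>+x. f (b + 1 * x) * indicator {b..<1} (b + 1 * x) +
        f (b - 1 + 1 * x) * indicator {0..<b} (b - 1 + 1 * x) \<partial>lborel)"
    using b by (intro nn_integral_cong) (auto simp: fr indicator_def algebra_simps)
  also have "\<dots> = (\<integral>\<^sup>+x. f (b + 1 * x) * indicator {b..<1} (b + 1 * x) \<partial>lborel) +
        (\<integral>\<^sup>+x. f (b - 1 + 1 * x) * indicator {0..<b} (b - 1 + 1 * x) \<partial>lborel)"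
    by (intro nn_integral_add) measurable
  also have "\<dots> = (\<integral>\<^sup>+x. f x * indicator {b..<1} x \<partial>lborel) + (\<integral>\<^sup>+x. f x * indicator {0..<b} x \<partial>lborel)"
    using nn_integral_real_affine[of "\<lambda>x. f x * indicator {b..<1} x" 1 b]
      nn_integral_real_affine[of "\<lambda>x. f x * indicator {0..<b} x" 1 "b - 1"] by simp
  also have "\<dots> = (\<integral>\<^sup>+x. f x * indicator {b..<1} x + f x * indicator {0..<b} x \<partial>lborel)"
    by (intro nn_integral_add[symmetric]) measurable
  also have "\<dots> = (\<integral>\<^sup>+x. f x * indicator {0..<1} x \<partial>lborel)"
    using b by (intro nn_integral_cong) (auto simp: indicator_def)
  also have "\<dots> = (\<integral>\<^sup>+x. f x \<partial>unit_interval)"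
    by (rule nn_integral_unit_interval[symmetric]) measurable
  finally show ?thesis .
qed

lemma nn_integral_strip:
  assumes "f \<in> borel_measurable (strip I)"
  shows "(\<integral>\<^sup>+z. f z \<partial>strip I) = (\<integral>\<^sup>+x. (\<integral>\<^sup>+k. f (x, k) \<partial>count_space I) \<partial>unit_interval)"
  using sigma_finite_measure.nn_integral_fst[OF sigma_finite_count_space_int, of f unit_interval I] assms
  by (simp add: strip_def)

text \<open>At a fixed abscissa the labels are merely permuted, and the abscissa is rotated.\<close>

lemma nn_integral_skew:
  assumes g: "\<And>j. bij_betw (g j) I I" and f: "f \<in> borel_measurable (strip I)"
  shows "(\<integral>\<^sup>+z. f (skew a g z) \<partial>strip I) = (\<integral>\<^sup>+z. f z \<partial>strip I)"
proof -
  have gI: "\<And>j k. k \<in> I \<Longrightarrow> g j k \<in> I"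
    using g by (auto simp: bij_betw_def)
  note sk = measurable_skew[of I g a, OF gI]
  define h where "h x = (\<integral>\<^sup>+k. f (x, k) \<partial>count_space I)" for x
  have h: "h \<in> borel_measurable unit_interval"
    using sigma_finite_measure.borel_measurable_nn_integral_fst[OF sigma_finite_count_space_int] f
    unfolding h_def strip_def by blast
  \<comment> \<open>Extension by zero turns the fibre integral into a Borel function on the line,
    the form that \<open>nn_integral_rotation\<close> takes.\<close>
  define h' where "h' x = h x * indicator {0..<1} x" for x
  have h': "h' \<in> borel_measurable borel"
    using h unfolding h'_def
    by (subst (asm) measurable_cong_sets[OF measurable_unit_interval refl])
      (simp add: borel_measurable_restrict_space_iff_ennreal)
  have "(\<integral>\<^sup>+z. f (skew a g z) \<partial>strip I) = (\<integral>\<^sup>+x. (\<integral>\<^sup>+k. f (skew a g (x, k)) \<partial>count_space I) \<partial>unit_interval)"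
    by (rule nn_integral_strip) (rule measurable_compose[OF sk f])
  also have "\<dots> = (\<integral>\<^sup>+x. h' (frac (x + a)) \<partial>unit_interval)"
  proof (rule nn_integral_cong)
    fix x :: real
    have "(\<integral>\<^sup>+k. f (skew a g (x, k)) \<partial>count_space I) =
        (\<integral>\<^sup>+k. f (frac (x + a), g \<lfloor>x + a\<rfloor> k) \<partial>count_space I)"
      by (simp add: skew_def)
    also have "\<dots> = (\<integral>\<^sup>+k. f (frac (x + a), k) \<partial>count_space I)"
      using nn_integral_bij_count_space[OF g, of "\<lambda>k. f (frac (x + a), k)"] by simp
    finally show "(\<integral>\<^sup>+k. f (skew a g (x, k)) \<partial>count_space I) = h' (frac (x + a))"
      by (simp add: h_def h'_def frac_lt_1)
  qed
  also have "\<dots> = (\<integral>\<^sup>+x. h' x \<partial>unit_interval)"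
    by (rule nn_integral_rotation[OF h'])
  also have "\<dots> = (\<integral>\<^sup>+x. h x \<partial>unit_interval)"
    by (intro nn_integral_cong) (auto simp: h'_def)
  also have "\<dots> = (\<integral>\<^sup>+z. f z \<partial>strip I)"
    unfolding h_def by (rule nn_integral_strip[symmetric, OF f])
  finally show ?thesis .
qed

lemma measure_preserving_skew:
  assumes g: "\<And>j. bij_betw (g j) I I"
  shows "measure_preserving (strip I) (skew a g)"
proof -
  have gI: "\<And>j k. k \<in> I \<Longrightarrow> g j k \<in> I"
    using g by (auto simp: bij_betw_def)
  note sk = measurable_skew[of I g a, OF gI]
  have "distr (strip I) (strip I) (skew a g) = strip I"
  proof (rule measure_eqI)
    fix A assume "A \<in> sets (distr (strip I) (strip I) (skew a g))"
    then have A: "A \<in> sets (strip I)" by simp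
    have "emeasure (distr (strip I) (strip I) (skew a g)) A =
        (\<integral>\<^sup>+z. indicator A z \<partial>distr (strip I) (strip I) (skew a g))"
      using A by (subst nn_integral_indicator) auto
    also have "\<dots> = (\<integral>\<^sup>+z. indicator A (skew a g z) \<partial>strip I)"
      using A by (intro nn_integral_distr[OF sk]) auto
    also have "\<dots> = (\<integral>\<^sup>+z. indicator A z \<partial>strip I)"
      using A by (intro nn_integral_skew[OF g]) auto
    finally show "emeasure (distr (strip I) (strip I) (skew a g)) A = emeasure (strip I) A"
      using A by simp
  qed simp
  then show ?thesis using sk by (simp add: measure_preserving_def)
qed

section \<open>Slopes with well spaced multiples\<close>

text \<open>The first clause separates the multiples of \<open>a\<close> modulo 1. It runs to
  \<open>2 * K\<close> because a forward and a backward orbit of length \<open>K\<close> are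
  compared in \<open>shift_into\<close>. The second clause excludes denominators up to
  \<open>c * K\<close> in Dirichlet's theorem, which forces the first \<open>K\<close> multiples to
  be dense at scale \<open>1 / K\<close>.\<close>

definition well_spaced :: "real \<Rightarrow> nat \<Rightarrow> real \<Rightarrow> bool" where
  "well_spaced c K a \<longleftrightarrow>
    (\<forall>j\<ge>1. \<forall>n::int. (j \<le> 2 * K \<longrightarrow> c / K \<le> \<bar>real j * a - n\<bar>) \<and>
      (real j \<le> c * K \<longrightarrow> 1 / K \<le> \<bar>real j * a - n\<bar>))"

definition often_well_spaced :: "real \<Rightarrow> bool" where
  "often_well_spaced a \<longleftrightarrow> (\<exists>c>0. c \<le> 1 \<and> (\<exists>\<^sub>\<infinity>K. well_spaced c K a))"

lemma measure_near_fractions_le: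
  fixes e :: real and m :: int
  assumes j: "j \<ge> 1" and e: "0 < e" "e \<le> 1"
  shows "emeasure lborel {x\<in>{m..<m + 1}. \<exists>n::int. \<bar>real j * x - n\<bar> < e} \<le> ennreal (8 * e)"
proof -
  have jp: "0 < real j" using j by simp
  \<comment> \<open>As \<open>e \<le> 1\<close>, only these \<open>j + 3 \<le> 4 * j\<close>
    numerators matter; each contributes an interval of length \<open>2 * e / j\<close>, whence the
    constant 8.\<close>
  define F where "F = {int j * m - 1..int j * m + int j + 1}"
  have sub: "{x\<in>{m..<m + 1}. \<exists>n::int. \<bar>real j * x - n\<bar> < e} \<subseteq>
      (\<Union>n\<in>F. {(real_of_int n - e) / j..(real_of_int n + e) / j})"
  proof safe
    fix x :: real and n :: int
    assume x: "x \<in> {m..<m + 1}" and n: "\<bar>real j * x - n\<bar> < e"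
    have 1: "real j * m \<le> real j * x" "real j * x \<le> real j * (m + 1)"
      using x jp by (auto intro!: mult_left_mono)
    have "real_of_int (int j * m - 1) \<le> real_of_int n" "real_of_int n \<le> real_of_int (int j * m + int j + 1)"
      using 1 n e by (auto simp: algebra_simps abs_less_iff)
    then have "n \<in> F"
      unfolding F_def atLeastAtMost_iff of_int_le_iff by blast
    moreover have "x \<in> {(real_of_int n - e) / j..(real_of_int n + e) / j}"
      using n jp by (auto simp: field_simps abs_less_iff)
    ultimately show "x \<in> (\<Union>n\<in>F. {(real_of_int n - e) / j..(real_of_int n + e) / j})"
      by blast
  qed
  have "emeasure lborel {x\<in>{m..<m + 1}. \<exists>n::int. \<bar>real j * x - n\<bar> < e} \<le>
      emeasure lborel (\<Union>n\<in>F. {(real_of_int n - e) / j..(real_of_int n + e) / j})"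
    by (rule emeasure_mono[OF sub]) (auto simp: F_def)
  also have "\<dots> \<le> (\<Sum>n\<in>F. emeasure lborel {(real_of_int n - e) / j..(real_of_int n + e) / j})"
    by (rule emeasure_subadditive_finite) (auto simp: F_def)
  also have "\<dots> = (\<Sum>n\<in>F. ennreal (2 * e / j))"
    using e jp by (intro sum.cong refl) (simp add: field_simps)
  also have "\<dots> = of_nat (card F) * ennreal (2 * e / j)" by simp
  also have "\<dots> = ennreal (real (card F) * (2 * e / j))"
    by (subst ennreal_mult) (use e in \<open>auto simp: ennreal_of_nat_eq_real_of_nat\<close>)
  also have "\<dots> \<le> ennreal (8 * e)"
  proof (rule ennreal_leI)
    have "card F = j + 3" by (simp add: F_def)
    then show "real (card F) * (2 * e / j) \<le> 8 * e"
      using j e by (simp add: field_simps)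
  qed
  finally show ?thesis .
qed

lemma not_well_spaced_measurable [measurable]:
  "{x\<in>{real_of_int m..<m + 1}. \<not> well_spaced c K x} \<in> sets borel"
  unfolding well_spaced_def by measurable

text \<open>The first clause fails with measure at most \<open>2 * K\<close> times
  \<open>8 * c / K\<close>, the second with at most \<open>c * K\<close> times \<open>8 / K\<close>.
  What matters is that the total \<open>24 * c\<close> does not involve \<open>K\<close>.\<close>

lemma emeasure_not_well_spaced_le:
  fixes m :: int
  assumes c: "0 < c" "c \<le> 1" and K: "K \<ge> 1"
  shows "emeasure lborel {x\<in>{real_of_int m..<m + 1}. \<not> well_spaced c K x} \<le> ennreal (24 * c)"
proof -
  define E where "E j e = {x\<in>{real_of_int m..<m + 1}. \<exists>n::int. \<bar>real j * x - n\<bar> < e}" for j e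
  have [measurable]: "E j e \<in> sets borel" for j e
    unfolding E_def by measurable
  define q where "q = nat \<lfloor>c * K\<rfloor>"
  have q: "real q \<le> c * K" using c by (simp add: q_def)
  have cK: "0 < c / K" "c / K \<le> 1" "0 < 1 / real K" "1 / real K \<le> 1"
    using c K by (auto simp: field_simps) 
  have sub: "{x\<in>{real_of_int m..<m + 1}. \<not> well_spaced c K x} \<subseteq>
      (\<Union>j\<in>{1..2*K}. E j (c / K)) \<union> (\<Union>j\<in>{1..q}. E j (1 / K))"
  proof
    fix x assume x: "x \<in> {x\<in>{real_of_int m..<m + 1}. \<not> well_spaced c K x}"
    then obtain j n where j: "j \<ge> 1" and *: "(j \<le> 2 * K \<and> \<bar>real j * x - real_of_int n\<bar> < c / K) \<or>
       (real j \<le> c * K \<and> \<bar>real j * x - real_of_int n\<bar> < 1 / K)"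
      unfolding mem_Collect_eq well_spaced_def by (meson not_le)
    have "j \<le> q" if "real j \<le> c * K"
      using that unfolding q_def by (simp add: le_nat_iff le_floor_iff)
    then show "x \<in> (\<Union>j\<in>{1..2*K}. E j (c / K)) \<union> (\<Union>j\<in>{1..q}. E j (1 / K))"
      using * j x unfolding E_def by auto
  qed
  have "emeasure lborel {x\<in>{real_of_int m..<m + 1}. \<not> well_spaced c K x} \<le>
      emeasure lborel ((\<Union>j\<in>{1..2*K}. E j (c / K)) \<union> (\<Union>j\<in>{1..q}. E j (1 / K)))"
    by (rule emeasure_mono[OF sub]) auto
  also have "\<dots> \<le> emeasure lborel (\<Union>j\<in>{1..2*K}. E j (c / K)) + emeasure lborel (\<Union>j\<in>{1..q}. E j (1 / K))"
    by (rule emeasure_subadditive) auto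
  also have "\<dots> \<le> (\<Sum>j\<in>{1..2*K}. emeasure lborel (E j (c / K))) + (\<Sum>j\<in>{1..q}. emeasure lborel (E j (1 / K)))"
    by (intro add_mono emeasure_subadditive_finite) auto
  also have "\<dots> \<le> (\<Sum>j\<in>{1..2*K}. ennreal (8 * (c / K))) + (\<Sum>j\<in>{1..q}. ennreal (8 * (1 / K)))"
    unfolding E_def by (intro add_mono sum_mono measure_near_fractions_le) (use cK in auto)
  also have "\<dots> = ennreal (2 * real K * (8 * (c / K))) + ennreal (real q * (8 * (1 / K)))"
  proof -
    have const: "(\<Sum>j\<in>A. ennreal r) = ennreal (real (card A) * r)" if "r \<ge> 0" for r and A :: "nat set"
      using that by (simp add: ennreal_mult ennreal_of_nat_eq_real_of_nat)
    have "0 \<le> 8 * (c / K)" "0 \<le> 8 * (1 / real K)" using c by auto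
    then show ?thesis by (simp only: const card_atLeastAtMost) simp
  qed
  also have "\<dots> = ennreal (2 * real K * (8 * (c / K)) + real q * (8 * (1 / K)))"
    using c by (intro ennreal_plus[symmetric]) auto
  also have "\<dots> \<le> ennreal (24 * c)"
  proof (rule ennreal_leI)
    have "real q * (8 * (1 / K)) \<le> 8 * c"
      using q K by (simp add: field_simps)
    then show "2 * real K * (8 * (c / K)) + real q * (8 * (1 / K)) \<le> 24 * c"
      using K by simp
  qed
  finally show ?thesis .
qed

text \<open>For fixed \<open>c\<close>, the points of a unit interval that fail from some
  \<open>K\<close> on form an increasing union of sets of measure at most \<open>24 * c\<close>. A
  point outside \<open>often_well_spaced\<close> lies in this union for every
  \<open>c = 1 / Suc i\<close>.\<close>

lemma AE_often_well_spaced: "AE x in lborel. often_well_spaced x"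
proof -
  define N where "N m = {x\<in>{real_of_int m..<m + 1}. \<forall>i::nat. \<exists>K0. \<forall>K\<ge>K0. \<not> well_spaced (1 / Suc i) K x}" for m :: int
  have null: "emeasure lborel (N m) = 0"
    for m :: int
  proof -
    have bd: "emeasure lborel (N m) \<le> ennreal (24 / Suc i)" for i
    proof -
      define B where "B k = {x\<in>{real_of_int m..<m + 1}. \<forall>K\<ge>Suc k. \<not> well_spaced (1 / Suc i) K x}" for k
      have Beq: "B k = (\<Inter>K\<in>{Suc k..}. {x\<in>{real_of_int m..<m + 1}. \<not> well_spaced (1 / Suc i) K x})" for k
        unfolding B_def by auto
      have [measurable]: "B k \<in> sets borel" for k
      proof -
        have "(\<Inter>K\<in>{Suc k..}. {x\<in>{real_of_int m..<m + 1}. \<not> well_spaced (1 / Suc i) K x}) \<in> sets lborel"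
          by (rule sets.countable_INT) (auto simp only: sets_lborel intro!: not_well_spaced_measurable)
        then show ?thesis by (simp add: Beq)
      qed
      have inc: "incseq B"
        by (rule incseq_SucI) (auto simp: B_def)
      have "N m \<subseteq> (\<Union>k. B k)"
      proof
        fix x assume x: "x \<in> N m"
        then obtain K0 where "\<forall>K\<ge>K0. \<not> well_spaced (1 / Suc i) K x"
          unfolding N_def by blast
        then have "x \<in> B K0" using x by (auto simp: B_def N_def)
        then show "x \<in> (\<Union>k. B k)" by blast
      qed
      then have "emeasure lborel (N m) \<le> emeasure lborel (\<Union>k. B k)"
        by (rule emeasure_mono) auto
      also have "\<dots> = (SUP k. emeasure lborel (B k))"
        using inc by (intro SUP_emeasure_incseq[symmetric]) auto
      also have "\<dots> \<le> ennreal (24 / Suc i)"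
      proof (rule SUP_least)
        fix k
        have "emeasure lborel (B k) \<le> emeasure lborel {x\<in>{real_of_int m..<m + 1}. \<not> well_spaced (1 / Suc i) (Suc k) x}"
        proof (rule emeasure_mono)
          show "{x\<in>{real_of_int m..<m + 1}. \<not> well_spaced (1 / Suc i) (Suc k) x} \<in> sets lborel"
            unfolding sets_lborel by (rule not_well_spaced_measurable)
        qed (auto simp: B_def)
        also have "\<dots> \<le> ennreal (24 * (1 / Suc i))"
          by (rule emeasure_not_well_spaced_le) auto
        finally show "emeasure lborel (B k) \<le> ennreal (24 / Suc i)" by simp
      qed
      finally show ?thesis .
    qed
    have lim: "(\<lambda>i. ennreal (24 / Suc i)) \<longlonglongrightarrow> ennreal 0"
      by (intro tendsto_ennrealI) real_asymp
    have "emeasure lborel (N m) \<le> 0"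
      by (rule tendsto_lowerbound[OF lim[simplified]]) (use bd in auto)
    then show ?thesis by simp
  qed
  have [measurable]: "N m \<in> sets borel"
    for m :: int
    unfolding N_def well_spaced_def by measurable
  have nullU: "(\<Union>m::int. N m) \<in> null_sets lborel"
    using null by (intro null_sets_UN null_setsI) simp_all
  show ?thesis
  proof (rule AE_I'[OF nullU])
    show "{x \<in> space lborel. \<not> often_well_spaced x} \<subseteq>
        (\<Union>m::int. N m)"
    proof
      fix x assume x: "x \<in> {x \<in> space lborel. \<not> often_well_spaced x}"
      have "x \<in> {real_of_int \<lfloor>x\<rfloor>..<\<lfloor>x\<rfloor> + 1}" by simp
      moreover have "\<exists>K0. \<forall>K\<ge>K0. \<not> well_spaced (1 / Suc i) K x" for i
      proof -
        have "\<not> (\<exists>\<^sub>\<infinity>K. well_spaced (1 / Suc i) K x)"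
          using x unfolding often_well_spaced_def
          by (auto dest!: spec[of _ "1 / real (Suc i)"])
        then show ?thesis
          by (auto simp: MOST_nat_le)
      qed
      ultimately show "x \<in> (\<Union>m::int. N m)"
        unfolding N_def by blast
    qed
  qed
qed

text \<open>Dirichlet gives a reduced fraction \<open>h / k\<close> with \<open>k \<le> K\<close>
  and \<open>k * a\<close> within \<open>1 / K\<close> of \<open>h\<close>; the second clause of
  \<open>well_spaced\<close> yields \<open>k > c * K\<close>. The numbers \<open>j * h / k\<close>
  run through all multiples of \<open>1 / k\<close> modulo 1, and for \<open>j < k\<close> the point
  \<open>j * a\<close> differs from \<open>j * h / k\<close> by at most
  \<open>1 / K\<close>.\<close>

lemma well_spaced_covering:
  fixes x :: real
  assumes ws: "well_spaced c K a" and c: "0 < c" and K: "K \<ge> 1"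
  obtains j :: nat and n :: int where "j < K" "\<bar>x + real j * a - n\<bar> \<le> (1 / c + 1) / K"
proof -
  obtain h k :: int where cop: "coprime h k" and k: "0 < k" "k \<le> int K"
    and hk: "\<bar>of_int k * a - of_int h\<bar> < 1 / K"
    using Dirichlet_approx_coprime[of K a] K by (metis less_le_trans zero_less_one)
  define k' where "k' = nat k"
  have k': "int k' = k" "k' \<ge> 1" "real k' = real_of_int k" using k by (auto simp: k'_def)
  have "\<not> real k' \<le> c * K"
  proof
    assume "real k' \<le> c * K"
    then have "1 / K \<le> \<bar>real k' * a - h\<bar>"
      using ws k' unfolding well_spaced_def by blast
    then show False using hk k' by simp
  qed
  then have kc: "c * K < k" using k' by simp
  \<comment> \<open>\<open>t / k\<close> is \<open>- x\<close> rounded to the grid of mesh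
    \<open>1 / k\<close>.\<close>
  define t where "t = - \<lfloor>x * k\<rfloor>"
  have t: "0 \<le> x + t / k" "x + t / k \<le> 1 / k"
  proof -
    have "0 \<le> x * k + t" "x * k + t \<le> 1" unfolding t_def by linarith+
    moreover have "x + t / k = (x * k + t) / k" using k by (simp add: add_divide_distrib)
    ultimately show "0 \<le> x + t / k" "x + t / k \<le> 1 / k" using k by (auto simp: divide_right_mono)
  qed
  obtain p q where pq: "p * h + q * k = 1"
    using cop by (metis bezout_int coprime_imp_gcd_eq_1)
  \<comment> \<open>By Bezout \<open>p\<close> inverts \<open>h\<close> modulo \<open>k\<close>, so
    this \<open>j\<close> solves \<open>j * h = t\<close> modulo \<open>k\<close>, and
    \<open>n\<close> below is the corresponding quotient.\<close>
  define j where "j = (t * p) mod k"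
  define n where "n = - (t * q + h * ((t * p) div k))"
  have j: "0 \<le> j" "j < k" using k by (auto simp: j_def)
  have "j * h - n * k = t"
  proof -
    have "j = t * p - k * ((t * p) div k)" by (simp add: j_def minus_mult_div_eq_mod)
    then have "j * h - n * k = (t * p - k * ((t * p) div k)) * h + (t * q + h * ((t * p) div k)) * k"
      by (simp only: n_def minus_mult_left[symmetric] diff_minus_eq_add)
    also have "\<dots> = t * (p * h + q * k)" by (simp add: algebra_simps)
    finally show ?thesis using pq by simp
  qed
  then have "real_of_int (j * h - n * k) = real_of_int t" by simp
  then have jt: "real_of_int j * h - n * k = t" by simp
  have eq: "x + real (nat j) * a - n = (x + t / k) + (j / k) * (k * a - h)"
    using k j by (simp add: jt[symmetric] field_simps)
  have "\<bar>(j / k) * (k * a - h)\<bar> \<le> 1 * (1 / K)"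
    unfolding abs_mult using j k hk by (intro mult_mono) auto
  then have "\<bar>x + real (nat j) * a - n\<bar> \<le> 1 / k + 1 / K"
    unfolding eq using t by linarith
  also have "\<dots> \<le> 1 / (c * K) + 1 / K"
    using kc c K k by (intro add_mono divide_left_mono) auto
  also have "\<dots> = (1 / c + 1) / K" using c K by (simp add: field_simps)
  finally have bound: "\<bar>x + real (nat j) * a - n\<bar> \<le> (1 / c + 1) / K" .
  have "nat j < K" using j k by linarith
  then show thesis by (rule that[OF _ bound])
qed

section \<open>Functions coded by a rotation\<close>

lemma floor_eq_if_far:
  fixes z z' t :: real
  assumes far: "\<And>m::int. t \<le> \<bar>z - m\<bar>" and near: "\<bar>z' - z\<bar> < t"
  shows "\<lfloor>z'\<rfloor> = \<lfloor>z\<rfloor>"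
proof (rule floor_unique)
  have "t \<le> z - \<lfloor>z\<rfloor>" using far[of "\<lfloor>z\<rfloor>"] by linarith
  then show "real_of_int \<lfloor>z\<rfloor> \<le> z'" using near by linarith
  have "t \<le> \<lfloor>z\<rfloor> + 1 - z" using far[of "\<lfloor>z\<rfloor> + 1"] by linarith
  then show "z' < real_of_int \<lfloor>z\<rfloor> + 1" using near by linarith
qed

text \<open>A density statement that is uniform in the radius: the radius is later dictated by the
  scale \<open>K\<close>, so a density point alone would not do. A closed part \<open>C\<close> of
  \<open>B\<close> carries half of its measure, and an open \<open>Op\<close> around
  \<open>B\<close> exceeds it by less than \<open>\<eta> * b / 4\<close>. The cells of a grid of
  mesh \<open>2 * \<rho>\<close> that meet \<open>C\<close> lie in \<open>Op\<close> and number at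
  least \<open>b / (4 * \<rho>)\<close>; if each lost \<open>\<eta> * \<rho>\<close>, the loss would
  exceed that excess.\<close>

lemma dense_cell:
  fixes B :: "real set"
  assumes B: "B \<in> sets borel" "B \<subseteq> {0<..<1}" "emeasure lborel B > 0" and \<eta>: "\<eta> > 0"
  obtains \<delta> where "\<delta> > 0" "\<And>\<rho>. 0 < \<rho> \<Longrightarrow> \<rho> < \<delta> \<Longrightarrow>
    \<exists>x0. 0 \<le> x0 - \<rho> \<and> x0 + \<rho> \<le> 1 \<and> emeasure lborel ({x0 - \<rho><..<x0 + \<rho>} - B) \<le> ennreal (\<eta> * \<rho>)"
proof -
  have Bfin: "emeasure lborel B \<le> 1"
    using emeasure_mono[OF B(2), of lborel] B(1) by simp
  then obtain b where b: "emeasure lborel B = ennreal b" "b \<ge> 0"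
    using ennreal_cases[of "emeasure lborel B"] by (metis ennreal_one_less_top leD top.extremum_uniqueI ennreal_less_top order_le_less_trans)
  have bpos: "b > 0" using B(3) b by (metis ennreal_0 less_numeral_extra(3) order_le_less)
  obtain T where T: "open T" "B \<subseteq> T" "emeasure lborel (T - B) < ennreal (\<eta> * b / 4)"
    using outer_regular_lborel[OF B(1), of "\<eta> * b / 4"] bpos \<eta> by auto
  define Op where "Op = T \<inter> {0<..<1}"
  have Op: "open Op" "B \<subseteq> Op" "Op \<subseteq> {0<..<1}" using T B by (auto simp: Op_def)
  have "emeasure lborel (Op - B) \<le> emeasure lborel (T - B)"
    using T(1) B(1) by (intro emeasure_mono) (auto simp: Op_def)
  then have OpB: "emeasure lborel (Op - B) < ennreal (\<eta> * b / 4)" using T(3) by (rule le_less_trans)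
  obtain C where C: "closed C" "C \<subseteq> B" "emeasure lebesgue (B - C) < ennreal (b / 2)"
  proof (rule sets_lebesgue_inner_closed[of B "b / 2"])
    show "B \<in> sets lebesgue" using B(1) by simp
    show "0 < b / 2" using bpos by simp
  qed
  have Cb: "C \<in> sets borel" using C(1) by simp
  have BC: "emeasure lborel (B - C) < ennreal (b / 2)"
    using C(3) B(1) Cb by simp
  have "compact C"
    unfolding compact_eq_bounded_closed
  proof
    show "bounded C"
      by (rule bounded_subset[of "{0..1}"]) (use C(2) B(2) in \<open>force+\<close>)
  qed (rule C(1))
  then obtain d where d: "d > 0" "(\<Union>x\<in>C. ball x d) \<subseteq> Op"
    using compact_subset_open_imp_ball_epsilon_subset[of C Op] C Op by auto
  show thesis
  \<comment> \<open>Cells have length \<open>2 * \<rho> < d\<close>, the distance kept free around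
    \<open>C\<close>.\<close>
  proof (rule that[of "d / 2"])
    show "d / 2 > 0" using d by simp
    fix \<rho> assume \<rho>: "0 < \<rho>" "\<rho> < d / 2"
    define cell where "cell i = {2 * \<rho> * real i..<2 * \<rho> * real (Suc i)}" for i
    define ocell where "ocell i = {2 * \<rho> * real i<..<2 * \<rho> * real (Suc i)}" for i
    define S where "S = {i. cell i \<inter> C \<noteq> {}}"
    have cellOp: "cell i \<subseteq> Op" if i: "i \<in> S" for i
    proof
      fix z assume z: "z \<in> cell i"
      obtain x where x: "x \<in> cell i" "x \<in> C" using i by (auto simp: S_def)
      have "dist x z < d"
        using x z \<rho> by (auto simp: cell_def dist_real_def algebra_simps)
      then show "z \<in> Op" using x d by (auto simp: ball_def)
    qed
    have Csub: "C \<subseteq> (\<Union>i\<in>S. cell i)"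
    proof
      fix x assume x: "x \<in> C"
      then have x0: "0 < x" using C B by auto
      define i where "i = nat \<lfloor>x / (2 * \<rho>)\<rfloor>"
      have i: "real i = real_of_int \<lfloor>x / (2 * \<rho>)\<rfloor>" using x0 \<rho> by (simp add: i_def)
      have "real i \<le> x / (2 * \<rho>)" "x / (2 * \<rho>) < real i + 1" unfolding i by linarith+
      then have "x \<in> cell i" using \<rho> by (auto simp: cell_def field_simps)
      then show "x \<in> (\<Union>i\<in>S. cell i)" using x by (auto simp: S_def)
    qed
    have finS: "finite S"
    proof (rule finite_subset)
      show "S \<subseteq> {..nat \<lceil>1 / (2 * \<rho>)\<rceil>}"
      proof
        fix i assume i: "i \<in> S"
        have "2 * \<rho> * real i \<in> cell i" using \<rho> by (simp add: cell_def)
        then have "2 * \<rho> * real i < 1" using cellOp[OF i] Op(3) by auto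
        then have "real i \<le> 1 / (2 * \<rho>)" using \<rho> by (simp add: field_simps)
        then show "i \<in> {..nat \<lceil>1 / (2 * \<rho>)\<rceil>}" by simp linarith
      qed
    qed simp
    have "\<exists>i\<in>S. emeasure lborel (ocell i - B) \<le> ennreal (\<eta> * \<rho>)"
    proof (rule ccontr)
      assume "\<not> ?thesis"
      then have big: "ennreal (\<eta> * \<rho>) \<le> emeasure lborel (ocell i - B)" if "i \<in> S" for i
        using that by (meson linear)
      have "emeasure lborel B \<le> emeasure lborel (C \<union> (B - C))"
        using B Cb by (intro emeasure_mono) auto
      also have "\<dots> \<le> emeasure lborel C + emeasure lborel (B - C)"
        using B Cb by (intro emeasure_subadditive) auto
      finally have split: "ennreal b \<le> emeasure lborel C + emeasure lborel (B - C)"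
        by (simp only: b(1))
      have "emeasure lborel C \<le> emeasure lborel (\<Union>i\<in>S. cell i)"
        using Csub finS by (intro emeasure_mono) (auto simp: cell_def)
      also have "\<dots> \<le> (\<Sum>i\<in>S. emeasure lborel (cell i))"
        using finS by (intro emeasure_subadditive_finite) (auto simp: cell_def)
      also have "\<dots> = (\<Sum>i\<in>S. ennreal (2 * \<rho>))"
        using \<rho> by (intro sum.cong refl) (simp add: cell_def algebra_simps)
      also have "\<dots> = ennreal (real (card S) * (2 * \<rho>))"
        using \<rho> by (simp add: ennreal_mult ennreal_of_nat_eq_real_of_nat)
      finally have "emeasure lborel C + emeasure lborel (B - C) \<le>
          ennreal (real (card S) * (2 * \<rho>)) + ennreal (b / 2)"
        using BC by (intro add_mono) auto
      with split have "ennreal b \<le> ennreal (real (card S) * (2 * \<rho>)) + ennreal (b / 2)"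
        by (rule order_trans)
      also have "\<dots> = ennreal (real (card S) * (2 * \<rho>) + b / 2)"
        using \<rho> bpos by (subst ennreal_plus) auto
      finally have 1: "b \<le> real (card S) * (2 * \<rho>) + b / 2"
        using \<rho> bpos by (subst (asm) ennreal_le_iff) auto
      have "ennreal (real (card S) * (\<eta> * \<rho>)) = (\<Sum>i\<in>S. ennreal (\<eta> * \<rho>))"
        using \<rho> \<eta> by (simp add: ennreal_mult ennreal_of_nat_eq_real_of_nat)
      also have "\<dots> \<le> (\<Sum>i\<in>S. emeasure lborel (ocell i - B))"
        by (rule sum_mono) (rule big)
      also have "\<dots> = emeasure lborel (\<Union>i\<in>S. ocell i - B)"
      proof (rule sum_emeasure)
        have "ocell i \<inter> ocell j = {}" if "i < j" for i j
        proof -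
          have "2 * \<rho> * real (Suc i) \<le> 2 * \<rho> * real j" using that \<rho> by (intro mult_left_mono) auto
          then show ?thesis by (auto simp: ocell_def)
        qed
        then have "ocell i \<inter> ocell j = {}" if "i \<noteq> j" for i j
          using that by (metis Int_commute linorder_neqE_nat)
        then show "disjoint_family_on (\<lambda>i. ocell i - B) S"
          unfolding disjoint_family_on_def by blast
      qed (use finS B in \<open>auto simp: ocell_def\<close>)
      also have "\<dots> \<le> emeasure lborel (Op - B)"
      proof (rule emeasure_mono)
        have "ocell i \<subseteq> cell i" for i by (auto simp: ocell_def cell_def)
        then show "(\<Union>i\<in>S. ocell i - B) \<subseteq> Op - B" using cellOp by blast
      qed (use Op B in auto)
      also have "\<dots> < ennreal (\<eta> * b / 4)" by (rule OpB)
      finally have "real (card S) * (\<eta> * \<rho>) < \<eta> * b / 4"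
        using \<rho> \<eta> by (subst (asm) ennreal_less_iff) auto
      then have "real (card S) * \<rho> < b / 4"
        using \<eta> by (simp add: field_simps)
      then show False using 1 by simp
    qed
    then obtain i where i: "i \<in> S" "emeasure lborel (ocell i - B) \<le> ennreal (\<eta> * \<rho>)" by blast
    define x0 where "x0 = 2 * \<rho> * real i + \<rho>"
    have oc: "ocell i = {x0 - \<rho><..<x0 + \<rho>}" by (simp add: ocell_def x0_def algebra_simps)
    have "x0 + \<rho> \<le> 1"
    proof (rule ccontr)
      assume "\<not> ?thesis"
      moreover have "2 * \<rho> * real i \<in> cell i" using \<rho> by (simp add: cell_def)
      then have "2 * \<rho> * real i < 1" using cellOp[OF i(1)] Op(3) by auto
      ultimately have "1 \<in> cell i" by (simp add: cell_def x0_def algebra_simps)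
      then show False using cellOp[OF i(1)] Op(3) by auto
    qed
    then show "\<exists>x0. 0 \<le> x0 - \<rho> \<and> x0 + \<rho> \<le> 1 \<and> emeasure lborel ({x0 - \<rho><..<x0 + \<rho>} - B) \<le> ennreal (\<eta> * \<rho>)"
      using i(2) \<rho> unfolding oc by (intro exI[of _ x0]) (auto simp: x0_def)
  qed
qed

text \<open>\<open>V x\<close> will be the fibre over \<open>x\<close> of an invariant set. It is
  not constant along orbits: a step applies a permutation that depends on the floor. The locale
  keeps only what such a permutation respects, namely whether two fibres are equal, in both
  directions of time.\<close>

locale rotation_coding =
  fixes a :: real and V :: "real \<Rightarrow> 'b"
  assumes compat: "\<And>x x'. x \<in> {0..<1} \<Longrightarrow> x' \<in> {0..<1} \<Longrightarrow> \<lfloor>x + a\<rfloor> = \<lfloor>x' + a\<rfloor> \<Longrightarrow>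
      V (frac (x + a)) = V (frac (x' + a)) \<longleftrightarrow> V x = V x'"
    and level_sets: "\<And>L. {x \<in> {0<..<1}. V x = L} \<in> sets borel"
begin

lemma frac_iterate:
  "frac (x + real (Suc j) * a) = frac (frac (x + real j * a) + a)"
  "\<lfloor>frac (x + real j * a) + a\<rfloor> = \<lfloor>x + real (Suc j) * a\<rfloor> - \<lfloor>x + real j * a\<rfloor>"
proof -
  have eq: "frac (x + real j * a) + a = (x + real (Suc j) * a) - \<lfloor>x + real j * a\<rfloor>"
    by (simp add: frac_def algebra_simps)
  show "\<lfloor>frac (x + real j * a) + a\<rfloor> = \<lfloor>x + real (Suc j) * a\<rfloor> - \<lfloor>x + real j * a\<rfloor>"
    unfolding eq by simp
  show "frac (x + real (Suc j) * a) = frac (frac (x + real j * a) + a)"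
    unfolding eq by (simp add: frac_def)
qed

text \<open>The floor used in each single step is the difference of two consecutive floors of the
  iterates, so equal floors along the way make \<open>compat\<close> applicable at every
  step.\<close>

lemma compat_iterate:
  assumes x: "x \<in> {0..<1}" "x' \<in> {0..<1}"
    and fl: "\<And>i. 1 \<le> i \<Longrightarrow> i \<le> j \<Longrightarrow> \<lfloor>x + real i * a\<rfloor> = \<lfloor>x' + real i * a\<rfloor>"
  shows "V (frac (x + real j * a)) = V (frac (x' + real j * a)) \<longleftrightarrow> V x = V x'"
  using fl
proof (induction j)
  case 0
  have "frac x = x" "frac x' = x'" using x by (auto simp: frac_eq)
  then show ?case by simp
next
  case (Suc j)
  have IH: "V (frac (x + real j * a)) = V (frac (x' + real j * a)) \<longleftrightarrow> V x = V x'"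
    using Suc by auto
  have fj: "\<lfloor>x + real j * a\<rfloor> = \<lfloor>x' + real j * a\<rfloor>"
  proof (cases "j = 0")
    case True
    have "\<lfloor>x\<rfloor> = 0" "\<lfloor>x'\<rfloor> = 0" using x by (auto simp: floor_eq_iff)
    then show ?thesis using True by simp
  next
    case False then show ?thesis using Suc.prems[of j] by auto
  qed
  have "\<lfloor>frac (x + real j * a) + a\<rfloor> = \<lfloor>frac (x' + real j * a) + a\<rfloor>"
    unfolding frac_iterate(2) using fj Suc.prems[of "Suc j"] by auto
  then show ?case
    unfolding frac_iterate(1) using IH
    by (subst compat) (auto simp: frac_lt_1)
qed

text \<open>
  The interval around \<open>y\<close> is carried into the given one by some power of the rotation or of its
  inverse without being cut at an integer: were both orbits cut, some \<open>j * a\<close> with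
  \<open>1 \<le> j \<le> 2 * K\<close> would be too close to an integer.
\<close>

lemma shift_into:
  assumes ws: "well_spaced c K a" and c: "0 < c" and K: "K \<ge> 1"
    and \<tau>: "\<tau> = c / (2 * K)" and \<rho>: "\<rho> = (1 / c + 1) / K + \<tau>"
    and y: "\<tau> \<le> y" "y \<le> 1 - \<tau>" and x0: "0 \<le> x0 - \<rho>" "x0 + \<rho> \<le> 1"
  obtains w where "\<And>x. \<bar>x - y\<bar> < \<tau> \<Longrightarrow> x + w \<in> {x0 - \<rho><..<x0 + \<rho>}"
    "\<And>x x'. \<bar>x - y\<bar> < \<tau> \<Longrightarrow> \<bar>x' - y\<bar> < \<tau> \<Longrightarrow> V x = V x' \<longleftrightarrow> V (x + w) = V (x' + w)"
proof -
  have \<tau>0: "0 < \<tau>" using c K \<tau> by simp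
  have J: "x \<in> {0..<1}" "frac x = x" if "\<bar>x - y\<bar> < \<tau>" for x
  proof -
    show "x \<in> {0..<1}" using that y by auto
    then show "frac x = x" by (simp add: frac_eq)
  qed
  have I0: "z \<in> {0..<1}" if "z \<in> {x0 - \<rho><..<x0 + \<rho>}" for z using that x0 by auto
  have "(\<forall>i<K. \<forall>n::int. \<tau> \<le> \<bar>y - real i * a - n\<bar>) \<or> (\<forall>i<K. \<forall>n::int. \<tau> \<le> \<bar>y + real i * a - n\<bar>)"
  proof (rule ccontr)
    assume "\<not> ?thesis"
    then obtain i i' :: nat and n n' :: int where i: "i < K" "\<bar>y - real i * a - n\<bar> < \<tau>"
      and i': "i' < K" "\<bar>y + real i' * a - n'\<bar> < \<tau>" by (auto simp: not_le)
    show False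
    proof (cases "i + i' = 0")
      case True
      then have "\<bar>y - n\<bar> < \<tau>" using i by simp
      moreover have "n \<le> 0 \<or> n \<ge> 1" by linarith
      then have "real_of_int n \<le> 0 \<or> real_of_int n \<ge> 1" by auto
      ultimately show False using y by linarith
    next
      case False
      then have "1 \<le> i + i'" "i + i' \<le> 2 * K" using i i' by linarith+
      then have "c / K \<le> \<bar>real (i + i') * a - real_of_int (n' - n)\<bar>"
        using ws unfolding well_spaced_def by blast
      also have "\<dots> = \<bar>(y + real i' * a - n') - (y - real i * a - n)\<bar>"
        by (simp add: algebra_simps)
      also have "\<dots> < 2 * \<tau>" using i i' by linarith
      finally show False using \<tau> K by simp
    qed
  qed
  then show thesis
  proof
    assume free: "\<forall>i<K. \<forall>n::int. \<tau> \<le> \<bar>y - real i * a - n\<bar>"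
    obtain j n where j: "j < K" and jn: "\<bar>(x0 - y) + real j * a - real_of_int n\<bar> \<le> (1 / c + 1) / K"
      using well_spaced_covering[OF ws c K, of "x0 - y"] by blast
    \<comment> \<open>Here the backward orbit of \<open>y\<close> is uncut: \<open>j\<close>
      rotations carry \<open>x + w\<close>, a point near \<open>x0\<close>, forward to
      \<open>x\<close>.\<close>
    define w where "w = real_of_int n - real j * a"
    show thesis
    proof (rule that[of w])
      fix x assume x: "\<bar>x - y\<bar> < \<tau>"
      show "x + w \<in> {x0 - \<rho><..<x0 + \<rho>}"
        using x jn unfolding \<rho> w_def by auto
    next
      fix x x' assume x: "\<bar>x - y\<bar> < \<tau>" "\<bar>x' - y\<bar> < \<tau>"
      have inI: "z + w \<in> {0..<1}" if "\<bar>z - y\<bar> < \<tau>" for z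
        using that jn by (intro I0) (auto simp: \<rho> w_def)
      have return: "frac (z + w + real j * a) = z" if "\<bar>z - y\<bar> < \<tau>" for z
        using J(2)[OF that] by (simp add: w_def frac_def)
      have fl: "\<lfloor>z + w + real i * a\<rfloor> = \<lfloor>y - real (j - i) * a\<rfloor> + n"
        if "\<bar>z - y\<bar> < \<tau>" "i \<le> j" for z i
      proof -
        have "z + w + real i * a = (z - real (j - i) * a) + n"
          using that by (simp add: w_def of_nat_diff algebra_simps)
        moreover have "\<lfloor>z - real (j - i) * a\<rfloor> = \<lfloor>y - real (j - i) * a\<rfloor>"
        proof (rule floor_eq_if_far[of \<tau>])
          have "j - i < K" using j by simp
          then show "\<tau> \<le> \<bar>y - real (j - i) * a - real_of_int m\<bar>" for m using free by blast
        qed (use that in simp)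
        ultimately show ?thesis by (simp only: floor_add_int[symmetric])
      qed
      have "V (frac (x + w + real j * a)) = V (frac (x' + w + real j * a)) \<longleftrightarrow> V (x + w) = V (x' + w)"
        using x by (intro compat_iterate inI) (auto simp: fl)
      then show "V x = V x' \<longleftrightarrow> V (x + w) = V (x' + w)"
        using return x by simp
    qed
  next
    assume free: "\<forall>i<K. \<forall>n::int. \<tau> \<le> \<bar>y + real i * a - n\<bar>"
    obtain j n where j: "j < K" and jn: "\<bar>(y - x0) + real j * a - real_of_int n\<bar> \<le> (1 / c + 1) / K"
      using well_spaced_covering[OF ws c K, of "y - x0"] by blast
    \<comment> \<open>Here the forward orbit of \<open>y\<close> is uncut: \<open>j\<close>
      rotations carry \<open>x\<close> to \<open>x + w\<close>. The last floor is \<open>n\<close>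
      for all these points because the target interval lies in \<open>[0, 1)\<close>.\<close>
    define w where "w = real j * a - real_of_int n"
    show thesis
    proof (rule that[of w])
      fix x assume x: "\<bar>x - y\<bar> < \<tau>"
      show "x + w \<in> {x0 - \<rho><..<x0 + \<rho>}"
        using x jn unfolding \<rho> w_def by auto
    next
      fix x x' assume x: "\<bar>x - y\<bar> < \<tau>" "\<bar>x' - y\<bar> < \<tau>"
      have inI: "z + w \<in> {0..<1}" if "\<bar>z - y\<bar> < \<tau>" for z
        using that jn by (intro I0) (auto simp: \<rho> w_def)
      have forth: "frac (z + real j * a) = z + w" "\<lfloor>z + real j * a\<rfloor> = n" if "\<bar>z - y\<bar> < \<tau>" for z
      proof -
        show "\<lfloor>z + real j * a\<rfloor> = n"
          using inI[OF that] by (intro floor_unique) (auto simp: w_def)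
        then show "frac (z + real j * a) = z + w" by (simp add: frac_def w_def)
      qed
      have fl: "\<lfloor>z + real i * a\<rfloor> = \<lfloor>y + real i * a\<rfloor>"
        if "\<bar>z - y\<bar> < \<tau>" "i < j" for z i
        using free j that by (intro floor_eq_if_far[of \<tau>]) auto
      have "V (frac (x + real j * a)) = V (frac (x' + real j * a)) \<longleftrightarrow> V x = V x'"
      proof (rule compat_iterate)
        fix i assume "1 \<le> i" "i \<le> j"
        then show "\<lfloor>x + real i * a\<rfloor> = \<lfloor>x' + real i * a\<rfloor>"
          using fl[of x i] fl[of x' i] forth[of x] forth[of x'] x by (cases "i = j") auto
      qed (use J x in auto)
      then show "V x = V x' \<longleftrightarrow> V (x + w) = V (x' + w)"
        using forth x by simp
    qed
  qed
qed

lemma exceptional_sets [measurable]: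
  assumes [measurable]: "S \<in> sets borel" and "S \<subseteq> {0<..<1}"
  shows "{x \<in> S. V x \<noteq> L} \<in> sets borel"
proof -
  have "{x \<in> S. V x \<noteq> L} = S - {x \<in> {0<..<1}. V x = L}" using assms by auto
  also have "\<dots> \<in> sets borel" by (intro sets.Diff level_sets assms(1))
  finally show ?thesis .
qed

text \<open>Translation by the \<open>w\<close> of \<open>shift_into\<close> transports the
  exceptional set. The new value \<open>L\<close> need not be \<open>K0\<close>: it is the value at
  a point \<open>x1\<close> carried to a point of value \<open>K0\<close>, which exists because
  \<open>\<beta>\<close> is less than the length \<open>2 * \<tau>\<close> of the interval.\<close>

lemma nearly_constant_near:
  assumes ws: "well_spaced c K a" and c: "0 < c" and K: "K \<ge> 1"
    and \<tau>: "\<tau> = c / (2 * K)" and \<rho>: "\<rho> = (1 / c + 1) / K + \<tau>"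
    and y: "\<tau> \<le> y" "y \<le> 1 - \<tau>" and x0: "0 \<le> x0 - \<rho>" "x0 + \<rho> \<le> 1"
    and \<beta>: "emeasure lborel {x \<in> {x0 - \<rho><..<x0 + \<rho>}. V x \<noteq> K0} \<le> ennreal \<beta>" "\<beta> < 2 * \<tau>"
  shows "\<exists>L. emeasure lborel {x \<in> {y - \<tau><..<y + \<tau>}. V x \<noteq> L} \<le> ennreal \<beta>"
proof -
  have \<tau>0: "0 < \<tau>" using c K \<tau> by simp
  obtain w where w: "\<And>x. \<bar>x - y\<bar> < \<tau> \<Longrightarrow> x + w \<in> {x0 - \<rho><..<x0 + \<rho>}"
    "\<And>x x'. \<bar>x - y\<bar> < \<tau> \<Longrightarrow> \<bar>x' - y\<bar> < \<tau> \<Longrightarrow> V x = V x' \<longleftrightarrow> V (x + w) = V (x' + w)"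
    using shift_into[OF ws c K \<tau> \<rho> y x0] by blast
  have I0: "{x0 - \<rho><..<x0 + \<rho>} \<subseteq> {0<..<1}" using x0 by auto
  have meas: "{x \<in> {x0 - \<rho><..<x0 + \<rho>}. V x \<noteq> K0} \<in> sets borel"
    by (rule exceptional_sets) (use I0 in auto)
  have "\<exists>x1. \<bar>x1 - y\<bar> < \<tau> \<and> V (x1 + w) = K0"
  proof (rule ccontr)
    assume no: "\<not> ?thesis"
    have "{y + w - \<tau><..<y + w + \<tau>} \<subseteq> {x \<in> {x0 - \<rho><..<x0 + \<rho>}. V x \<noteq> K0}"
    proof
      fix z assume "z \<in> {y + w - \<tau><..<y + w + \<tau>}"
      then have z: "\<bar>(z - w) - y\<bar> < \<tau>" by (auto simp: abs_less_iff)
      then show "z \<in> {x \<in> {x0 - \<rho><..<x0 + \<rho>}. V x \<noteq> K0}" using w(1)[OF z] no by force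
    qed
    then have "emeasure lborel {y + w - \<tau><..<y + w + \<tau>} \<le> ennreal \<beta>"
      using emeasure_mono[OF _ meas[folded sets_lborel]] \<beta>(1) order_trans by blast
    then have "ennreal (2 * \<tau>) \<le> ennreal \<beta>" using \<tau>0 by simp
    then show False using \<tau>0 \<beta>(2) by (simp add: ennreal_le_iff2)
  qed
  then obtain x1 where x1: "\<bar>x1 - y\<bar> < \<tau>" "V (x1 + w) = K0" by blast
  define E where "E = {x \<in> {x0 - \<rho><..<x0 + \<rho>}. V x \<noteq> K0}"
  have E: "E \<in> sets borel" using meas by (simp only: E_def)
  have sub: "{x \<in> {y - \<tau><..<y + \<tau>}. V x \<noteq> V x1} \<subseteq> (+) w -` E"
  proof
    fix x assume x: "x \<in> {x \<in> {y - \<tau><..<y + \<tau>}. V x \<noteq> V x1}"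
    then have x': "\<bar>x - y\<bar> < \<tau>" by (auto simp: abs_less_iff)
    show "x \<in> (+) w -` E"
      using w(1)[OF x'] w(2)[OF x' x1(1)] x x1(2) by (auto simp: add.commute E_def)
  qed
  have wm: "(+) w \<in> borel \<rightarrow>\<^sub>M (borel :: real measure)" by measurable
  have "(+) w -` E \<inter> space borel \<in> sets borel" by (rule measurable_sets[OF wm E])
  then have wE: "(+) w -` E \<in> sets lborel" by (simp only: space_borel Int_UNIV_right sets_lborel)
  have "emeasure lborel {x \<in> {y - \<tau><..<y + \<tau>}. V x \<noteq> V x1} \<le> emeasure lborel ((+) w -` E)"
    by (rule emeasure_mono[OF sub wE])
  also have "\<dots> = emeasure (distr lborel borel ((+) w)) E"
    using E wm by (subst emeasure_distr) auto
  also have "\<dots> \<le> ennreal \<beta>"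
    using \<beta>(1) unfolding lborel_distr_plus E_def .
  finally show ?thesis by blast
qed

text \<open>Windows of half-width \<open>\<tau>\<close> around the multiples of
  \<open>\<tau>\<close> each have a dominant value. Neighbouring windows overlap in length at least
  \<open>\<tau> > 2 * \<beta>\<close>, so their dominant values agree. At most
  \<open>1 / \<tau>\<close> windows contribute \<open>\<beta>\<close> each; the last summand
  \<open>\<tau>\<close> pays for the end of the interval that the windows may miss.\<close>

lemma nearly_constant:
  assumes ws: "well_spaced c K a" and c: "0 < c" "c \<le> 1" and K: "K \<ge> 1"
    and \<tau>: "\<tau> = c / (2 * K)" and \<rho>: "\<rho> = (1 / c + 1) / K + \<tau>"
    and x0: "0 \<le> x0 - \<rho>" "x0 + \<rho> \<le> 1" and \<beta>0: "0 \<le> \<beta>"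
    and \<beta>: "emeasure lborel {x \<in> {x0 - \<rho><..<x0 + \<rho>}. V x \<noteq> K0} \<le> ennreal \<beta>" "2 * \<beta> < \<tau>"
  shows "\<exists>L. emeasure lborel {x \<in> {0<..<1}. V x \<noteq> L} \<le> ennreal (\<beta> / \<tau> + \<tau>)"
proof -
  have \<tau>0: "0 < \<tau>" using c K \<tau> by simp
  have \<tau>1: "\<tau> \<le> 1 / 2"
    using frac_le[of 1 c 2 "2 * K"] c K unfolding \<tau> by simp
  define Bad where "Bad y L = {x \<in> {y - \<tau><..<y + \<tau>}. V x \<noteq> L}" for y L
  have "\<forall>y. \<tau> \<le> y \<and> y \<le> 1 - \<tau> \<longrightarrow> (\<exists>L. emeasure lborel (Bad y L) \<le> ennreal \<beta>)"
    unfolding Bad_def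
    using nearly_constant_near[OF ws c(1) K \<tau> \<rho> _ _ x0 \<beta>(1)] \<beta>(2) \<beta>0 by auto
  then obtain L where L: "\<And>y. \<tau> \<le> y \<Longrightarrow> y \<le> 1 - \<tau> \<Longrightarrow> emeasure lborel (Bad y (L y)) \<le> ennreal \<beta>"
    by metis
  have Bm: "Bad y M \<in> sets borel" if "\<tau> \<le> y" "y \<le> 1 - \<tau>" for y M
    unfolding Bad_def by (rule exceptional_sets) (use that in auto)
  have step: "L y = L y'" if y: "\<tau> \<le> y" "y \<le> y'" "y' \<le> 1 - \<tau>" "y' \<le> y + \<tau>" for y y'
  proof (rule ccontr)
    assume ne: "L y \<noteq> L y'"
    have "ennreal \<tau> \<le> ennreal (y + \<tau> - (y' - \<tau>))" using y by (intro ennreal_leI) auto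
    also have "\<dots> = emeasure lborel {y' - \<tau><..<y + \<tau>}"
      using y \<tau>0 by simp
    also have "\<dots> \<le> emeasure lborel (Bad y (L y) \<union> Bad y' (L y'))"
    proof (rule emeasure_mono)
      show "{y' - \<tau><..<y + \<tau>} \<subseteq> Bad y (L y) \<union> Bad y' (L y')"
        using ne y unfolding Bad_def by auto
    qed (use y Bm in auto)
    also have "\<dots> \<le> emeasure lborel (Bad y (L y)) + emeasure lborel (Bad y' (L y'))"
      using y Bm by (intro emeasure_subadditive) auto
    also have "\<dots> \<le> ennreal \<beta> + ennreal \<beta>"
      using y by (intro add_mono L) auto
    also have "\<dots> = ennreal (2 * \<beta>)" using \<beta>0 by (subst ennreal_plus[symmetric]) auto
    finally show False using \<beta>(2) \<tau>0 by (simp add: ennreal_le_iff2)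
  qed
  define N where "N = nat \<lfloor>(1 - \<tau>) / \<tau>\<rfloor>"
  have N: "real N \<le> (1 - \<tau>) / \<tau>" using \<tau>0 \<tau>1 by (simp add: N_def)
  have grid: "\<tau> \<le> real i * \<tau>" "real i * \<tau> \<le> 1 - \<tau>" if "1 \<le> i" "i \<le> N" for i
  proof -
    have "1 * \<tau> \<le> real i * \<tau>" using that \<tau>0 by (intro mult_right_mono) auto
    then show "\<tau> \<le> real i * \<tau>" by simp
    have "real i \<le> (1 - \<tau>) / \<tau>" using that N by linarith
    then show "real i * \<tau> \<le> 1 - \<tau>" using \<tau>0 by (simp add: field_simps)
  qed
  have const: "L (real i * \<tau>) = L \<tau>" if "1 \<le> i" "i \<le> N" for i
    using that
  proof (induction i rule: nat_induct_at_least)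
    case base then show ?case by simp
  next
    case (Suc i)
    then have "L (real i * \<tau>) = L (real (Suc i) * \<tau>)"
      using grid[of i] grid[of "Suc i"] \<tau>0 by (intro step) (auto simp: algebra_simps)
    then show ?case using Suc by simp
  qed
  have cover: "{x \<in> {0<..<1}. V x \<noteq> L \<tau>} \<subseteq> (\<Union>i\<in>{1..N}. Bad (real i * \<tau>) (L \<tau>)) \<union> {1 - \<tau>..1}"
  proof
    fix x assume x: "x \<in> {x \<in> {0<..<1}. V x \<noteq> L \<tau>}"
    show "x \<in> (\<Union>i\<in>{1..N}. Bad (real i * \<tau>) (L \<tau>)) \<union> {1 - \<tau>..1}"
    proof (cases "1 - \<tau> \<le> x")
      case True then show ?thesis using x by auto
    next
      case False
      \<comment> \<open>The maximum serves the points below \<open>\<tau>\<close>, which belong to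
        the first window.\<close>
      define i where "i = max 1 (nat \<lfloor>x / \<tau>\<rfloor>)"
      have x0: "0 < x / \<tau>" using x \<tau>0 by simp
      have "1 \<le> (1 - \<tau>) / \<tau>" using \<tau>0 \<tau>1 by (simp add: field_simps)
      then have N1: "1 \<le> N" unfolding N_def by linarith
      have "x / \<tau> \<le> (1 - \<tau>) / \<tau>" using False \<tau>0 by (simp add: divide_right_mono)
      then have "nat \<lfloor>x / \<tau>\<rfloor> \<le> N" unfolding N_def by (intro nat_mono floor_mono)
      then have iN: "1 \<le> i" "i \<le> N" using N1 by (auto simp: i_def)
      have "\<bar>x / \<tau> - real i\<bar> < 1"
      proof (cases "x / \<tau> < 1")
        case True
        then have "i = 1" using x0 by (simp add: i_def floor_less_iff)
        then show ?thesis using True x0 by simp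
      next
        case False
        then have "1 \<le> \<lfloor>x / \<tau>\<rfloor>" by simp
        then have "real i = real_of_int \<lfloor>x / \<tau>\<rfloor>" unfolding i_def by linarith
        then show ?thesis by linarith
      qed
      then have "\<bar>x / \<tau> - real i\<bar> * \<tau> < 1 * \<tau>" using \<tau>0 by (intro mult_strict_right_mono)
      moreover have "\<bar>x / \<tau> - real i\<bar> * \<tau> = \<bar>(x / \<tau> - real i) * \<tau>\<bar>" using \<tau>0 by (simp add: abs_mult)
      ultimately have "\<bar>x - real i * \<tau>\<bar> < \<tau>" using \<tau>0 by (simp add: left_diff_distrib)
      then have "x \<in> Bad (real i * \<tau>) (L \<tau>)" using x by (auto simp: Bad_def abs_less_iff)
      then show ?thesis using iN by auto
    qed
  qed
  have UB: "(\<Union>i\<in>{1..N}. Bad (real i * \<tau>) (L \<tau>)) \<in> sets borel"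
    using grid by (intro sets.finite_UN Bm) auto
  have "emeasure lborel {x \<in> {0<..<1}. V x \<noteq> L \<tau>} \<le>
      emeasure lborel ((\<Union>i\<in>{1..N}. Bad (real i * \<tau>) (L \<tau>)) \<union> {1 - \<tau>..1})"
    using UB by (intro emeasure_mono[OF cover]) auto
  also have "\<dots> \<le> emeasure lborel (\<Union>i\<in>{1..N}. Bad (real i * \<tau>) (L \<tau>)) + emeasure lborel {1 - \<tau>..1}"
    using UB by (intro emeasure_subadditive) auto
  also have "\<dots> \<le> (\<Sum>i\<in>{1..N}. emeasure lborel (Bad (real i * \<tau>) (L \<tau>))) + ennreal \<tau>"
    using grid Bm \<tau>0 by (intro add_mono emeasure_subadditive_finite) auto
  also have "\<dots> \<le> (\<Sum>i\<in>{1..N}. ennreal \<beta>) + ennreal \<tau>"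
  proof (intro add_mono sum_mono order_refl)
    fix i assume "i \<in> {1..N}"
    then show "emeasure lborel (Bad (real i * \<tau>) (L \<tau>)) \<le> ennreal \<beta>"
      using L[of "real i * \<tau>"] grid const by auto
  qed
  also have "\<dots> = ennreal (real N * \<beta>) + ennreal \<tau>"
    using \<beta>0 by (simp add: ennreal_mult ennreal_of_nat_eq_real_of_nat)
  also have "\<dots> = ennreal (real N * \<beta> + \<tau>)"
    using \<beta>0 \<tau>0 by (intro ennreal_plus[symmetric]) auto
  also have "\<dots> \<le> ennreal (\<beta> / \<tau> + \<tau>)"
  proof (rule ennreal_leI)
    have "real N \<le> 1 / \<tau>" using N \<tau>0 by (simp add: field_simps)
    then have "real N * \<beta> \<le> 1 / \<tau> * \<beta>" using \<beta>0 by (intro mult_right_mono)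
    then show "real N * \<beta> + \<tau> \<le> \<beta> / \<tau> + \<tau>" by simp
  qed
  finally show ?thesis by blast
qed

text \<open>Finitely many values leave some level set of positive measure, to which
  \<open>dense_cell\<close> applies. Since \<open>\<rho>\<close> and \<open>\<tau>\<close> are both
  of order \<open>1 / K\<close>, their ratio is at most a constant \<open>C\<close>, and the error
  \<open>\<eta> * \<rho> / \<tau> + \<tau>\<close> of \<open>nearly_constant\<close> becomes
  arbitrarily small at a large well spaced scale.\<close>

lemma AE_constant:
  assumes a: "often_well_spaced a" and fin: "finite (range V)"
  shows "\<exists>L. AE x in unit_interval. V x = L"
proof -
  have "\<exists>K0. emeasure lborel {x \<in> {0<..<1}. V x = K0} > 0"
  proof (rule ccontr)
    assume "\<not> ?thesis"
    then have "(\<Union>K0\<in>range V. {x \<in> {0<..<1}. V x = K0}) \<in> null_sets lborel"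
      using fin level_sets by (intro null_sets_UN' countable_finite null_setsI) (auto simp: not_gr_zero)
    moreover have "(\<Union>K0\<in>range V. {x \<in> {0<..<1}. V x = K0}) = {0<..<1::real}" by auto
    ultimately show False by (auto simp: null_sets_def)
  qed
  then obtain K0 where K0: "emeasure lborel {x \<in> {0<..<1}. V x = K0} > 0" by blast
  obtain c where c: "0 < c" "c \<le> 1" and inf: "\<exists>\<^sub>\<infinity>K. well_spaced c K a"
    using a unfolding often_well_spaced_def by blast
  have small: "\<exists>L. emeasure lborel {x \<in> {0<..<1}. V x \<noteq> L} \<le> ennreal e" if e: "e > 0" for e
  proof -
    define C where "C = 2 * (1 / c + 2) / c"
    have C: "C > 0" using c by (simp add: C_def add_pos_pos)
    \<comment> \<open>The bound \<open>e / 2\<close> is half of the allowed error; the bound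
      \<open>1 / 4\<close> gives the hypothesis \<open>2 * \<beta> < \<tau>\<close> of
      \<open>nearly_constant\<close>.\<close>
    define \<eta> where "\<eta> = min (e / 2) (1 / 4) / C"
    have \<eta>: "\<eta> > 0" using C e by (simp add: \<eta>_def)
    obtain \<delta> where \<delta>: "\<delta> > 0" "\<And>\<rho>. 0 < \<rho> \<Longrightarrow> \<rho> < \<delta> \<Longrightarrow>
      \<exists>x0. 0 \<le> x0 - \<rho> \<and> x0 + \<rho> \<le> 1 \<and>
        emeasure lborel ({x0 - \<rho><..<x0 + \<rho>} - {x \<in> {0<..<1}. V x = K0}) \<le> ennreal (\<eta> * \<rho>)"
      using dense_cell[OF level_sets _ K0 \<eta>] by blast
    \<comment> \<open>The first entry makes \<open>\<tau> \<le> e / 2\<close>, the second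
      \<open>\<rho> < \<delta>\<close>.\<close>
    obtain m :: nat where m: "real m > max (2 / e) ((1 / c + 2) / \<delta>)"
      using reals_Archimedean2 by blast
    obtain K where K: "K > m" "well_spaced c K a"
      using inf unfolding INFM_nat by blast
    define \<tau> where "\<tau> = c / (2 * K)"
    define \<rho> where "\<rho> = (1 / c + 1) / K + \<tau>"
    have Km: "real K > 2 / e" "real K > (1 / c + 2) / \<delta>" using m K(1) by auto
    have K1: "K \<ge> 1" using K(1) by simp
    have \<tau>0: "0 < \<tau>" using c K1 by (simp add: \<tau>_def)
    have \<tau>1: "\<tau> \<le> 1 / K" using c K1 by (simp add: \<tau>_def field_simps)
    have \<tau>e: "\<tau> \<le> e / 2"
    proof -
      have "1 / K < e / 2" using Km(1) K1 e by (simp add: field_simps)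
      then show ?thesis using \<tau>1 by simp
    qed
    have \<rho>0: "0 < \<rho>" using c K1 \<tau>0 by (simp add: \<rho>_def add_pos_pos)
    have \<rho>1: "\<rho> \<le> (1 / c + 2) / K" using \<tau>1 by (simp add: \<rho>_def add_divide_distrib)
    have "(1 / c + 2) / K < \<delta>" using Km(2) K1 \<delta>(1) by (simp add: field_simps)
    then have \<rho>\<delta>: "\<rho> < \<delta>" using \<rho>1 by simp
    obtain x0 where x0: "0 \<le> x0 - \<rho>" "x0 + \<rho> \<le> 1"
      and me: "emeasure lborel ({x0 - \<rho><..<x0 + \<rho>} - {x \<in> {0<..<1}. V x = K0}) \<le> ennreal (\<eta> * \<rho>)"
      using \<delta>(2)[OF \<rho>0 \<rho>\<delta>] by blast
    have seq: "{x0 - \<rho><..<x0 + \<rho>} - {x \<in> {0<..<1}. V x = K0} = {x \<in> {x0 - \<rho><..<x0 + \<rho>}. V x \<noteq> K0}"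
      using x0 by auto
    have "\<rho> / \<tau> \<le> ((1 / c + 2) / K) / \<tau>" using \<rho>1 \<tau>0 by (intro divide_right_mono) auto
    also have "\<dots> = C" using c K1 by (simp add: \<tau>_def C_def field_simps)
    finally have "\<eta> * \<rho> / \<tau> \<le> \<eta> * C" using \<eta> by (metis less_imp_le mult_left_mono times_divide_eq_right)
    also have "\<dots> = min (e / 2) (1 / 4)" using C by (simp add: \<eta>_def)
    finally have q: "\<eta> * \<rho> / \<tau> \<le> e / 2" "\<eta> * \<rho> / \<tau> \<le> 1 / 4" by auto
    have "2 * (\<eta> * \<rho>) < \<tau>"
    proof -
      have "\<eta> * \<rho> \<le> 1 / 4 * \<tau>" using q(2) \<tau>0 by (simp only: pos_divide_le_eq)
      then show ?thesis using \<tau>0 by linarith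
    qed
    then obtain L where "emeasure lborel {x \<in> {0<..<1}. V x \<noteq> L} \<le> ennreal (\<eta> * \<rho> / \<tau> + \<tau>)"
      using nearly_constant[OF K(2) c K1 \<tau>_def \<rho>_def x0 _ me[unfolded seq]] \<eta> \<rho>0 by auto
    also have "\<dots> \<le> ennreal e" using q(1) \<tau>e by (intro ennreal_leI) linarith
    finally show ?thesis by blast
  qed
  have em: "{x \<in> {0<..<1}. V x \<noteq> L} \<in> sets borel" for L by (rule exceptional_sets) auto
  \<comment> \<open>So far the value depends on \<open>e\<close>. Two exceptional sets of measure at
    most \<open>1 / 3\<close> cannot cover the interval, so all small errors share this
    \<open>L\<close>.\<close>
  obtain L where L: "emeasure lborel {x \<in> {0<..<1}. V x \<noteq> L} \<le> ennreal (1 / 3)"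
    using small[of "1 / 3"] by auto
  have Le: "emeasure lborel {x \<in> {0<..<1}. V x \<noteq> L} \<le> ennreal e" if e: "e > 0" for e
  proof -
    obtain L' where L': "emeasure lborel {x \<in> {0<..<1}. V x \<noteq> L'} \<le> ennreal (min e (1 / 3))"
      using small[of "min e (1 / 3)"] e by auto
    have "L' = L"
    proof (rule ccontr)
      assume ne: "L' \<noteq> L"
      have "ennreal 1 = emeasure lborel {0<..<1::real}" by simp
      also have "\<dots> \<le> emeasure lborel ({x \<in> {0<..<1}. V x \<noteq> L} \<union> {x \<in> {0<..<1}. V x \<noteq> L'})"
        using em ne by (intro emeasure_mono) auto
      also have "\<dots> \<le> emeasure lborel {x \<in> {0<..<1}. V x \<noteq> L} + emeasure lborel {x \<in> {0<..<1}. V x \<noteq> L'}"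
        using em by (intro emeasure_subadditive) auto
      also have "\<dots> \<le> ennreal (1 / 3) + ennreal (min e (1 / 3))"
        by (intro add_mono L L')
      also have "\<dots> = ennreal (1 / 3 + min e (1 / 3))"
        using e by (intro ennreal_plus[symmetric]) auto
      also have "\<dots> < ennreal 1" using e by (intro ennreal_lessI) auto
      finally show False by simp
    qed
    moreover have "ennreal (min e (1 / 3)) \<le> ennreal e" by (intro ennreal_leI) simp
    ultimately show ?thesis using L' order_trans by blast
  qed
  have "emeasure lborel {x \<in> {0<..<1}. V x \<noteq> L} \<le> 0"
    by (rule ennreal_le_epsilon) (simp only: add_0_left Le)
  then have "{x \<in> {0<..<1}. V x \<noteq> L} \<union> {0} \<in> null_sets lborel"
    using em by (intro null_sets.Un null_setsI) auto
  then have "AE x in lborel. x \<notin> {x \<in> {0<..<1}. V x \<noteq> L} \<union> {0}" by (rule AE_not_in)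
  then have "AE x in lborel. x \<in> {0..<1} \<longrightarrow> V x = L"
    by (rule eventually_mono) auto
  then have "AE x in unit_interval. V x = L"
    unfolding unit_interval_def by (subst AE_restrict_space_iff) simp_all
  then show ?thesis by blast
qed

end

section \<open>Ergodicity of finite skew products\<close>

lemma measurable_Pair_strip:
  assumes "k \<in> I"
  shows "(\<lambda>x. (x, k)) \<in> measurable unit_interval (strip I)"
  unfolding strip_def using assms by (intro measurable_Pair) auto

lemma emeasure_strip_eq_0_iff:
  assumes A: "A \<in> sets (strip I)"
  shows "emeasure (strip I) A = 0 \<longleftrightarrow> (\<forall>k\<in>I. AE x in unit_interval. (x, k) \<notin> A)"
proof -
  have "emeasure (strip I) A = (\<integral>\<^sup>+z. indicator A z \<partial>strip I)"
    using A by simp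
  also have "\<dots> = (\<integral>\<^sup>+x. (\<integral>\<^sup>+k. indicator A (x, k) \<partial>count_space I) \<partial>unit_interval)"
    using A by (intro nn_integral_strip) auto
  finally have eq: "emeasure (strip I) A = (\<integral>\<^sup>+x. (\<integral>\<^sup>+k. indicator A (x, k) \<partial>count_space I) \<partial>unit_interval)" .
  have meas: "(\<lambda>x. \<integral>\<^sup>+k. indicator A (x, k) \<partial>count_space I :: ennreal) \<in> borel_measurable unit_interval"
    using sigma_finite_measure.borel_measurable_nn_integral_fst[OF sigma_finite_count_space_int,
        of "indicator A" unit_interval I] A
    by (simp add: strip_def)
  have "emeasure (strip I) A = 0 \<longleftrightarrow>
      (AE x in unit_interval. (\<integral>\<^sup>+k. indicator A (x, k) \<partial>count_space I) = (0 :: ennreal))"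
    unfolding eq using meas by (rule nn_integral_0_iff_AE)
  also have "\<dots> \<longleftrightarrow> (AE x in unit_interval. \<forall>k\<in>I. (x, k) \<notin> A)"
    by (simp add: nn_integral_0_iff_AE AE_count_space indicator_def)
  also have "\<dots> \<longleftrightarrow> (\<forall>k\<in>I. AE x in unit_interval. (x, k) \<notin> A)"
    by (rule AE_ball_countable) simp
  finally show ?thesis .
qed

lemma AE_unit_interval_rotation:
  assumes P: "AE x in unit_interval. P x"
  shows "AE x in unit_interval. P (frac (x + a))"
proof -
  obtain N where N: "N \<in> null_sets unit_interval" "{x \<in> space unit_interval. \<not> P x} \<subseteq> N"
    using P by (auto simp: eventually_ae_filter)
  then have Nb: "N \<in> sets borel" by (auto simp: sets_unit_interval null_sets_def)
  have "(\<integral>\<^sup>+x. indicator N (frac (x + a)) \<partial>unit_interval) = (\<integral>\<^sup>+x. indicator N x \<partial>unit_interval)"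
    using Nb by (intro nn_integral_rotation) auto
  also have "\<dots> = emeasure unit_interval N" using N by (intro nn_integral_indicator) auto
  also have "\<dots> = 0" using N by auto
  finally have zero: "(\<integral>\<^sup>+x. indicator N (frac (x + a)) \<partial>unit_interval) = (0 :: ennreal)" .
  have "(\<lambda>x. frac (x + a)) \<in> measurable unit_interval unit_interval"
  proof (rule measurable_into_unit_interval)
    have "(\<lambda>x. x) \<in> borel_measurable unit_interval"
      unfolding unit_interval_def by (intro measurable_restrict_space1) simp
    then show "(\<lambda>x. frac (x + a)) \<in> borel_measurable unit_interval" by measurable
  qed (auto simp: frac_lt_1)
  then have "(\<lambda>x. indicator N (frac (x + a)) :: ennreal) \<in> borel_measurable unit_interval"
    by (rule measurable_compose[OF _ borel_measurable_indicator]) (use N(1) in blast)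
  then have "AE x in unit_interval. indicator N (frac (x + a)) = (0 :: ennreal)"
    using zero by (simp add: nn_integral_0_iff_AE)
  then show ?thesis
  proof (rule eventually_mono)
    fix x assume "indicator N (frac (x + a)) = (0 :: ennreal)"
    then have "frac (x + a) \<notin> N" by (auto simp: indicator_def split: if_splits)
    moreover have "frac (x + a) \<in> space unit_interval" by (simp add: frac_lt_1)
    ultimately show "P (frac (x + a))" using N(2) by blast
  qed
qed

lemma AE_unit_interval_ex:
  assumes P: "AE x in unit_interval. P x" and uv: "0 \<le> u" "u < v" "v \<le> 1"
  obtains x where "u < x" "x < v" "P x"
proof -
  obtain N where N: "N \<in> null_sets unit_interval" "{x \<in> space unit_interval. \<not> P x} \<subseteq> N"
    using P by (auto simp: eventually_ae_filter)
  then have Ns: "N \<in> sets unit_interval" and "emeasure lborel N = 0"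
    using emeasure_unit_interval by (auto simp: null_sets_def)
  then have "\<not> {u<..<v} \<subseteq> N"
    using emeasure_mono[of "{u<..<v}" N lborel] uv by (auto simp: sets_unit_interval)
  then obtain x where x: "u < x" "x < v" "x \<notin> N"
    unfolding subset_iff greaterThanLessThan_iff by blast
  then have "x \<in> space unit_interval" using uv by simp
  then have "P x" using N(2) x(3) by blast
  then show thesis by (rule that[OF x(1,2)])
qed

lemma often_well_spaced_not_Ints:
  assumes "often_well_spaced a"
  shows "a \<notin> \<int>"
proof
  assume "a \<in> \<int>"
  then have ai: "a = real_of_int \<lfloor>a\<rfloor>" by simp
  obtain c where c: "0 < c" and inf: "\<exists>\<^sub>\<infinity>K. well_spaced c K a"
    using assms unfolding often_well_spaced_def by blast
  obtain K where K: "K > 0" "well_spaced c K a" using inf unfolding INFM_nat by blast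
  then have "1 \<le> 2 * K" by simp
  then have "c / K \<le> \<bar>real 1 * a - \<lfloor>a\<rfloor>\<bar>" using K(2) unfolding well_spaced_def by blast
  moreover have "0 < c / K" using c K by simp
  ultimately show False using ai by linarith
qed

text \<open>The fibre \<open>V x\<close> of an invariant set is moved by
  \<open>g \<lfloor>x + a\<rfloor>\<close>, so it obeys \<open>rotation_coding\<close> and is almost
  everywhere one set \<open>L\<close>. Then \<open>L\<close> is mapped to itself by both label maps
  that occur, and \<open>trans\<close> leaves only the trivial cases.\<close>

theorem skew_ergodic:
  assumes a: "often_well_spaced a" and I: "finite I" and g: "\<And>j. bij_betw (g j) I I"
    and A: "A \<in> sets (strip I)"
    and inv: "\<And>z. z \<in> {0..<1} \<times> I \<Longrightarrow> skew a g z \<in> A \<longleftrightarrow> z \<in> A"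
    and trans: "\<And>L. L \<subseteq> I \<Longrightarrow> g \<lfloor>a\<rfloor> ` L = L \<Longrightarrow> g (\<lfloor>a\<rfloor> + 1) ` L = L \<Longrightarrow> L = {} \<or> L = I"
  shows "emeasure (strip I) A = 0 \<or> emeasure (strip I) (space (strip I) - A) = 0"
proof -
  define V where "V x = {k \<in> I. (x, k) \<in> A}" for x
  have VI: "V x \<subseteq> I" for x by (auto simp: V_def)
  have step: "V (frac (x + a)) = g \<lfloor>x + a\<rfloor> ` V x" if x: "x \<in> {0..<1}" for x
  proof -
    have iff: "g \<lfloor>x + a\<rfloor> k \<in> V (frac (x + a)) \<longleftrightarrow> k \<in> V x" if "k \<in> I" for k
      using inv[of "(x, k)"] x that g[of "\<lfloor>x + a\<rfloor>"]
      by (auto simp: V_def skew_def bij_betw_def)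
    show ?thesis
    proof (intro equalityI subsetI)
      fix l assume l: "l \<in> V (frac (x + a))"
      then have "l \<in> g \<lfloor>x + a\<rfloor> ` I" using VI g[of "\<lfloor>x + a\<rfloor>"] by (auto simp: bij_betw_def)
      then show "l \<in> g \<lfloor>x + a\<rfloor> ` V x" using l iff by auto
    next
      fix l assume "l \<in> g \<lfloor>x + a\<rfloor> ` V x"
      then obtain k where "k \<in> V x" "l = g \<lfloor>x + a\<rfloor> k" by blast
      then show "l \<in> V (frac (x + a))" using iff[of k] VI[of x] by auto
    qed
  qed
  interpret rotation_coding a V
  proof
    fix x x' :: real assume x: "x \<in> {0..<1}" "x' \<in> {0..<1}" and fl: "\<lfloor>x + a\<rfloor> = \<lfloor>x' + a\<rfloor>"
    have "inj_on (g \<lfloor>x' + a\<rfloor>) I" using g by (simp add: bij_betw_def)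
    then show "V (frac (x + a)) = V (frac (x' + a)) \<longleftrightarrow> V x = V x'"
      using step x fl VI by (simp add: inj_on_image_eq_iff)
  next
    fix L
    have sec: "{x \<in> {0<..<1}. (x, k) \<in> A} \<in> sets borel" if "k \<in> I" for k
    proof -
      have "(\<lambda>x. (x, k)) -` A \<inter> space unit_interval \<in> sets unit_interval"
        by (rule measurable_sets[OF measurable_Pair_strip[OF that] A])
      then have "(\<lambda>x. (x, k)) -` A \<inter> {0..<1} \<in> sets borel"
        by (simp add: sets_unit_interval)
      then have "((\<lambda>x. (x, k)) -` A \<inter> {0..<1}) \<inter> {0<..<1} \<in> sets borel"
        by (rule sets.Int) simp
      also have "((\<lambda>x. (x, k)) -` A \<inter> {0..<1}) \<inter> {0<..<1} = {x \<in> {0<..<1}. (x, k) \<in> A}" by auto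
      finally show ?thesis .
    qed
    show "{x \<in> {0<..<1}. V x = L} \<in> sets borel"
    proof (cases "L \<subseteq> I")
      case True
      have "{x \<in> {0<..<1}. V x = L} = {0<..<1} - (\<Union>k\<in>L. {0<..<1} - {x \<in> {0<..<1}. (x, k) \<in> A}) -
          (\<Union>k\<in>I - L. {x \<in> {0<..<1}. (x, k) \<in> A})"
        using True by (auto simp: V_def)
      also have "\<dots> \<in> sets borel"
        using I True finite_subset[OF True I] by (intro sets.Diff sets.finite_UN sec) (auto intro: sec)
      finally show ?thesis .
    next
      case False
      then have "{x \<in> {0<..<1}. V x = L} = {}" using VI by auto
      then show ?thesis by (simp only: sets.empty_sets)
    qed
  qed
  have "finite (range V)" by (rule finite_subset[of _ "Pow I"]) (use VI I in auto)
  then obtain L where L: "AE x in unit_interval. V x = L" using AE_constant[OF a] by blast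
  have LI: "L \<subseteq> I" using AE_unit_interval_ex[OF L, of 0 1] VI by auto
  \<comment> \<open>For non-integral \<open>a\<close> each of the two floors occurs on an interval
    of positive length, left and right of \<open>1 - frac a\<close>, so a generic point can be
    picked in each.\<close>
  have "frac a \<noteq> 0" using often_well_spaced_not_Ints[OF a] by (simp add: frac_eq_0_iff)
  then have fa: "0 < frac a" "frac a < 1"
    using frac_ge_0[of a] frac_lt_1[of a] by linarith+
  have L2: "AE x in unit_interval. x \<in> {0..<1} \<and> V x = L \<and> V (frac (x + a)) = L"
    using L AE_unit_interval_rotation[OF L, of a] by auto
  have gL: "g \<lfloor>x + a\<rfloor> ` L = L" if "x \<in> {0..<1} \<and> V x = L \<and> V (frac (x + a)) = L" for x
    using step[of x] that by auto
  obtain x where x: "0 < x" "x < 1 - frac a" "x \<in> {0..<1} \<and> V x = L \<and> V (frac (x + a)) = L"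
    using AE_unit_interval_ex[OF L2, of 0 "1 - frac a"] fa by auto
  have "\<lfloor>x + a\<rfloor> = \<lfloor>a\<rfloor>" using x(1,2) unfolding frac_def by (intro floor_unique) linarith+
  then have g1: "g \<lfloor>a\<rfloor> ` L = L" using gL[OF x(3)] by simp
  obtain x where x: "1 - frac a < x" "x < 1" "x \<in> {0..<1} \<and> V x = L \<and> V (frac (x + a)) = L"
    using AE_unit_interval_ex[OF L2, of "1 - frac a" 1] fa by auto
  have "\<lfloor>x + a\<rfloor> = \<lfloor>a\<rfloor> + 1"
  proof (rule floor_unique)
    show "real_of_int (\<lfloor>a\<rfloor> + 1) \<le> x + a" using x(1) by (simp add: frac_def)
    show "x + a < real_of_int (\<lfloor>a\<rfloor> + 1) + 1" using x(2) by simp linarith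
  qed
  then have g2: "g (\<lfloor>a\<rfloor> + 1) ` L = L" using gL[OF x(3)] by simp
  from trans[OF LI g1 g2] show ?thesis
  proof
    assume "L = {}"
    then have "\<forall>k\<in>I. AE x in unit_interval. (x, k) \<notin> A"
      using L by (auto simp: V_def elim!: eventually_mono)
    then show ?thesis using emeasure_strip_eq_0_iff[OF A] by blast
  next
    assume "L = I"
    then have "\<forall>k\<in>I. AE x in unit_interval. (x, k) \<notin> space (strip I) - A"
      using L by (auto simp: V_def elim!: eventually_mono)
    moreover have "space (strip I) - A \<in> sets (strip I)" by (rule sets.compl_sets[OF A])
    ultimately show ?thesis using emeasure_strip_eq_0_iff by blast
  qed
qed

section \<open>Measure preserving maps\<close>

lemma measure_preserving_measurable: "measure_preserving M T \<Longrightarrow> T \<in> measurable M M"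
  by (simp add: measure_preserving_def)

lemma measure_preserving_emeasure:
  assumes "measure_preserving M T" "A \<in> sets M"
  shows "emeasure M (T -` A \<inter> space M) = emeasure M A"
  using assms emeasure_distr[of T M M A] by (simp add: measure_preserving_def)

lemma measure_preserving_compose:
  assumes S: "measure_preserving M S" and T: "measure_preserving M T"
  shows "measure_preserving M (S \<circ> T)"
  using assms distr_distr[of S M M T M] measurable_comp[of T M M S M]
  by (simp add: measure_preserving_def)

lemma measure_preserving_funpow:
  assumes "measure_preserving M T"
  shows "measure_preserving M (T ^^ n)"
proof (induction n)
  case 0
  then show ?case by (simp add: measure_preserving_def distr_id2 id_def)
next
  case (Suc n)
  show ?case unfolding funpow.simps by (rule measure_preserving_compose[OF assms Suc])
qed

lemma measure_preserving_AE:
  assumes T: "measure_preserving M T" and P: "AE x in M. P x"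
  shows "AE x in M. P (T x)"
proof -
  obtain N where N: "N \<in> null_sets M" "{x \<in> space M. \<not> P x} \<subseteq> N"
    using P by (auto simp: eventually_ae_filter)
  have "T -` N \<inter> space M \<in> null_sets M"
    using N measure_preserving_emeasure[OF T, of N] measurable_sets[OF measure_preserving_measurable[OF T], of N]
    by (auto simp: null_sets_def)
  moreover have "{x \<in> space M. \<not> P (T x)} \<subseteq> T -` N \<inter> space M"
    using N(2) measurable_space[OF measure_preserving_measurable[OF T]] by auto
  ultimately show ?thesis by (rule AE_I')
qed

lemma measure_preserving_AE_funpow:
  assumes T: "measure_preserving M T" and P: "AE x in M. P x"
  shows "AE x in M. \<forall>n. P ((T ^^ n) x)"
  unfolding AE_all_countable
  using measure_preserving_AE[OF measure_preserving_funpow[OF T] P] by blast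

text \<open>Integrating the lower bound and dividing by \<open>n\<close> would suffice if
  \<open>h\<close> were integrable, but it is only finite. The bound by \<open>C\<close> also gives
  sums of at least \<open>- n * C\<close>; hence \<open>- min (h / n) C\<close> bounds the averages
  from below, and its integral tends to 0 by dominated convergence.\<close>

lemma integral_nonneg_of_sums_bounded_below:
  fixes f h :: "'a \<Rightarrow> real"
  assumes "finite_measure M" and T: "measure_preserving M T"
    and f: "f \<in> borel_measurable M" "\<And>x. x \<in> space M \<Longrightarrow> \<bar>f x\<bar> \<le> C"
    and h: "h \<in> borel_measurable M" "\<And>x. x \<in> space M \<Longrightarrow> 0 \<le> h x"
    and le: "AE x in M. \<forall>n. - h x \<le> (\<Sum>i<n. f ((T ^^ i) x))"
  shows "0 \<le> (\<integral>x. f x \<partial>M)"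
proof -
  interpret finite_measure M by fact
  note [measurable] = f(1) h(1)
  have Tm [measurable]: "(T ^^ i) \<in> measurable M M" for i
    using measure_preserving_measurable[OF measure_preserving_funpow[OF T]] .
  have Tsp: "(T ^^ i) x \<in> space M" if "x \<in> space M" for x i
    using measurable_space[OF Tm that] .
  have fint: "integrable M f"
    using f by (intro integrable_const_bound[of _ C]) auto
  have fTint: "integrable M (\<lambda>x. f ((T ^^ i) x))" for i
    using f Tsp by (intro integrable_const_bound[of _ C]) auto
  have same: "(\<integral>x. f ((T ^^ i) x) \<partial>M) = (\<integral>x. f x \<partial>M)" for i
  proof -
    have "distr M M (T ^^ i) = M"
      using measure_preserving_funpow[OF T] by (simp add: measure_preserving_def)
    then show ?thesis using integral_distr[OF Tm f(1)] by metis
  qed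
  define q where "q n x = min (h x / real (Suc n)) C" for n x
  have qm [measurable]: "q n \<in> borel_measurable M" for n unfolding q_def by measurable
  have C0: "0 \<le> C" if "x \<in> space M" for x using f(2)[OF that] by linarith
  have lower: "- (\<integral>x. q n x \<partial>M) \<le> (\<integral>x. f x \<partial>M)" for n
  proof -
    have qint: "integrable M (q n)"
      using h(2) C0 by (intro integrable_const_bound[of _ C]) (auto simp: q_def)
    have "real (Suc n) * (- (\<integral>x. q n x \<partial>M)) = (\<integral>x. real (Suc n) * (- q n x) \<partial>M)"
      by simp
    also have "\<dots> \<le> (\<integral>x. (\<Sum>i<Suc n. f ((T ^^ i) x)) \<partial>M)"
    proof (rule integral_mono_AE)
      show "AE x in M. real (Suc n) * (- q n x) \<le> (\<Sum>i<Suc n. f ((T ^^ i) x))"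
        using le AE_space
      proof eventually_elim
        fix x assume 1: "\<forall>n. - h x \<le> (\<Sum>i<n. f ((T ^^ i) x))" and x: "x \<in> space M"
        have 2: "- (real (Suc n) * C) \<le> (\<Sum>i<Suc n. f ((T ^^ i) x))"
        proof -
          have "(\<Sum>i<Suc n. - C) \<le> (\<Sum>i<Suc n. f ((T ^^ i) x))"
            using f(2)[OF Tsp[OF x]] by (intro sum_mono) (metis abs_le_D2 minus_le_iff)
          then show ?thesis by simp
        qed
        have 3: "- h x \<le> (\<Sum>i<Suc n. f ((T ^^ i) x))" using 1 by blast
        have "real (Suc n) * q n x = min (h x) (real (Suc n) * C)"
          unfolding q_def by (simp add: min_mult_distrib_left)
        then show "real (Suc n) * (- q n x) \<le> (\<Sum>i<Suc n. f ((T ^^ i) x))"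
          using 2 3 by linarith
      qed
    qed (use qint fTint in auto)
    also have "\<dots> = (\<Sum>i<Suc n. (\<integral>x. f ((T ^^ i) x) \<partial>M))"
      using fTint by (intro Bochner_Integration.integral_sum) auto
    also have "\<dots> = real (Suc n) * (\<integral>x. f x \<partial>M)" unfolding same by simp
    finally show ?thesis by (subst (asm) mult_le_cancel_left_pos) auto
  qed
  have "(\<lambda>n. \<integral>x. q n x \<partial>M) \<longlonglongrightarrow> (\<integral>x. 0 \<partial>M)"
  proof (rule integral_dominated_convergence[where w = "\<lambda>_. C"])
    show "AE x in M. (\<lambda>n. q n x) \<longlonglongrightarrow> 0"
      using AE_space
    proof eventually_elim
      fix x assume x: "x \<in> space M"
      have "(\<lambda>n. h x / real (Suc n)) \<longlonglongrightarrow> 0" by real_asymp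
      then have "(\<lambda>n. q n x) \<longlonglongrightarrow> min 0 C" unfolding q_def by (intro tendsto_min) auto
      then show "(\<lambda>n. q n x) \<longlonglongrightarrow> 0" using C0[OF x] by simp
    qed
    show "AE x in M. norm (q n x) \<le> C" for n
      using h(2) C0 by (auto simp: q_def)
  qed auto
  then have "(\<lambda>n. - (\<integral>x. q n x \<partial>M)) \<longlonglongrightarrow> 0" using tendsto_minus by fastforce
  then show ?thesis by (rule tendsto_upperbound) (use lower in auto)
qed

text \<open>
  If the partial sums stayed above their starting value with positive probability, then by ergodicity
  they would be bounded below almost everywhere, and minus the infimum, a finite function, would show
  that the mean of \<open>D\<close> is at least the measure of the set of strict last minima.
\<close>

theorem ergodic_sums_return:
  fixes D :: "'a \<Rightarrow> int"
  assumes fin: "finite_measure M" and T: "measure_preserving M T"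
    and erg: "\<And>A. A \<in> sets M \<Longrightarrow> (\<And>x. x \<in> space M \<Longrightarrow> T x \<in> A \<longleftrightarrow> x \<in> A) \<Longrightarrow>
        emeasure M A = 0 \<or> emeasure M (space M - A) = 0"
    and D: "D \<in> measurable M (count_space UNIV)" "\<And>x. x \<in> space M \<Longrightarrow> \<bar>D x\<bar> \<le> C"
    and mean: "(\<integral>x. real_of_int (D x) \<partial>M) = 0"
  shows "AE x in M. \<exists>n\<ge>1. (\<Sum>i<n. D ((T ^^ i) x)) \<le> 0"
proof -
  interpret finite_measure M by fact
  have Tm [measurable]: "(T ^^ i) \<in> measurable M M" for i
    using measure_preserving_measurable[OF measure_preserving_funpow[OF T]] .
  have Tsp: "T x \<in> space M" if "x \<in> space M" for x
    using measurable_space[OF Tm[of 1] that] by simp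
  note [measurable] = D(1)
  define S where "S n x = (\<Sum>i<n. D ((T ^^ i) x))" for n x
  have [measurable]: "S n \<in> measurable M (count_space UNIV)" for n
    unfolding S_def
  proof (induction n)
    case (Suc n)
    have "(\<lambda>x. D ((T ^^ n) x)) \<in> measurable M (count_space UNIV)" by measurable
    with Suc show ?case using measurable_discrete2[of _ M _ "(+)"] by (simp add: lessThan_Suc add.commute)
  qed simp
  have S_Suc: "S (Suc n) x = D x + S n (T x)" for n x
    unfolding S_def by (simp add: sum.lessThan_Suc_shift funpow_Suc_right del: funpow.simps sum.lessThan_Suc)
  define Z where "Z = {x \<in> space M. \<forall>n\<ge>1. 1 \<le> S n x}"
  \<comment> \<open>Boundedness from below is unaffected by dropping the bounded first term, so this
    set is invariant and contains \<open>Z\<close>; ergodicity then makes it full as soon as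
    \<open>Z\<close> has positive measure.\<close>
  define E where "E = {x \<in> space M. \<exists>b::nat. \<forall>n. - int b \<le> S n x}"
  have [measurable]: "Z \<in> sets M" "E \<in> sets M" unfolding Z_def E_def by measurable
  have S0: "S 0 x = 0" for x by (simp add: S_def)
  have ZE: "Z \<subseteq> E"
  proof
    fix x assume x: "x \<in> Z"
    have "- int 0 \<le> S n x" for n
    proof (cases "n = 0")
      case False
      then have "1 \<le> n" by simp
      then have "1 \<le> S n x" using x unfolding Z_def by blast
      then show ?thesis by linarith
    qed (simp add: S0)
    then show "x \<in> E" using x unfolding E_def Z_def by blast
  qed
  have TE: "T x \<in> E \<longleftrightarrow> x \<in> E" if x: "x \<in> space M" for x
  proof
    assume "T x \<in> E"
    then obtain b :: nat where b: "\<And>n. - int b \<le> S n (T x)" unfolding E_def by blast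
    have "- (int b + \<bar>C\<bar>) \<le> S n x" for n
    proof (cases n)
      case (Suc m)
      show ?thesis unfolding Suc using b[of m] D(2)[OF x] S_Suc[of m x] by linarith
    qed (simp add: S0)
    then have "\<forall>n. - int (b + nat \<bar>C\<bar>) \<le> S n x" by simp
    then show "x \<in> E" using x unfolding E_def by blast
  next
    assume "x \<in> E"
    then obtain b :: nat where b: "\<And>n. - int b \<le> S n x" unfolding E_def by blast
    have "- (int b + \<bar>C\<bar>) \<le> S n (T x)" for n
      using b[of "Suc n"] D(2)[OF x] S_Suc[of n x] by linarith
    then have "\<forall>n. - int (b + nat \<bar>C\<bar>) \<le> S n (T x)" by simp
    then show "T x \<in> E" using Tsp[OF x] unfolding E_def by blast
  qed
  have "emeasure M Z = 0"
  proof (rule ccontr)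
    assume Z0: "emeasure M Z \<noteq> 0"
    then have "emeasure M E \<noteq> 0" using emeasure_mono[OF ZE, of M] by (auto simp: \<open>E \<in> sets M\<close>)
    then have "emeasure M (space M - E) = 0" using erg[of E] TE by auto
    then have "space M - E \<in> null_sets M" by (intro null_setsI) auto
    then have EE: "AE x in M. x \<in> E" by (rule AE_I') auto
    define b where "b x = (LEAST b::nat. \<forall>n. - int b \<le> S n x)" for x
    have b: "- int (b x) \<le> S n x" if "x \<in> E" for x n
    proof -
      have "\<exists>b::nat. \<forall>n. - int b \<le> S n x" using that unfolding E_def by blast
      then have "\<forall>n. - int (b x) \<le> S n x" unfolding b_def by (rule LeastI_ex)
      then show ?thesis by blast
    qed
    have b_le: "b x \<le> m" if "\<And>n. - int m \<le> S n x" for x m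
      unfolding b_def using that by (intro Least_le) blast
    define f where "f x = real_of_int (D x) - indicator Z x" for x
    define h where "h x = (if x \<in> E then real (b x) else 0)" for x
    have bm [measurable]: "b \<in> measurable M (count_space UNIV)"
      unfolding b_def by measurable
    have hm: "h \<in> borel_measurable M"
      unfolding h_def by measurable
    \<comment> \<open>Dropping the first term shifts all later sums by \<open>D x\<close>. On
      \<open>Z\<close> the later sums are at least 1 while the empty sum is 0, so the infimum over
      the later sums alone improves by one more unit: this is the indicator in
      \<open>f\<close>.\<close>
    have step: "h (T x) \<le> h x + f x" if x: "x \<in> E" for x
    proof -
      have xs: "x \<in> space M" using x by (simp add: E_def)
      have Tx: "T x \<in> E" using TE[OF xs] x by simp
      have D1: "- int (b x) \<le> D x" using b[OF x, of 1] by (simp add: S_def)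
      have "int (b (T x)) \<le> int (b x) + D x - (if x \<in> Z then 1 else 0)"
      proof (cases "x \<in> Z")
        case False
        have "b (T x) \<le> nat (int (b x) + D x)"
        proof (rule b_le)
          fix n show "- int (nat (int (b x) + D x)) \<le> S n (T x)"
            using b[OF x, of "Suc n"] D1 by (simp add: S_Suc)
        qed
        then show ?thesis using False D1 by simp
      next
        case True
        have D1: "1 \<le> D x" using True S_Suc[of 0 x] S0 unfolding Z_def by force
        have "b (T x) \<le> nat (D x - 1)"
        proof (rule b_le)
          fix n
          have "1 \<le> S (Suc n) x" using True unfolding Z_def by auto
          then show "- int (nat (D x - 1)) \<le> S n (T x)"
            using D1 by (simp add: S_Suc)
        qed
        then show ?thesis using True D1 by simp
      qed
      then have "real_of_int (int (b (T x))) \<le> real_of_int (int (b x) + D x - (if x \<in> Z then 1 else 0))"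
        by (simp only: of_int_le_iff)
      then show ?thesis using x Tx by (simp add: h_def f_def indicator_def split: if_splits)
    qed
    have sums: "h ((T ^^ n) x) \<le> h x + (\<Sum>i<n. f ((T ^^ i) x)) \<and> (T ^^ n) x \<in> E" if x: "x \<in> E" for x n
    proof (induction n)
      case (Suc n)
      then have E: "(T ^^ n) x \<in> E" by blast
      then show ?case using Suc step[OF E] TE[of "(T ^^ n) x"] by (auto simp: E_def)
    qed (use x in simp)
    have fm: "f \<in> borel_measurable M" unfolding f_def by measurable
    have "0 \<le> (\<integral>x. f x \<partial>M)"
    proof (rule integral_nonneg_of_sums_bounded_below[OF fin T fm _ hm, where C = "real_of_int C + 1"])
      fix x assume "x \<in> space M"
      then have "real_of_int \<bar>D x\<bar> \<le> real_of_int C" using D(2) by (simp only: of_int_le_iff)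
      then show "\<bar>f x\<bar> \<le> real_of_int C + 1" by (auto simp: f_def indicator_def)
    next
      show "0 \<le> h x" for x by (simp add: h_def)
      show "AE x in M. \<forall>n. - h x \<le> (\<Sum>i<n. f ((T ^^ i) x))"
        using EE
      proof eventually_elim
        fix x assume x: "x \<in> E"
        have "0 \<le> h y" for y by (simp add: h_def)
        then show "\<forall>n. - h x \<le> (\<Sum>i<n. f ((T ^^ i) x))"
          using sums[OF x] by (smt (verit, best))
      qed
    qed
    also have "(\<integral>x. f x \<partial>M) = (\<integral>x. real_of_int (D x) \<partial>M) - measure M Z"
    proof -
      have "\<bar>real_of_int (D x)\<bar> \<le> real_of_int C" if "x \<in> space M" for x
        using D(2)[OF that] by (metis of_int_abs of_int_le_iff)
      then have "integrable M (\<lambda>x. real_of_int (D x))"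
        by (intro integrable_const_bound[of _ "real_of_int C"]) auto
      moreover have "integrable M (indicator Z :: 'a \<Rightarrow> real)"
        using \<open>Z \<in> sets M\<close> by (intro integrable_real_indicator) (auto simp: less_top[symmetric])
      ultimately show ?thesis unfolding f_def
        by (subst Bochner_Integration.integral_diff) (auto simp: Int_absorb1 sets.sets_into_space)
    qed
    finally have "measure M Z \<le> 0" using mean by simp
    then show False using Z0 by (simp add: emeasure_eq_measure measure_le_0_iff)
  qed
  then have "Z \<in> null_sets M" by (intro null_setsI) auto
  then show ?thesis
  proof (rule AE_I')
    show "{x \<in> space M. \<not> (\<exists>n\<ge>1. (\<Sum>i<n. D ((T ^^ i) x)) \<le> 0)} \<subseteq> Z"
      unfolding Z_def S_def by (auto simp only: not_le not_less int_one_le_iff_zero_less)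
  qed
qed

text \<open>The \<open>n\<close>-th images of the points of \<open>W\<close> that are in
  \<open>C\<close> at time \<open>n\<close> would be disjoint parts of \<open>C\<close>. Pulling all
  of them back to the common time \<open>N\<close> says this with preimages only: the sets
  \<open>B n\<close> are disjoint because two of them would give a return to \<open>W\<close>, and
  all lie in the preimage of \<open>C\<close> under \<open>T ^^ N\<close>.\<close>

lemma wandering_sum_le:
  assumes T: "measure_preserving M T" and W: "W \<in> sets M" and C: "C \<in> sets M"
    and wand: "\<And>x n. x \<in> W \<Longrightarrow> n \<ge> 1 \<Longrightarrow> (T ^^ n) x \<notin> W"
  shows "(\<Sum>n\<le>N. emeasure M (W \<inter> ((T ^^ n) -` C \<inter> space M))) \<le> emeasure M C"
proof -
  have Tm: "(T ^^ i) \<in> measurable M M" for i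
    using measure_preserving_measurable[OF measure_preserving_funpow[OF T]] .
  define A where "A n = W \<inter> ((T ^^ n) -` C \<inter> space M)" for n
  have A: "A n \<in> sets M" for n unfolding A_def using W measurable_sets[OF Tm C] by auto
  define B where "B n = (T ^^ (N - n)) -` A n \<inter> space M" for n
  have B: "B n \<in> sets M" for n unfolding B_def by (rule measurable_sets[OF Tm A])
  have "(\<Sum>n\<le>N. emeasure M (A n)) = (\<Sum>n\<le>N. emeasure M (B n))"
    unfolding B_def using measure_preserving_emeasure[OF measure_preserving_funpow[OF T] A] by simp
  also have "\<dots> = emeasure M (\<Union>n\<in>{..N}. B n)"
  proof (rule sum_emeasure)
    have "B m \<inter> B n = {}" if mn: "m < n" "n \<le> N" for m n
    proof (rule ccontr)
      assume "B m \<inter> B n \<noteq> {}"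
      then obtain x where x: "x \<in> B m" "x \<in> B n" by blast
      have "(T ^^ (n - m)) ((T ^^ (N - n)) x) = (T ^^ (N - m)) x"
        using mn by (simp flip: funpow_add comp_apply[of "T ^^ (n - m)"])
      then have "(T ^^ (n - m)) ((T ^^ (N - n)) x) \<in> W" using x(1) by (simp add: B_def A_def)
      moreover have "(T ^^ (N - n)) x \<in> W" using x(2) by (simp add: B_def A_def)
      ultimately show False using wand[of "(T ^^ (N - n)) x" "n - m"] mn by auto
    qed
    then show "disjoint_family_on B {..N}"
      unfolding disjoint_family_on_def by (metis Int_commute atMost_iff linorder_neqE_nat)
  qed (use B in auto)
  also have "\<dots> \<le> emeasure M ((T ^^ N) -` C \<inter> space M)"
  proof (rule emeasure_mono)
    show "(\<Union>n\<in>{..N}. B n) \<subseteq> (T ^^ N) -` C \<inter> space M"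
    proof
      fix x assume "x \<in> (\<Union>n\<in>{..N}. B n)"
      then obtain n where n: "n \<le> N" "x \<in> B n" by auto
      have "(T ^^ n) ((T ^^ (N - n)) x) = (T ^^ N) x"
        using n by (simp flip: funpow_add comp_apply[of "T ^^ n"])
      then show "x \<in> (T ^^ N) -` C \<inter> space M" using n(2) by (simp add: B_def A_def)
    qed
    show "(T ^^ N) -` C \<inter> space M \<in> sets M" by (rule measurable_sets[OF Tm C])
  qed
  also have "\<dots> = emeasure M C" by (rule measure_preserving_emeasure[OF measure_preserving_funpow[OF T] C])
  finally show ?thesis unfolding A_def .
qed

text \<open>The visits to \<open>C\<close> have finite total measure by
  \<open>wandering_sum_le\<close>, so Borel-Cantelli makes them finite in number along almost every
  orbit from \<open>W\<close>.\<close>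

lemma wandering_leaves:
  assumes T: "measure_preserving M T" and W: "W \<in> sets M" and C: "C \<in> sets M" "emeasure M C < \<infinity>"
    and wand: "\<And>x n. x \<in> W \<Longrightarrow> n \<ge> 1 \<Longrightarrow> (T ^^ n) x \<notin> W"
  shows "AE x in M. x \<in> W \<longrightarrow> (\<forall>\<^sub>F n in sequentially. (T ^^ n) x \<notin> C)"
proof -
  have Tm: "(T ^^ i) \<in> measurable M M" for i
    using measure_preserving_measurable[OF measure_preserving_funpow[OF T]] .
  define A where "A n = W \<inter> ((T ^^ n) -` C \<inter> space M)" for n
  have A: "A n \<in> sets M" for n unfolding A_def using W measurable_sets[OF Tm C(1)] by auto
  have le: "(\<Sum>n\<le>N. emeasure M (A n)) \<le> emeasure M C" for N
    unfolding A_def by (rule wandering_sum_le[OF T W C(1) wand])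
  have fin: "emeasure M (A n) < \<infinity>" for n
  proof -
    have "emeasure M (A n) \<le> (\<Sum>n\<le>n. emeasure M (A n))" by (rule member_le_sum) auto
    then show ?thesis using le[of n] C(2) by (meson order.strict_trans1)
  qed
  have "(\<Sum>n\<le>N. measure M (A n)) \<le> measure M C" for N
  proof -
    have "ennreal (\<Sum>n\<le>N. measure M (A n)) = (\<Sum>n\<le>N. emeasure M (A n))"
    proof -
      have "emeasure M (A n) = ennreal (measure M (A n))" for n
        using fin[of n] by (intro emeasure_eq_ennreal_measure) auto
      then show ?thesis by (simp add: sum_ennreal)
    qed
    also have "\<dots> \<le> ennreal (measure M C)"
      using le C(2) by (simp add: emeasure_eq_ennreal_measure)
    finally show ?thesis by (subst (asm) ennreal_le_iff) auto
  qed
  then have "summable (\<lambda>n. measure M (A n))"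
    by (intro bounded_imp_summable[of _ "measure M C"]) auto
  then have "AE x in M. eventually (\<lambda>n. x \<in> space M - A n) sequentially"
    using A fin by (intro borel_cantelli_AE1) auto
  then show ?thesis
    by (rule eventually_mono) (auto simp: A_def elim: eventually_mono)
qed

text \<open>This is how smallness is transferred: a set through which the whole of \<open>W\<close>
  passes is at least as large as \<open>W\<close>, wherever it lies and however late the visits
  are.\<close>

lemma wandering_measure_le:
  assumes T: "measure_preserving M T" and W: "W \<in> sets M" and C: "C \<in> sets M"
    and wand: "\<And>x n. x \<in> W \<Longrightarrow> n \<ge> 1 \<Longrightarrow> (T ^^ n) x \<notin> W"
    and hit: "AE x in M. x \<in> W \<longrightarrow> (\<exists>n. (T ^^ n) x \<in> C)"
  shows "emeasure M W \<le> emeasure M C"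
proof -
  have Tm: "(T ^^ i) \<in> measurable M M" for i
    using measure_preserving_measurable[OF measure_preserving_funpow[OF T]] .
  define A where "A n = W \<inter> ((T ^^ n) -` C \<inter> space M)" for n
  have A: "A n \<in> sets M" for n unfolding A_def using W measurable_sets[OF Tm C(1)] by auto
  have "emeasure M W \<le> emeasure M (\<Union>n. A n)"
  proof (rule emeasure_mono_AE)
    show "AE x in M. x \<in> W \<longrightarrow> x \<in> (\<Union>n. A n)"
      using hit AE_space by eventually_elim (auto simp: A_def)
  qed (use A in auto)
  also have "\<dots> \<le> (\<Sum>n. emeasure M (A n))"
    using A by (intro emeasure_subadditive_countably) auto
  also have "\<dots> \<le> emeasure M C"
  proof (rule suminf_le_const)
    fix N
    have "(\<Sum>n<N. emeasure M (A n)) \<le> (\<Sum>n\<le>N. emeasure M (A n))"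
      by (rule sum_mono2) auto
    also have "\<dots> \<le> emeasure M C"
      unfolding A_def by (rule wandering_sum_le[OF T W C(1) wand])
    finally show "(\<Sum>n<N. emeasure M (A n)) \<le> emeasure M C" .
  qed (rule summableI)
  finally show ?thesis .
qed

definition conservative :: "'a measure \<Rightarrow> ('a \<Rightarrow> 'a) \<Rightarrow> bool" where
  "conservative M T \<longleftrightarrow>
    (\<forall>W\<in>sets M. (\<forall>x\<in>W. \<forall>n\<ge>1. (T ^^ n) x \<notin> W) \<longrightarrow> emeasure M W = 0)"

text \<open>The points of \<open>B\<close> that never return form a wandering, hence null set.
  Almost every orbit avoids it at all times, whereas a last visit to \<open>B\<close> would lie in
  it.\<close>

lemma conservative_infinitely_often:
  assumes T: "measure_preserving M T" and cons: "conservative M T" and B: "B \<in> sets M"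
  shows "AE x in M. x \<in> B \<longrightarrow> (\<exists>\<^sub>\<infinity>n. (T ^^ n) x \<in> B)"
proof -
  have Tm: "(T ^^ i) \<in> measurable M M" for i
    using measure_preserving_measurable[OF measure_preserving_funpow[OF T]] .
  define W where "W = B - (\<Union>n\<in>{1..}. (T ^^ n) -` B \<inter> space M)"
  have Ws: "W \<in> sets M"
    unfolding W_def using B measurable_sets[OF Tm B] by (intro sets.Diff sets.countable_UN') auto
  have Wiff: "x \<in> W \<longleftrightarrow> x \<in> B \<and> (\<forall>n\<ge>1. (T ^^ n) x \<notin> B)" for x
    unfolding W_def using sets.sets_into_space[OF B] by auto
  have "emeasure M W = 0"
    using cons Ws Wiff unfolding conservative_def by blast
  then have "W \<in> null_sets M" using Ws by auto
  then have "AE x in M. x \<notin> W" by (rule AE_not_in)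
  from measure_preserving_AE_funpow[OF T this] show ?thesis
  proof (rule eventually_mono, intro impI)
    fix x assume nW: "\<forall>n. (T ^^ n) x \<notin> W" and x: "x \<in> B"
    show "\<exists>\<^sub>\<infinity>n. (T ^^ n) x \<in> B"
    proof (rule ccontr)
      assume "\<not> ?thesis"
      then have fin: "finite {n. (T ^^ n) x \<in> B}" by (simp add: INFM_iff_infinite)
      define m where "m = Max {n. (T ^^ n) x \<in> B}"
      have ne: "{n. (T ^^ n) x \<in> B} \<noteq> {}" using x by (auto intro: exI[of _ 0])
      have m: "(T ^^ m) x \<in> B" using Max_in[OF fin ne] by (simp add: m_def)
      have "(T ^^ n) ((T ^^ m) x) \<notin> B" if "n \<ge> 1" for n
      proof
        assume "(T ^^ n) ((T ^^ m) x) \<in> B"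
        then have "(T ^^ (n + m)) x \<in> B" by (simp add: funpow_add)
        then have "n + m \<le> m" unfolding m_def using fin by (intro Max_ge) auto
        then show False using that by simp
      qed
      then show False using nW m Wiff by blast
    qed
  qed
qed

section \<open>Iterates of permutations\<close>

text \<open>The backward map is an argument because the staircase map is invertible only on
  \<open>{0..<1} \<times> UNIV\<close>, not on its whole type.\<close>

definition ziter :: "('a \<Rightarrow> 'a) \<Rightarrow> ('a \<Rightarrow> 'a) \<Rightarrow> int \<Rightarrow> 'a \<Rightarrow> 'a" where
  "ziter f g j = (if 0 \<le> j then f ^^ nat j else g ^^ nat (- j))"

definition zpow :: "('a \<Rightarrow> 'a) \<Rightarrow> int \<Rightarrow> 'a \<Rightarrow> 'a" where
  "zpow f = ziter f (inv f)"

lemma ziter_0 [simp]: "ziter f g 0 x = x"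
  by (simp add: ziter_def)

lemma ziter_plus_1:
  assumes S: "x \<in> S" "\<And>y. y \<in> S \<Longrightarrow> g y \<in> S" "\<And>y. y \<in> S \<Longrightarrow> f (g y) = y"
  shows "ziter f g (j + 1) x = f (ziter f g j x)"
proof (cases "0 \<le> j")
  case True
  then have "nat (j + 1) = Suc (nat j)" by simp
  then show ?thesis using True by (simp add: ziter_def)
next
  case False
  define m where "m = nat (- (j + 1))"
  have m: "nat (- j) = Suc m" using False by (simp add: m_def)
  have "(g ^^ m) x \<in> S" by (induction m) (use S in auto)
  then have "f (ziter f g j x) = (g ^^ m) x" using False S(3) by (simp add: ziter_def m)
  also have "\<dots> = ziter f g (j + 1) x" using False by (cases "j = - 1") (auto simp: ziter_def m_def)
  finally show ?thesis by simp
qed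

lemma zpow_0 [simp]: "zpow f 0 x = x"
  by (simp add: zpow_def)

lemma zpow_plus_1: "bij f \<Longrightarrow> zpow f (j + 1) x = f (zpow f j x)"
  unfolding zpow_def by (rule ziter_plus_1[of x UNIV]) (auto simp: bij_is_surj surj_f_inv_f)

lemma zpow_1: "zpow f 1 x = f x"
  by (simp add: zpow_def ziter_def)

lemma zpow_add: "bij f \<Longrightarrow> zpow f (i + j) x = zpow f i (zpow f j x)"
proof (induction i rule: int_induct[where k = 0])
  case (step1 i)
  then show ?case using zpow_plus_1[of f "i + j"] zpow_plus_1[of f i]
    by (simp add: algebra_simps)
next
  case (step2 i)
  have "f (zpow f (i - 1 + j) x) = f (zpow f (i - 1) (zpow f j x))"
    using step2 zpow_plus_1[of f "i - 1 + j" x] zpow_plus_1[of f "i - 1" "zpow f j x"]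
    by (simp add: algebra_simps)
  then show ?case using bij_is_inj[OF \<open>bij f\<close>] by (simp add: inj_eq)
qed simp

lemma zpow_uminus: "bij f \<Longrightarrow> zpow f (- j) (zpow f j x) = x"
  using zpow_add[of f "- j" j x] by simp

lemma bij_zpow: "bij f \<Longrightarrow> bij (zpow f j)"
  by (rule bij_betw_byWitness[where f' = "zpow f (- j)"])
    (use zpow_uminus[of f j] zpow_uminus[of f "- j"] in auto)

text \<open>One induction for both signs of the exponent: \<open>n\<close> counts the steps made, so
  \<open>P\<close> may express a bound that grows with every step.\<close>

lemma zpow_steps_induct:
  assumes "P 0 x" "\<And>n y. n < nat \<bar>j\<bar> \<Longrightarrow> P n y \<Longrightarrow> P (Suc n) (f y)"
    "\<And>n y. n < nat \<bar>j\<bar> \<Longrightarrow> P n y \<Longrightarrow> P (Suc n) (inv f y)"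
  shows "P (nat \<bar>j\<bar>) (zpow f j x)"
proof -
  have 1: "P n ((f ^^ n) x)" if "n \<le> nat \<bar>j\<bar>" for n using that by (induction n) (use assms in auto)
  have 2: "P n ((inv f ^^ n) x)" if "n \<le> nat \<bar>j\<bar>" for n using that by (induction n) (use assms in auto)
  show ?thesis using 1[of "nat \<bar>j\<bar>"] 2[of "nat \<bar>j\<bar>"]
    by (auto simp: zpow_def ziter_def)
qed

section \<open>Gluing permutations\<close>

definition zeros_unbounded :: "(int \<Rightarrow> bool) \<Rightarrow> bool" where
  "zeros_unbounded s \<longleftrightarrow> (\<forall>n. (\<exists>m\<ge>n. \<not> s m) \<and> (\<exists>m\<le>n. \<not> s m))"

text \<open>All rows and all columns are finite, so every edge is glued and the gluings are
  permutations of the labels.\<close>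

definition regular :: "(int \<Rightarrow> bool) \<Rightarrow> bool" where
  "regular s \<longleftrightarrow> zeros_unbounded s \<and> zeros_unbounded (\<lambda>n. \<not> s n)"

definition right_of :: "(int \<Rightarrow> bool) \<Rightarrow> int \<Rightarrow> int" where
  "right_of s n = (THE m. glued_right s n m)"

text \<open>Reflection in the diagonal exchanges the two symbols; whatever is proved for rows then
  holds for columns.\<close>

definition above :: "(int \<Rightarrow> bool) \<Rightarrow> int \<Rightarrow> int" where
  "above s = right_of (\<lambda>n. \<not> s n)"

lemma glued_top_eq: "glued_top s = glued_right (\<lambda>n. \<not> s n)"
  by (auto simp: glued_top_def glued_right_def finite_row_def finite_column_def fun_eq_iff)

lemma glued_right_unique: "glued_right s n m \<Longrightarrow> glued_right s n m' \<Longrightarrow> m = m'"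
proof (induction m m' rule: linorder_wlog)
  case (le m m')
  show ?case
  proof (rule ccontr)
    assume "m \<noteq> m'"
    then have "m < m'" using le(1) by simp
    then show False using le(2,3)
      unfolding glued_right_def finite_row_def
      by (metis add1_zle_eq diff_add_cancel le_diff_eq less_irrefl order_le_less order_trans zle_diff1_eq zless_add1_eq)
  qed
qed simp

lemma glued_right_unique_left: "glued_right s n m \<Longrightarrow> glued_right s n' m \<Longrightarrow> n = n'"
proof (induction n n' rule: linorder_wlog)
  case (le n n')
  show ?case
  proof (rule ccontr)
    assume "n \<noteq> n'"
    then have "n < n'" using le(1) by simp
    then show False using le(2,3) unfolding glued_right_def finite_row_def by force
  qed
qed simp

lemma glued_right_exists:
  assumes "zeros_unbounded s"
  shows "\<exists>m. glued_right s n m"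
proof (cases "s n")
  case False
  obtain l where l: "l \<le> n - 1" "\<not> s l" using assms unfolding zeros_unbounded_def by blast
  define k where "k = (LEAST k::nat. \<not> s (n - 1 - int k))"
  have "\<not> s (n - 1 - int (nat (n - 1 - l)))" using l by simp
  then have k: "\<not> s (n - 1 - int k)" unfolding k_def by (rule LeastI)
  have "s i" if "n - int k \<le> i" "i < n" for i
  proof -
    have "nat (n - 1 - i) < k" using that by linarith
    then have "s (n - 1 - int (nat (n - 1 - i)))" unfolding k_def using not_less_Least by blast
    then show ?thesis using that by simp
  qed
  then have "glued_right s n (n - int k)"
    using k False unfolding glued_right_def finite_row_def by (auto simp: algebra_simps)
  then show ?thesis by blast
qed (auto simp: glued_right_def)

lemma glued_right_exists_left:
  assumes "zeros_unbounded s"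
  shows "\<exists>n. glued_right s n m"
proof (cases "s (m - 1)")
  case False
  obtain l where l: "l \<ge> m" "\<not> s l" using assms unfolding zeros_unbounded_def by blast
  define k where "k = (LEAST k::nat. \<not> s (m + int k))"
  have "\<not> s (m + int (nat (l - m)))" using l by simp
  then have k: "\<not> s (m + int k)" unfolding k_def by (rule LeastI)
  have "s i" if "m \<le> i" "i < m + int k" for i
  proof -
    have "nat (i - m) < k" using that by linarith
    then have "s (m + int (nat (i - m)))" unfolding k_def using not_less_Least by blast
    then show ?thesis using that by simp
  qed
  then have "glued_right s (m + int k) m"
    using k False unfolding glued_right_def finite_row_def by auto
  then show ?thesis by blast
next
  case True
  then have "glued_right s (m - 1) m" by (auto simp: glued_right_def)
  then show ?thesis by blast
qed

lemma right_of_eq_iff: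
  assumes "zeros_unbounded s"
  shows "right_of s n = m \<longleftrightarrow> glued_right s n m"
  unfolding right_of_def
  using glued_right_exists[OF assms, of n] glued_right_unique[of s n] by (metis (no_types, lifting) the_equality)

lemma bij_right_of:
  assumes "zeros_unbounded s"
  shows "bij (right_of s)"
proof (rule bijI)
  show "inj (right_of s)"
    by (rule injI) (metis assms glued_right_unique_left right_of_eq_iff)
  show "surj (right_of s)"
    unfolding surj_def by (metis assms glued_right_exists_left right_of_eq_iff)
qed

lemma inv_right_of_eq_iff:
  assumes "zeros_unbounded s"
  shows "inv (right_of s) m = n \<longleftrightarrow> glued_right s n m"
  using bij_right_of[OF assms] right_of_eq_iff[OF assms]
  by (metis bij_inv_eq_iff)

text \<open>A window with both symbols stops rows as well as columns, so no gluing jumps across it.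
  The condition is symmetric in the two symbols, which suits the reflection above.\<close>

definition mixed :: "(int \<Rightarrow> bool) \<Rightarrow> int \<Rightarrow> int \<Rightarrow> bool" where
  "mixed s N x \<longleftrightarrow> (\<exists>z\<in>{x..<x + N}. s z) \<and> (\<exists>z\<in>{x..<x + N}. \<not> s z)"

lemma mixed_compl: "mixed (\<lambda>n. \<not> s n) N x \<longleftrightarrow> mixed s N x"
  by (auto simp: mixed_def)

text \<open>A row ends at the first zero after its start, so the zero \<open>z\<close> stops every
  row that begins below \<open>e\<close>; the other gluings move the label by one only.
  \<open>glued_right_down\<close> is the mirror image.\<close>

lemma glued_right_up:
  assumes g: "glued_right s n m" and z: "e \<le> z" "z < e + N" "\<not> s z"
  shows "n < e \<Longrightarrow> m < e + N" "m < e \<Longrightarrow> n < e + N"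
proof -
  show "n < e \<Longrightarrow> m < e + N" using g z unfolding glued_right_def finite_row_def by auto
  assume me: "m < e"
  show "n < e + N"
  proof (rule ccontr)
    assume "\<not> n < e + N"
    then show False using g z me unfolding glued_right_def finite_row_def by auto
  qed
qed

lemma glued_right_down:
  assumes g: "glued_right s n m" and z: "e - N < z" "z \<le> e" "\<not> s z"
  shows "e < n \<Longrightarrow> e - N < m" "e < m \<Longrightarrow> e - N < n"
proof -
  show "e < m \<Longrightarrow> e - N < n" using g z unfolding glued_right_def finite_row_def by auto
  assume me: "e < n"
  show "e - N < m"
  proof (rule ccontr)
    assume "\<not> e - N < m"
    then show False using g z me unfolding glued_right_def finite_row_def by force
  qed
qed

lemma right_of_up:
  assumes s: "zeros_unbounded s" and mx: "mixed s N e" and i: "i < e"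
  shows "right_of s i < e + N" "inv (right_of s) i < e + N"
proof -
  obtain z where z: "e \<le> z" "z < e + N" "\<not> s z" using mx by (auto simp: mixed_def)
  have "glued_right s i (right_of s i)" using right_of_eq_iff[OF s] by blast
  then show "right_of s i < e + N" using glued_right_up(1)[of s i _ e z N] z i by blast
  have "glued_right s (inv (right_of s) i) i" using inv_right_of_eq_iff[OF s] by blast
  then show "inv (right_of s) i < e + N" using glued_right_up(2)[of s _ i e z N] z i by blast
qed

lemma right_of_down:
  assumes s: "zeros_unbounded s" and mx: "mixed s N (e - N + 1)" and i: "e < i"
  shows "e - N < right_of s i" "e - N < inv (right_of s) i"
proof -
  obtain z where z: "e - N < z" "z \<le> e" "\<not> s z" using mx by (force simp: mixed_def)
  have "glued_right s i (right_of s i)" using right_of_eq_iff[OF s] by blast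
  then show "e - N < right_of s i" using glued_right_down(1)[of s i _ e N z] z i by blast
  have "glued_right s (inv (right_of s) i) i" using inv_right_of_eq_iff[OF s] by blast
  then show "e - N < inv (right_of s) i" using glued_right_down(2)[of s _ i e N z] z i by blast
qed

text \<open>A trajectory crossing one horizontal edge and, before that, \<open>j\<close> vertical edges.\<close>

definition climb :: "(int \<Rightarrow> bool) \<Rightarrow> int \<Rightarrow> int \<Rightarrow> int" where
  "climb s j k = above s (zpow (right_of s) j k)"

lemma bij_above: "regular s \<Longrightarrow> bij (above s)"
  unfolding above_def regular_def by (simp add: bij_right_of)

lemma bij_climb: "regular s \<Longrightarrow> bij (climb s j)"
proof -
  assume s: "regular s"
  have "climb s j = above s \<circ> zpow (right_of s) j" by (simp add: climb_def fun_eq_iff)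
  moreover have "bij (above s \<circ> zpow (right_of s) j)"
    by (rule bij_comp[OF bij_zpow bij_above[OF s]]) (use s in \<open>simp add: regular_def bij_right_of\<close>)
  ultimately show ?thesis by simp
qed

text \<open>Each crossing overshoots by at most one mixed window of length \<open>N\<close>, and
  there are at most \<open>J\<close> horizontal crossings and one vertical crossing. Windows above
  \<open>e\<close> are needed because every crossing may start from the place that the previous one
  reached.\<close>

lemma climb_up:
  assumes s: "regular s" and N: "N \<ge> 0" and J: "\<bar>j\<bar> \<le> J"
    and mx: "\<And>x. e \<le> x \<Longrightarrow> x \<le> e + J * N \<Longrightarrow> mixed s N x" and i: "i < e"
  shows "climb s j i < e + (J + 1) * N"
proof -
  have sz: "zeros_unbounded s" "zeros_unbounded (\<lambda>n. \<not> s n)" using s by (auto simp: regular_def)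
  have mx': "mixed s N (e + int n * N)" if "n \<le> nat \<bar>j\<bar>" for n
  proof (rule mx)
    have "int n \<le> J" using that J by linarith
    then show "e + int n * N \<le> e + J * N" using N by (simp add: mult_right_mono)
  qed (use N in simp)
  have "zpow (right_of s) j i < e + int (nat \<bar>j\<bar>) * N"
  proof (rule zpow_steps_induct[where P = "\<lambda>n y. y < e + int n * N"])
    fix n y assume n: "n < nat \<bar>j\<bar>" and y: "y < e + int n * N"
    show "right_of s y < e + int (Suc n) * N" "inv (right_of s) y < e + int (Suc n) * N"
      using right_of_up[OF sz(1) mx' y] n by (auto simp: algebra_simps)
  qed (use i in simp)
  moreover have "mixed (\<lambda>n. \<not> s n) N (e + int (nat \<bar>j\<bar>) * N)"
    unfolding mixed_compl by (rule mx') simp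
  ultimately have "climb s j i < e + int (nat \<bar>j\<bar>) * N + N"
    unfolding climb_def above_def by (intro right_of_up(1)[OF sz(2)])
  also have "\<dots> \<le> e + (J + 1) * N"
  proof -
    have "int (nat \<bar>j\<bar>) * N \<le> J * N" using J N by (intro mult_right_mono) auto
    then show ?thesis by (simp add: algebra_simps)
  qed
  finally show ?thesis .
qed

lemma climb_down:
  assumes s: "regular s" and N: "N \<ge> 0" and J: "\<bar>j\<bar> \<le> J"
    and mx: "\<And>x. e - (J + 1) * N < x \<Longrightarrow> x \<le> e + 1 \<Longrightarrow> mixed s N x" and i: "e < i"
  shows "e - (J + 1) * N < climb s j i"
proof -
  have sz: "zeros_unbounded s" "zeros_unbounded (\<lambda>n. \<not> s n)" using s by (auto simp: regular_def)
  have mx': "mixed s N (e - int n * N - N + 1)" if "n \<le> nat \<bar>j\<bar>" for n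
  proof (rule mx)
    have "int n \<le> J" using that J by linarith
    then have "int n * N \<le> J * N" using N by (simp add: mult_right_mono)
    then show "e - (J + 1) * N < e - int n * N - N + 1" by (simp add: algebra_simps)
    have "0 \<le> int n * N" using N by simp
    then show "e - int n * N - N + 1 \<le> e + 1" using N by linarith
  qed
  have "e - int (nat \<bar>j\<bar>) * N < zpow (right_of s) j i"
  proof (rule zpow_steps_induct[where P = "\<lambda>n y. e - int n * N < y"])
    fix n y assume n: "n < nat \<bar>j\<bar>" and y: "e - int n * N < y"
    show "e - int (Suc n) * N < right_of s y" "e - int (Suc n) * N < inv (right_of s) y"
      using right_of_down[OF sz(1) mx' y] n by (auto simp: algebra_simps)
  qed (use i in simp)
  moreover have "mixed (\<lambda>n. \<not> s n) N (e - int (nat \<bar>j\<bar>) * N - N + 1)"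
    unfolding mixed_compl by (rule mx') simp
  ultimately have "e - int (nat \<bar>j\<bar>) * N - N < climb s j i"
    unfolding climb_def above_def by (intro right_of_down(1)[OF sz(2)])
  moreover have "e - (J + 1) * N \<le> e - int (nat \<bar>j\<bar>) * N - N"
  proof -
    have "int (nat \<bar>j\<bar>) * N \<le> J * N" using J N by (intro mult_right_mono) auto
    then show ?thesis by (simp add: algebra_simps)
  qed
  ultimately show ?thesis by linarith
qed

section \<open>Locality of the gluings\<close>

lemma mixed_imp_zeros_unbounded:
  assumes "\<And>x. mixed p N x"
  shows "zeros_unbounded p"
  unfolding zeros_unbounded_def
proof (intro allI conjI)
  fix n
  show "\<exists>m\<ge>n. \<not> p m" using assms[of n] by (auto simp: mixed_def)
  obtain z where "z \<in> {n - N..<n - N + N}" "\<not> p z" using assms[of "n - N"] by (auto simp: mixed_def)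
  then show "\<exists>m\<le>n. \<not> p m" by (intro exI[of _ z]) auto
qed

lemma mixed_imp_regular: "(\<And>x. mixed p N x) \<Longrightarrow> regular p"
  using mixed_imp_zeros_unbounded[of p N] mixed_imp_zeros_unbounded[of "\<lambda>n. \<not> p n" N]
  by (simp add: regular_def mixed_compl)

lemma glued_right_near:
  assumes mx: "\<And>x. mixed p N x" and g: "glued_right p n m"
  shows "\<bar>m - n\<bar> \<le> N"
proof -
  have N: "N > 0" using mx[of 0] by (auto simp: mixed_def)
  obtain z where z: "z \<in> {n - N..<n - N + N}" "\<not> p z" using mx[of "n - N"] by (auto simp: mixed_def)
  have "n - N \<le> m"
  proof (rule ccontr)
    assume "\<not> n - N \<le> m"
    then show False using g z unfolding glued_right_def finite_row_def by auto
  qed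
  moreover have "m \<le> n + 1" using g unfolding glued_right_def finite_row_def by auto
  ultimately show ?thesis using N by auto
qed

text \<open>The gluing at \<open>k\<close> reads the symbols of one row within distance
  \<open>N\<close>, and in addition the symbol just before that row, which is the reason for the
  \<open>+ 1\<close>.\<close>

lemma right_of_local:
  assumes mx: "\<And>x. mixed p N x" and s: "zeros_unbounded s"
    and agree: "\<And>i. \<bar>i\<bar> \<le> H \<Longrightarrow> s (c + i) = p i" and k: "\<bar>k\<bar> + N + 1 \<le> H"
  shows "right_of s (c + k) = c + right_of p k" "inv (right_of s) (c + k) = c + inv (right_of p) k"
    "\<bar>right_of p k - k\<bar> \<le> N" "\<bar>inv (right_of p) k - k\<bar> \<le> N"
proof -
  have p: "zeros_unbounded p" using mixed_imp_zeros_unbounded[OF mx] .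
  have loc: "glued_right s (c + n) (c + m)"
    if g: "glued_right p n m" and nm: "\<bar>n\<bar> \<le> H" "\<bar>m\<bar> + 1 \<le> H" for n m
  proof -
    have "s (c + n) = p n" "s (c + m - 1) = p (m - 1)"
      using agree[of n] agree[of "m - 1"] nm by (auto simp: algebra_simps)
    moreover have "s i = p (i - c)" if "c + m \<le> i" "i < c + n" for i
      using agree[of "i - c"] that nm by auto
    ultimately show ?thesis
      using g unfolding glued_right_def finite_row_def by auto
  qed
  have g1: "glued_right p k (right_of p k)" using right_of_eq_iff[OF p] by blast
  have g2: "glued_right p (inv (right_of p) k) k" using inv_right_of_eq_iff[OF p] by blast
  show b: "\<bar>right_of p k - k\<bar> \<le> N" "\<bar>inv (right_of p) k - k\<bar> \<le> N"
    using glued_right_near[OF mx g1] glued_right_near[OF mx g2] by auto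
  show "right_of s (c + k) = c + right_of p k"
    unfolding right_of_eq_iff[OF s] using g1 b k by (intro loc) auto
  show "inv (right_of s) (c + k) = c + inv (right_of p) k"
    unfolding inv_right_of_eq_iff[OF s] using g2 b k by (intro loc) auto
qed

text \<open>Each of the at most \<open>J + 1\<close> crossings drifts by at most \<open>N\<close>,
  so the crossings stay inside the stretch where \<open>s\<close> copies \<open>p\<close> and
  \<open>right_of_local\<close> applies to each of them.\<close>

lemma climb_local:
  assumes mx: "\<And>x. mixed p N x" and s: "regular s" and J: "\<bar>j\<bar> \<le> J"
    and agree: "\<And>i. \<bar>i\<bar> \<le> H \<Longrightarrow> s (c + i) = p i" and k: "\<bar>k\<bar> + (J + 1) * N + 1 \<le> H"
  shows "climb s j (c + k) = c + climb p j k" "\<bar>climb p j k - k\<bar> \<le> (J + 1) * N"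
proof -
  have sz: "zeros_unbounded s" "zeros_unbounded (\<lambda>n. \<not> s n)" using s by (auto simp: regular_def)
  have N: "N > 0" using mx[of 0] by (auto simp: mixed_def)
  have small: "\<bar>l\<bar> + N + 1 \<le> H" if "\<bar>l - k\<bar> \<le> int n * N" "n \<le> nat \<bar>j\<bar>" for l n
  proof -
    have "int n * N \<le> J * N" using that J N by (intro mult_right_mono) auto
    then show ?thesis using that k by (simp add: algebra_simps)
  qed
  let ?P = "\<lambda>n (y, y'). y = c + y' \<and> \<bar>y' - k\<bar> \<le> int n * N"
  have pos: "?P n ((right_of s ^^ n) (c + k), (right_of p ^^ n) k)" if "n \<le> nat \<bar>j\<bar>" for n
    using that
  proof (induction n)
    case (Suc n)
    then have y: "(right_of s ^^ n) (c + k) = c + (right_of p ^^ n) k"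
      and b: "\<bar>(right_of p ^^ n) k - k\<bar> \<le> int n * N" by auto
    have "\<bar>(right_of p ^^ n) k\<bar> + N + 1 \<le> H" using small[OF b] Suc by simp
    from right_of_local[OF mx sz(1) agree this] show ?case
      using b y by (simp add: algebra_simps)
  qed simp
  have neg: "?P n ((inv (right_of s) ^^ n) (c + k), (inv (right_of p) ^^ n) k)" if "n \<le> nat \<bar>j\<bar>" for n
    using that
  proof (induction n)
    case (Suc n)
    then have y: "(inv (right_of s) ^^ n) (c + k) = c + (inv (right_of p) ^^ n) k"
      and b: "\<bar>(inv (right_of p) ^^ n) k - k\<bar> \<le> int n * N" by auto
    have "\<bar>(inv (right_of p) ^^ n) k\<bar> + N + 1 \<le> H" using small[OF b] Suc by simp
    from right_of_local[OF mx sz(1) agree this] show ?case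
      using b y by (simp add: algebra_simps)
  qed simp
  have "?P (nat \<bar>j\<bar>) (zpow (right_of s) j (c + k), zpow (right_of p) j k)"
    using pos[of "nat \<bar>j\<bar>"] neg[of "nat \<bar>j\<bar>"]
    unfolding zpow_def ziter_def by (cases "0 \<le> j") auto
  then have z: "zpow (right_of s) j (c + k) = c + zpow (right_of p) j k"
    and b: "\<bar>zpow (right_of p) j k - k\<bar> \<le> int (nat \<bar>j\<bar>) * N" by auto
  have mx': "mixed (\<lambda>n. \<not> p n) N x" for x using mx by (simp add: mixed_compl)
  have "\<bar>zpow (right_of p) j k\<bar> + N + 1 \<le> H" by (rule small[OF b]) simp
  note loc = right_of_local[OF mx' sz(2) _ this, of c]
  have "\<bar>i\<bar> \<le> H \<Longrightarrow> (\<not> s (c + i)) = (\<not> p i)" for i using agree by blast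
  note loc = loc[OF this]
  show "climb s j (c + k) = c + climb p j k"
    using loc(1) by (simp add: climb_def above_def z)
  have "int (nat \<bar>j\<bar>) * N \<le> J * N" using J N by (intro mult_right_mono) auto
  then show "\<bar>climb p j k - k\<bar> \<le> (J + 1) * N"
    using loc(3) b by (simp add: climb_def above_def algebra_simps)
qed

section \<open>Periodic staircases\<close>

definition equivariant :: "int \<Rightarrow> (int \<Rightarrow> int) \<Rightarrow> bool" where
  "equivariant N f \<longleftrightarrow> (\<forall>k. f (k + N) = f k + N)"

lemma equivariant_inv: "bij f \<Longrightarrow> equivariant N f \<Longrightarrow> equivariant N (inv f)"
  unfolding equivariant_def by (metis bij_inv_eq_iff)

lemma equivariant_funpow: "equivariant N f \<Longrightarrow> equivariant N (f ^^ n)"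
  by (induction n) (auto simp: equivariant_def)

lemma equivariant_zpow: "bij f \<Longrightarrow> equivariant N f \<Longrightarrow> equivariant N (zpow f j)"
  unfolding zpow_def ziter_def by (simp add: equivariant_funpow equivariant_inv)

lemma equivariant_compose: "equivariant N f \<Longrightarrow> equivariant N g \<Longrightarrow> equivariant N (\<lambda>k. f (g k))"
  by (auto simp: equivariant_def)

lemma equivariant_mult:
  assumes "equivariant N f"
  shows "f (k + t * N) = f k + t * N"
proof (induction t rule: int_induct[where k = 0])
  case (step1 t)
  then show ?case using assms[unfolded equivariant_def, rule_format, of "k + t * N"]
    by (simp add: algebra_simps)
next
  case (step2 t)
  then show ?case using assms[unfolded equivariant_def, rule_format, of "k + (t - 1) * N"]
    by (simp add: algebra_simps)
qed simp

lemma equivariant_mod: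
  assumes "equivariant N f"
  shows "f (k mod N) = f k - (k div N) * N" "f (k mod N) mod N = f k mod N"
    "f (k mod N) - k mod N = f k - k"
proof -
  have "f (k mod N + (k div N) * N) = f (k mod N) + (k div N) * N"
    by (rule equivariant_mult[OF assms])
  then show 1: "f (k mod N) = f k - (k div N) * N" by simp
  show "f (k mod N) mod N = f k mod N" unfolding 1 by (metis mod_mult_self3 diff_add_cancel add.commute)
  show "f (k mod N) - k mod N = f k - k" unfolding 1 by (simp add: minus_div_mult_eq_mod[symmetric])
qed

lemma equivariant_bij_mod:
  assumes f: "bij f" "equivariant N f" and N: "N > 0"
  shows "bij_betw (\<lambda>k. f k mod N) {0..<N} {0..<N}"
proof -
  have "inj_on (\<lambda>k. f k mod N) {0..<N}"
  proof (rule inj_onI)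
    fix k k' assume k: "k \<in> {0..<N}" "k' \<in> {0..<N}" and eq: "f k mod N = f k' mod N"
    obtain t where "f k = f k' + t * N"
      using eq by (metis mod_eqE mult.commute)
    then have "f k = f (k' + t * N)" by (simp add: equivariant_mult[OF f(2)])
    then have "k = k' + t * N" using f(1) by (simp add: bij_is_inj inj_eq)
    then have "k mod N = k' mod N" by simp
    then show "k = k'" using k by simp
  qed
  then show ?thesis
    using N by (intro bij_betw_imageI endo_inj_surj) auto
qed

lemma sum_periodic:
  fixes \<phi> :: "int \<Rightarrow> int"
  assumes per: "\<And>k. \<phi> (k + N) = \<phi> k" and N: "N > 0"
  shows "(\<Sum>k\<in>{m..<m + N}. \<phi> k) = (\<Sum>k\<in>{0..<N}. \<phi> k)"
proof -
  have step: "(\<Sum>k\<in>{m + 1..<m + 1 + N}. \<phi> k) = (\<Sum>k\<in>{m..<m + N}. \<phi> k)" for m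
  proof -
    have "{m..<m + N} = insert m {m + 1..<m + N}" "{m + 1..<m + 1 + N} = insert (m + N) {m + 1..<m + N}"
      using N by auto
    then show ?thesis using per[of m] by simp
  qed
  show ?thesis
  proof (induction m rule: int_induct[where k = 0])
    case (step1 m)
    then show ?case using step[of m] by simp
  next
    case (step2 m)
    then show ?case using step[of "m - 1"] by simp
  qed simp
qed

lemma sum_displacement_interval:
  fixes f :: "int \<Rightarrow> int"
  assumes inj: "inj f" and f: "\<And>k. k \<in> {m..<m + N} \<Longrightarrow> f k \<in> {m..<m + N}"
  shows "(\<Sum>k\<in>{m..<m + N}. f k - k) = 0"
proof -
  have "f ` {m..<m + N} = {m..<m + N}"
    using f inj by (intro endo_inj_surj) (auto intro: inj_on_subset)
  then have "(\<Sum>k\<in>{m..<m + N}. f k) = (\<Sum>k\<in>{m..<m + N}. k)"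
    using sum.reindex[of f "{m..<m + N}" "\<lambda>k. k"] inj_on_subset[OF inj] by simp
  then show ?thesis by (simp add: sum_subtractf)
qed

lemma glued_right_periodic:
  assumes per: "\<And>i. p (i + N) = p i" and g: "glued_right p n m"
  shows "glued_right p (n + N) (m + N)"
proof -
  have per': "p i = p (i - N)" for i using per[of "i - N"] by simp
  have "p (m + N - 1) = p (m - 1)" using per[of "m - 1"] by (simp add: algebra_simps)
  moreover have "p k" if "\<forall>k. m \<le> k \<and> k < n \<longrightarrow> p k" "m + N \<le> k" "k < n + N" for k
    using that per'[of k] by simp
  ultimately show ?thesis using g per
    unfolding glued_right_def finite_row_def by auto
qed

text \<open>No row extends across a place just after a zero, so an interval cut at two such places
  is a union of complete rows.\<close>

lemma glued_right_interval:
  assumes g: "glued_right p n m" and z: "\<not> p (m0 - 1)" "\<not> p (m0 + N - 1)"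
  shows "n \<in> {m0..<m0 + N} \<longleftrightarrow> m \<in> {m0..<m0 + N}"
proof -
  have a: "m0 \<le> n \<longleftrightarrow> m0 \<le> m" if z: "\<not> p (m0 - 1)" for m0
  proof (cases "p n \<and> m = n + 1")
    case True
    then have "n \<noteq> m0 - 1" using z by auto
    then show ?thesis using True by auto
  next
    case False
    then have r: "m \<le> n" "\<forall>k. m \<le> k \<and> k < n \<longrightarrow> p k" using g by (auto simp: glued_right_def finite_row_def)
    show ?thesis
    proof
      assume "m0 \<le> n"
      show "m0 \<le> m"
      proof (rule ccontr)
        assume "\<not> m0 \<le> m"
        then have "p (m0 - 1)" using r \<open>m0 \<le> n\<close> by auto
        then show False using z by simp
      qed
    qed (use r in auto)
  qed
  have "m0 + N \<le> n \<longleftrightarrow> m0 + N \<le> m" using a[of "m0 + N"] z by simp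
  then show ?thesis using a[OF z(1)] by auto
qed

definition stair :: "real \<Rightarrow> (int \<Rightarrow> bool) \<Rightarrow> real \<times> int \<Rightarrow> real \<times> int" where
  "stair a s = skew a (climb s)"

lemma floor_bound:
  assumes "x \<in> {0..<1::real}"
  shows "\<bar>\<lfloor>x + a\<rfloor>\<bar> \<le> \<bar>\<lfloor>a\<rfloor>\<bar> + 1"
proof -
  have "\<lfloor>a\<rfloor> \<le> \<lfloor>x + a\<rfloor>" using assms by (intro floor_mono) auto
  moreover have "\<lfloor>x + a\<rfloor> \<le> \<lfloor>a + 1\<rfloor>" using assms by (intro floor_mono) auto
  ultimately show ?thesis by simp
qed

locale periodic_word =
  fixes p :: "int \<Rightarrow> bool" and N :: int
  assumes mixed: "\<And>x. mixed p N x" and periodic: "\<And>i. p (i + N) = p i"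
begin

lemma N_pos: "N > 0"
  using mixed[of 0] by (auto simp: mixed_def)

lemma regular_p: "regular p"
  by (rule mixed_imp_regular[OF mixed])

lemma zeros_p: "zeros_unbounded p" "zeros_unbounded (\<lambda>n. \<not> p n)"
  using regular_p by (auto simp: regular_def)

lemma equivariant_right_of: "equivariant N (right_of p)"
  unfolding equivariant_def
proof
  fix k
  have "glued_right p k (right_of p k)" using right_of_eq_iff[OF zeros_p(1)] by blast
  then have "glued_right p (k + N) (right_of p k + N)"
    by (rule glued_right_periodic[of p N, rotated]) (rule periodic)
  then show "right_of p (k + N) = right_of p k + N" using right_of_eq_iff[OF zeros_p(1)] by blast
qed

text \<open>By periodicity any period serves as the range of summation. Starting it just after a
  zero makes it a union of rows, which the row gluing permutes.\<close>

lemma zpow_right_of_displacement: "(\<Sum>k\<in>{0..<N}. zpow (right_of p) j k - k) = 0"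
proof -
  have bij: "bij (right_of p)" by (rule bij_right_of[OF zeros_p(1)])
  obtain z where z: "\<not> p z" using mixed[of 0] by (auto simp: mixed_def)
  define m0 where "m0 = z + 1"
  have z0: "\<not> p (m0 - 1)" "\<not> p (m0 + N - 1)" using z periodic[of z] by (auto simp: m0_def algebra_simps)
  have 1: "right_of p k \<in> {m0..<m0 + N}" "inv (right_of p) k \<in> {m0..<m0 + N}"
    if "k \<in> {m0..<m0 + N}" for k
  proof -
    have "glued_right p k (right_of p k)" using right_of_eq_iff[OF zeros_p(1)] by blast
    from glued_right_interval[OF this z0] show "right_of p k \<in> {m0..<m0 + N}" using that by blast
    have "glued_right p (inv (right_of p) k) k" using inv_right_of_eq_iff[OF zeros_p(1)] by blast
    from glued_right_interval[OF this z0] show "inv (right_of p) k \<in> {m0..<m0 + N}" using that by blast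
  qed
  have "(\<Sum>k\<in>{m0..<m0 + N}. zpow (right_of p) j k - k) = 0"
  proof (rule sum_displacement_interval)
    show "inj (zpow (right_of p) j)" using bij_zpow[OF bij] by (rule bij_is_inj)
    fix k assume "k \<in> {m0..<m0 + N}"
    then show "zpow (right_of p) j k \<in> {m0..<m0 + N}"
      using zpow_steps_induct[of "\<lambda>n y. y \<in> {m0..<m0 + N}" k j "right_of p"] 1 by blast
  qed
  moreover have "zpow (right_of p) j (k + N) - (k + N) = zpow (right_of p) j k - k" for k
    using equivariant_zpow[OF bij equivariant_right_of] by (simp add: equivariant_def)
  ultimately show ?thesis
    using sum_periodic[of "\<lambda>k. zpow (right_of p) j k - k" N m0] N_pos by metis
qed

lemma complement: "periodic_word (\<lambda>n. \<not> p n) N"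
  by unfold_locales (use mixed periodic in \<open>auto simp: mixed_compl\<close>)

lemma equivariant_climb: "equivariant N (climb p j)"
proof -
  have "bij (right_of p)" by (rule bij_right_of[OF zeros_p(1)])
  then have "equivariant N (zpow (right_of p) j)" by (rule equivariant_zpow[OF _ equivariant_right_of])
  then show ?thesis
    unfolding climb_def above_def by (rule equivariant_compose[OF periodic_word.equivariant_right_of[OF complement]])
qed

text \<open>Rows are cut after zeros and columns after ones, so no single period need be preserved
  by the composition. Instead the displacement is split: that of the vertical crossing depends only
  on the residue modulo \<open>N\<close>, and the horizontal crossings permute the residues.\<close>

lemma climb_displacement: "(\<Sum>k\<in>{0..<N}. climb p j k - k) = 0"
proof -
  define z where "z = zpow (right_of p) j"
  have bij: "bij (right_of p)" by (rule bij_right_of[OF zeros_p(1)])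
  have zb: "bij z" "equivariant N z"
    unfolding z_def using bij_zpow[OF bij] equivariant_zpow[OF bij equivariant_right_of] by auto
  have e: "equivariant N (above p)" unfolding above_def by (rule periodic_word.equivariant_right_of[OF complement])
  have "(\<Sum>k\<in>{0..<N}. above p (z k) - z k) = (\<Sum>k\<in>{0..<N}. above p (z k mod N) - z k mod N)"
    by (intro sum.cong refl) (simp add: equivariant_mod(3)[OF e])
  also have "\<dots> = (\<Sum>k\<in>{0..<N}. above p k - k)"
    by (rule sum.reindex_bij_betw[OF equivariant_bij_mod[OF zb N_pos], of "\<lambda>k. above p k - k"])
  also have "\<dots> = 0"
    using periodic_word.zpow_right_of_displacement[OF complement, of 1] by (simp add: zpow_1 above_def)
  finally have "(\<Sum>k\<in>{0..<N}. above p (z k) - z k) + (\<Sum>k\<in>{0..<N}. z k - k) = 0"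
    using zpow_right_of_displacement[of j] by (simp add: z_def)
  then show ?thesis by (simp add: climb_def z_def sum.distrib[symmetric])
qed

text \<open>The two maps differ by one application of \<open>right_of p\<close>, so a set of
  residues invariant under both is invariant under \<open>right_of p\<close>, then under
  \<open>above p\<close>. The square with label \<open>k + 1\<close> is to the right of or above the
  one with label \<open>k\<close>, hence the set is invariant under adding 1.\<close>

lemma climb_transitive:
  assumes L: "L \<subseteq> {0..<N}"
    and 1: "(\<lambda>k. climb p m k mod N) ` L = L" and 2: "(\<lambda>k. climb p (m + 1) k mod N) ` L = L"
  shows "L = {} \<or> L = {0..<N}"
proof -
  have bij: "bij (right_of p)" by (rule bij_right_of[OF zeros_p(1)])
  define M where "M k \<longleftrightarrow> k mod N \<in> L" for k
  have inv: "M (climb p i k) \<longleftrightarrow> M k" if im: "(\<lambda>k. climb p i k mod N) ` L = L" for i k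
  proof -
    have b: "bij_betw (\<lambda>k. climb p i k mod N) {0..<N} {0..<N}"
      by (rule equivariant_bij_mod[OF bij_climb[OF regular_p] equivariant_climb N_pos])
    have r: "climb p i k mod N = climb p i (k mod N) mod N"
      using equivariant_mod(2)[OF equivariant_climb] by simp
    have kN: "k mod N \<in> {0..<N}" using N_pos by simp
    have "climb p i (k mod N) mod N \<in> (\<lambda>k. climb p i k mod N) ` L \<longleftrightarrow> k mod N \<in> L"
      by (rule inj_on_image_mem_iff[OF bij_betw_imp_inj_on[OF b] kN L])
    then show ?thesis unfolding M_def r im .
  qed
  have R: "M (right_of p k) \<longleftrightarrow> M k" for k
  proof -
    have "climb p (m + 1) k = climb p m (right_of p k)"
      using zpow_add[OF bij, of m 1 k] by (simp add: climb_def zpow_1)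
    then show ?thesis using inv[OF 1, of "right_of p k"] inv[OF 2, of k] by simp
  qed
  have Ri: "M (inv (right_of p) k) \<longleftrightarrow> M k" for k
    using R[of "inv (right_of p) k"] bij by (simp add: bij_is_surj surj_f_inv_f)
  have Z: "M (zpow (right_of p) m k) \<longleftrightarrow> M k" for k
    using zpow_steps_induct[of "\<lambda>_ y. M y \<longleftrightarrow> M k" k m "right_of p"] R Ri by simp
  have U: "M (above p k) \<longleftrightarrow> M k" for k
  proof -
    obtain l where l: "zpow (right_of p) m l = k"
      using bij_zpow[OF bij, of m] by (metis bij_pointE)
    then show ?thesis using inv[OF 1, of l] Z[of l] by (simp add: climb_def)
  qed
  have S: "M (k + 1) \<longleftrightarrow> M k" for k
  proof (cases "p k")
    case True
    then have "right_of p k = k + 1"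
      using right_of_eq_iff[OF zeros_p(1)] by (simp add: glued_right_def)
    then show ?thesis using R[of k] by simp
  next
    case False
    then have "above p k = k + 1"
      using right_of_eq_iff[OF zeros_p(2)] by (simp add: glued_right_def above_def)
    then show ?thesis using U[of k] by simp
  qed
  have all: "M k \<longleftrightarrow> M 0" for k
  proof (induction k rule: int_induct[where k = 0])
    case (step2 i) then show ?case using S[of "i - 1"] by simp
  qed (use S in auto)
  have "k \<in> L \<longleftrightarrow> M 0" if "k \<in> {0..<N}" for k
    using all[of k] that by (simp add: M_def)
  then show ?thesis using L by blast
qed

text \<open>At most \<open>\<bar>\<lfloor>a\<rfloor>\<bar> + 1\<close> horizontal crossings and one
  vertical crossing, each changing the label by at most \<open>N\<close>.\<close>

definition step_bound :: "real \<Rightarrow> int" where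
  "step_bound a = (\<bar>\<lfloor>a\<rfloor>\<bar> + 2) * N"

lemma step_bound_pos: "0 < step_bound a"
  unfolding step_bound_def using N_pos by simp

lemma climb_bound:
  assumes "x \<in> {0..<1}"
  shows "\<bar>climb p \<lfloor>x + a\<rfloor> k - k\<bar> \<le> step_bound a"
  using climb_local(2)[OF mixed regular_p floor_bound[OF assms, of a], of "\<bar>k\<bar> + (\<bar>\<lfloor>a\<rfloor>\<bar> + 1 + 1) * N + 1" 0 k]
  by (simp add: step_bound_def add.commute)

abbreviation residues :: "int set" where
  "residues \<equiv> {0..<N}"

definition quotient_climb :: "int \<Rightarrow> int \<Rightarrow> int" where
  "quotient_climb j k = climb p j k mod N"

definition displacement :: "real \<Rightarrow> real \<times> int \<Rightarrow> int" where
  "displacement a z = climb p \<lfloor>fst z + a\<rfloor> (snd z) - snd z"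

text \<open>The periodic staircase is a cover of the finite skew product, and the displacement is a
  function on the latter: its orbit sums recover the label upstairs.\<close>

lemma stair_quotient:
  "fst ((skew a quotient_climb ^^ n) (x, k mod N)) = fst ((stair a p ^^ n) (x, k)) \<and>
   snd ((skew a quotient_climb ^^ n) (x, k mod N)) = snd ((stair a p ^^ n) (x, k)) mod N \<and>
   (\<Sum>i<n. displacement a ((skew a quotient_climb ^^ i) (x, k mod N))) = snd ((stair a p ^^ n) (x, k)) - k"
proof (induction n)
  case (Suc n)
  define y where "y = (skew a quotient_climb ^^ n) (x, k mod N)"
  define z where "z = (stair a p ^^ n) (x, k)"
  have yz: "fst y = fst z" "snd y = snd z mod N"
    and sm: "(\<Sum>i<n. displacement a ((skew a quotient_climb ^^ i) (x, k mod N))) = snd z - k"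
    using Suc by (auto simp: y_def z_def)
  have "displacement a y = climb p \<lfloor>fst z + a\<rfloor> (snd z) - snd z"
    unfolding displacement_def yz
    by (rule equivariant_mod(3)[OF equivariant_climb])
  then show ?case
    using sm equivariant_mod(2)[OF equivariant_climb]
    by (simp flip: y_def z_def) (simp add: skew_def stair_def yz quotient_climb_def)
qed simp

lemma finite_measure_strip: "finite I \<Longrightarrow> finite_measure (strip I)"
proof -
  assume "finite I"
  then interpret c: finite_measure "count_space I" by (rule finite_measure_count_space)
  show ?thesis unfolding strip_def
    by (rule finite_measure_pair_measure) unfold_locales
qed

lemma measurable_displacement: "displacement a \<in> measurable (strip I) (count_space UNIV)"
proof -
  have fl: "(\<lambda>z. \<lfloor>fst z + a\<rfloor>) \<in> measurable (strip I) (count_space UNIV)"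
    by measurable
  show ?thesis
    unfolding displacement_def[abs_def]
    using measurable_discrete2[OF fl measurable_snd_strip, of "\<lambda>j k. climb p j k - k"] .
qed

lemma integral_displacement: "(\<integral>z. real_of_int (displacement a z) \<partial>strip residues) = 0"
proof -
  interpret u: sigma_finite_measure "count_space residues" by (rule sigma_finite_count_space_int)
  interpret pair_sigma_finite unit_interval "count_space residues" ..
  interpret s: finite_measure "strip residues" by (rule finite_measure_strip) simp
  have int: "integrable (strip residues) (\<lambda>z. real_of_int (displacement a z))"
  proof (rule s.integrable_const_bound[of _ "real_of_int (step_bound a)"])
    show "(\<lambda>z. real_of_int (displacement a z)) \<in> borel_measurable (strip residues)"
      using measurable_displacement by (rule measurable_compose) simp
    show "AE z in strip residues. norm (real_of_int (displacement a z)) \<le> real_of_int (step_bound a)"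
    proof (rule AE_I2)
      fix z assume "z \<in> space (strip residues)"
      then have "\<bar>displacement a z\<bar> \<le> step_bound a" unfolding displacement_def by (intro climb_bound) auto
      then show "norm (real_of_int (displacement a z)) \<le> real_of_int (step_bound a)"
        by (metis of_int_abs of_int_le_iff real_norm_def)
    qed
  qed
  then have "(\<integral>z. real_of_int (displacement a z) \<partial>strip residues) =
      (\<integral>x. (\<integral>k. real_of_int (displacement a (x, k)) \<partial>count_space residues) \<partial>unit_interval)"
    unfolding strip_def by (rule integral_fst'[symmetric])
  also have "\<dots> = (\<integral>x. 0 \<partial>unit_interval)"
  proof (rule Bochner_Integration.integral_cong[OF refl])
    fix x
    have "(\<integral>k. real_of_int (displacement a (x, k)) \<partial>count_space residues) =
        real_of_int (\<Sum>k\<in>residues. climb p \<lfloor>x + a\<rfloor> k - k)"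
      by (simp add: lebesgue_integral_count_space_finite displacement_def)
    then show "(\<integral>k. real_of_int (displacement a (x, k)) \<partial>count_space residues) = 0"
      unfolding climb_displacement by simp
  qed
  finally show ?thesis by simp
qed

text \<open>The sign \<open>\<sigma>\<close> selects the side: 1 rules out staying strictly right of
  the starting label for ever, \<open>- 1\<close> strictly left of it. The starting label enters
  only through its residue, whose fibre in the finite quotient has positive measure.\<close>

lemma stair_returns:
  assumes a: "often_well_spaced a" and \<sigma>: "\<sigma> = 1 \<or> \<sigma> = (- 1 :: int)"
  shows "AE x in unit_interval. \<exists>n\<ge>1. \<sigma> * (snd ((stair a p ^^ n) (x, k)) - k) \<le> 0"
proof -
  have bij: "bij_betw (quotient_climb j) residues residues" for j
    unfolding quotient_climb_def
    by (rule equivariant_bij_mod[OF bij_climb[OF regular_p] equivariant_climb N_pos])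
  have AE: "AE z in strip residues. \<exists>n\<ge>1. (\<Sum>i<n. \<sigma> * displacement a ((skew a quotient_climb ^^ i) z)) \<le> 0"
  proof (rule ergodic_sums_return[where C = "step_bound a"])
    show "finite_measure (strip residues)" by (rule finite_measure_strip) simp
    show "measure_preserving (strip residues) (skew a quotient_climb)"
      by (rule measure_preserving_skew[OF bij])
    show "(\<lambda>z. \<sigma> * displacement a z) \<in> measurable (strip residues) (count_space UNIV)"
      using measurable_displacement by (rule measurable_compose) simp
    show "(\<integral>z. real_of_int (\<sigma> * displacement a z) \<partial>strip residues) = 0"
      using integral_displacement by simp
    fix z assume "z \<in> space (strip residues)"
    then have "\<bar>displacement a z\<bar> \<le> step_bound a" unfolding displacement_def by (intro climb_bound) auto
    then show "\<bar>\<sigma> * displacement a z\<bar> \<le> step_bound a" using \<sigma> by auto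
  next
    fix A assume A: "A \<in> sets (strip residues)"
      and inv: "\<And>z. z \<in> space (strip residues) \<Longrightarrow> skew a quotient_climb z \<in> A \<longleftrightarrow> z \<in> A"
    show "emeasure (strip residues) A = 0 \<or> emeasure (strip residues) (space (strip residues) - A) = 0"
    proof (rule skew_ergodic[OF a _ bij A])
      show "L = {} \<or> L = residues" if "L \<subseteq> residues" "quotient_climb \<lfloor>a\<rfloor> ` L = L" "quotient_climb (\<lfloor>a\<rfloor> + 1) ` L = L" for L
        using climb_transitive[OF that(1)] that(2,3) unfolding quotient_climb_def by blast
    qed (use inv in simp_all)
  qed
  then obtain Z where Z: "Z \<in> null_sets (strip residues)"
    "{z \<in> space (strip residues). \<not> (\<exists>n\<ge>1. (\<Sum>i<n. \<sigma> * displacement a ((skew a quotient_climb ^^ i) z)) \<le> 0)} \<subseteq> Z"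
    by (auto simp only: eventually_ae_filter)
  have kN: "k mod N \<in> residues" using N_pos by simp
  have "AE x in unit_interval. (x, k mod N) \<notin> Z"
    using emeasure_strip_eq_0_iff[of Z residues] Z(1) kN by (auto simp: null_sets_def)
  then show ?thesis
    using AE_space
  proof eventually_elim
    fix x assume x: "(x, k mod N) \<notin> Z" "x \<in> space unit_interval"
    then have "(x, k mod N) \<in> space (strip residues)" using kN by simp
    then have "\<exists>n\<ge>1. (\<Sum>i<n. \<sigma> * displacement a ((skew a quotient_climb ^^ i) (x, k mod N))) \<le> 0"
      using x Z(2) by blast
    then show "\<exists>n\<ge>1. \<sigma> * (snd ((stair a p ^^ n) (x, k)) - k) \<le> 0"
      using stair_quotient[where a = a and x = x and k = k] by (simp add: sum_distrib_left[symmetric])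
  qed
qed

end

section \<open>Conservativity\<close>

lemma measure_preserving_stair:
  assumes "regular s"
  shows "measure_preserving (strip UNIV) (stair a s)"
  unfolding stair_def using bij_climb[OF assms] by (intro measure_preserving_skew) auto

lemma stair_space: "z \<in> {0..<1} \<times> UNIV \<Longrightarrow> (stair a s ^^ n) z \<in> {0..<1} \<times> UNIV"
  by (induction n) (auto simp: stair_def skew_def frac_lt_1)

lemma snd_stair_funpow_Suc:
  "snd ((stair a s ^^ Suc n) z) = climb s \<lfloor>fst ((stair a s ^^ n) z) + a\<rfloor> (snd ((stair a s ^^ n) z))"
  by (simp add: stair_def skew_def)

lemma emeasure_strip_finite:
  assumes "finite K"
  shows "emeasure (strip UNIV) ({0..<1} \<times> K) < \<infinity>"
proof -
  interpret c: sigma_finite_measure "count_space (UNIV :: int set)" by (rule sigma_finite_count_space_int)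
  have "emeasure (strip UNIV) ({0..<1} \<times> K) = emeasure unit_interval {0..<1} * emeasure (count_space UNIV) K"
    unfolding strip_def by (rule c.emeasure_pair_measure_Times) (auto simp: sets_unit_interval)
  also have "\<dots> < \<infinity>"
    using assms unit_interval.emeasure_space_1 by (simp add: of_nat_less_top)
  finally show ?thesis .
qed

lemma sets_strip_Times: "{0..<1} \<times> K \<in> sets (strip UNIV)"
  unfolding strip_def by (rule pair_measureI) (auto simp: sets_unit_interval)

definition translate :: "int \<Rightarrow> real \<times> int \<Rightarrow> real \<times> int" where
  "translate c z = (fst z, snd z - c)"

lemma measure_preserving_translate: "measure_preserving (strip UNIV) (translate c)"
proof -
  have mp: "measure_preserving (strip UNIV) (skew 0 (\<lambda>j k. k - c))"
    by (rule measure_preserving_skew) (rule bij_betw_byWitness[where f' = "\<lambda>k. k + c"], auto)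
  have eq: "skew 0 (\<lambda>j k. k - c) z = translate c z" if "z \<in> space (strip UNIV)" for z
    using that by (auto simp: skew_def translate_def frac_eq)
  show ?thesis
    using mp measurable_cong[of "strip UNIV" _ "translate c" "strip UNIV", OF eq]
      distr_cong[of "strip UNIV" "strip UNIV" "strip UNIV" "strip UNIV", OF refl refl eq]
    unfolding measure_preserving_def by simp
qed

context periodic_word
begin

text \<open>Orbits that cross label 0 towards the side \<open>\<sigma>\<close> in their first step
  and stay beyond it for \<open>n\<close> steps; for \<open>n \<ge> 1\<close> the start must lie
  within one step of 0. Only finitely many labels occur, so the measure is finite and continuity
  from above is available.\<close>

definition escape :: "real \<Rightarrow> int \<Rightarrow> nat \<Rightarrow> (real \<times> int) set" where
  "escape a \<sigma> n = {z \<in> {0..<1} \<times> UNIV. - step_bound a \<le> \<sigma> * snd z \<and> \<sigma> * snd z < 0 \<and>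
    (\<forall>i\<in>{1..n}. 0 \<le> \<sigma> * snd ((stair a p ^^ i) z))}"

lemma escape_measurable: "escape a \<sigma> n \<in> sets (strip UNIV)"
proof -
  have [measurable]: "(stair a p ^^ i) \<in> measurable (strip UNIV) (strip UNIV)" for i
    using measure_preserving_measurable[OF measure_preserving_funpow[OF measure_preserving_stair[OF regular_p]]] .
  have m: "(\<lambda>z. \<sigma> * snd ((stair a p ^^ i) z)) \<in> measurable (strip UNIV) (count_space UNIV)" for i
    by (rule measurable_compose[of "\<lambda>z. snd ((stair a p ^^ i) z)" _ "count_space UNIV"]) simp_all
  have m0: "(\<lambda>z. \<sigma> * snd z) \<in> measurable (strip UNIV) (count_space UNIV)"
    using m[of 0] by simp
  have "escape a \<sigma> n = ((\<lambda>z. \<sigma> * snd z) -` {- step_bound a..<0} \<inter> space (strip UNIV)) \<inter>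
      (\<Inter>i\<in>{1..n}. (\<lambda>z. \<sigma> * snd ((stair a p ^^ i) z)) -` {0..} \<inter> space (strip UNIV)) \<inter> space (strip UNIV)"
    by (auto simp: escape_def)
  also have "\<dots> \<in> sets (strip UNIV)"
  proof (cases "n = 0")
    case True
    then show ?thesis using measurable_sets[OF m0] by simp
  next
    case False
    have "(\<Inter>i\<in>{1..n}. (\<lambda>z. \<sigma> * snd ((stair a p ^^ i) z)) -` {0..} \<inter> space (strip UNIV)) \<in> sets (strip UNIV)"
    proof (rule sets.finite_INT)
      fix i show "(\<lambda>z. \<sigma> * snd ((stair a p ^^ i) z)) -` {0..} \<inter> space (strip UNIV) \<in> sets (strip UNIV)"
        by (rule measurable_sets[OF m]) simp
    qed (use False in auto)
    moreover have "(\<lambda>z. \<sigma> * snd z) -` {- step_bound a..<0} \<inter> space (strip UNIV) \<in> sets (strip UNIV)"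
      by (rule measurable_sets[OF m0]) simp
    ultimately show ?thesis by (intro sets.Int[OF sets.Int sets.top])
  qed
  finally show ?thesis .
qed

text \<open>The sets decrease with \<open>n\<close>. A point in all of them never comes back to its
  starting label or behind it, which \<open>stair_returns\<close> excludes almost
  everywhere.\<close>

lemma escape_small:
  assumes a: "often_well_spaced a" and \<sigma>: "\<sigma> = 1 \<or> \<sigma> = - 1" and e: "e > 0"
  shows "\<exists>n. emeasure (strip UNIV) (escape a \<sigma> n) < e"
proof -
  have fin: "emeasure (strip UNIV) (escape a \<sigma> n) \<noteq> \<infinity>" for n
  proof -
    have "emeasure (strip UNIV) (escape a \<sigma> n) \<le>
        emeasure (strip UNIV) ({0..<1} \<times> {- step_bound a..step_bound a})"
      using \<sigma> by (intro emeasure_mono sets_strip_Times) (auto simp: escape_def)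
    also have "\<dots> < \<infinity>" by (rule emeasure_strip_finite) simp
    finally show ?thesis by simp
  qed
  have "(INF n. emeasure (strip UNIV) (escape a \<sigma> n)) = emeasure (strip UNIV) (\<Inter>n. escape a \<sigma> n)"
    using fin escape_measurable by (intro INF_emeasure_decseq) (auto simp: decseq_def escape_def)
  also have "\<dots> = 0"
  proof -
    have "(\<Inter>n. escape a \<sigma> n) \<in> sets (strip UNIV)"
      using escape_measurable by (intro sets.countable_INT) auto
    moreover have "AE x in unit_interval. (x, k) \<notin> (\<Inter>n. escape a \<sigma> n)" for k
      using stair_returns[OF a \<sigma>, of k]
    proof (rule eventually_mono)
      fix x assume "\<exists>n\<ge>1. \<sigma> * (snd ((stair a p ^^ n) (x, k)) - k) \<le> 0"
      then obtain n where n: "n \<ge> 1" "\<sigma> * (snd ((stair a p ^^ n) (x, k)) - k) \<le> 0" by blast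
      have "(x, k) \<notin> escape a \<sigma> n"
        using n by (force simp: escape_def right_diff_distrib)
      then show "(x, k) \<notin> (\<Inter>n. escape a \<sigma> n)" by blast
    qed
    ultimately show ?thesis using emeasure_strip_eq_0_iff by blast
  qed
  finally have "(INF n. emeasure (strip UNIV) (escape a \<sigma> n)) < e" using e by simp
  then show ?thesis by (simp add: INF_less_iff)
qed

text \<open>At time \<open>i\<close> the label is within \<open>(i + 1) * step_bound a\<close> of
  the centre of the copy, and the next step reads symbols at most another
  \<open>step_bound a + 1\<close> away. A copy of the stated radius therefore determines the first
  \<open>n\<close> steps.\<close>

lemma follows_word:
  assumes s: "regular s" and z: "z \<in> {0..<1} \<times> UNIV"
    and agree: "\<And>i. \<bar>i\<bar> \<le> H \<Longrightarrow> s (c + i) = p i"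
    and H: "(int n + 2) * step_bound a + 1 \<le> H" and near: "\<bar>snd z - c\<bar> \<le> step_bound a" and i: "i \<le> n"
  shows "(stair a p ^^ i) (translate c z) = translate c ((stair a s ^^ i) z) \<and>
    \<bar>snd ((stair a s ^^ i) z) - c\<bar> \<le> (int i + 1) * step_bound a"
  using i
proof (induction i)
  case (Suc i)
  define y where "y = (stair a s ^^ i) z"
  have IH: "(stair a p ^^ i) (translate c z) = translate c y" "\<bar>snd y - c\<bar> \<le> (int i + 1) * step_bound a"
    using Suc by (auto simp: y_def)
  have y: "fst y \<in> {0..<1}" using stair_space[OF z, of i a s] by (auto simp: y_def mem_Times_iff)
  have "(int i + 2) * step_bound a \<le> (int n + 2) * step_bound a"
    using Suc.prems step_bound_pos[of a] by (intro mult_right_mono) auto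
  then have k: "\<bar>snd y - c\<bar> + (\<bar>\<lfloor>a\<rfloor>\<bar> + 1 + 1) * N + 1 \<le> H"
    using IH(2) H by (simp add: step_bound_def algebra_simps)
  have loc: "climb s \<lfloor>fst y + a\<rfloor> (snd y) = c + climb p \<lfloor>fst y + a\<rfloor> (snd y - c)"
    using climb_local(1)[OF mixed s floor_bound[OF y] agree k] by simp
  have "\<bar>climb p \<lfloor>fst y + a\<rfloor> (snd y - c) - (snd y - c)\<bar> \<le> step_bound a"
    by (rule climb_bound[OF y])
  then have "\<bar>climb s \<lfloor>fst y + a\<rfloor> (snd y) - c\<bar> \<le> (int (Suc i) + 1) * step_bound a"
    using IH(2) loc by (simp add: algebra_simps)
  then show ?case
    using IH(1) loc by (simp flip: y_def) (simp add: stair_def skew_def translate_def)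
qed (use near step_bound_pos[of a] in simp)

lemma enters_escape:
  assumes s: "regular s" and z: "z \<in> {0..<1} \<times> UNIV" and \<sigma>: "\<sigma> = 1 \<or> \<sigma> = - 1"
    and agree: "\<And>i. \<bar>i\<bar> \<le> H \<Longrightarrow> s (c + i) = p i"
    and H: "(int n + 2) * step_bound a + 1 \<le> H"
    and start: "- step_bound a \<le> \<sigma> * (snd z - c)" "\<sigma> * (snd z - c) < 0"
    and later: "\<And>i. 1 \<le> i \<Longrightarrow> 0 \<le> \<sigma> * (snd ((stair a s ^^ i) z) - c)"
  shows "translate c z \<in> escape a \<sigma> n"
proof -
  have near: "\<bar>snd z - c\<bar> \<le> step_bound a" using start \<sigma> by auto
  have "0 \<le> \<sigma> * snd ((stair a p ^^ i) (translate c z))" if "i \<in> {1..n}" for i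
    using follows_word[OF s z agree H near, of i] later[of i] that by (simp add: translate_def)
  then show ?thesis using start z by (auto simp: escape_def translate_def)
qed

lemma agree_imp_mixed:
  assumes agree: "\<And>i. \<bar>i\<bar> \<le> H \<Longrightarrow> s (c + i) = p i" and x: "\<bar>x - c\<bar> + N \<le> H"
  shows "mixed s N x"
proof -
  have eq: "s z = p (z - c)" if "z \<in> {x..<x + N}" for z
    using agree[of "z - c"] that x by auto
  obtain z z' where "z \<in> {x - c..<x - c + N}" "p z" "z' \<in> {x - c..<x - c + N}" "\<not> p z'"
    using mixed[of "x - c"] unfolding mixed_def by blast
  then show ?thesis unfolding mixed_def
    using eq[of "z + c"] eq[of "z' + c"] by (intro conjI bexI[of _ "z + c"] bexI[of _ "z' + c"]) auto
qed

text \<open>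
  An orbit leaving every bounded set has a last visit to the region between two far away copies of a
  long piece of \<open>p\<close>. At that moment it enters one of the copies and never comes back, which
  in the periodic staircase happens only on a small set.
\<close>

lemma last_exit_escapes:
  assumes s: "regular s" and z: "z \<in> {0..<1} \<times> UNIV"
    and agree: "\<And>i. \<bar>i\<bar> \<le> H \<Longrightarrow> s (c + i) = p i" and agree': "\<And>i. \<bar>i\<bar> \<le> H \<Longrightarrow> s (c' + i) = p i"
    and H: "(int n + 2) * step_bound a + 1 \<le> H" "(int n' + 2) * step_bound a + 1 \<le> H"
      "step_bound a + 1 + N \<le> H"
    and c: "step_bound a + 1 < c" and c': "c' < - step_bound a - 1"
    and start: "c' < snd z" "snd z < c"
    and leaves: "\<forall>\<^sub>F m in sequentially. \<not> (c' < snd ((stair a s ^^ m) z) \<and> snd ((stair a s ^^ m) z) < c)"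
  shows "\<exists>m. translate c ((stair a s ^^ m) z) \<in> escape a 1 n \<or>
    translate c' ((stair a s ^^ m) z) \<in> escape a (- 1) n'"
proof -
  define b where "b = step_bound a"
  define J where "J = \<bar>\<lfloor>a\<rfloor>\<bar> + 1"
  have bJ: "b = (J + 1) * N" by (simp add: b_def J_def step_bound_def)
  have b: "0 < b" using step_bound_pos by (simp add: b_def)
  have JN: "J * N \<le> b" using N_pos by (simp add: bJ algebra_simps)
  have N0: "0 \<le> N" using N_pos by simp
  have mx: "mixed s N x" if "\<bar>x - c\<bar> \<le> b + 1" for x
    using that H(3) by (intro agree_imp_mixed[OF agree]) (auto simp: b_def)
  have mx': "mixed s N x" if "\<bar>x - c'\<bar> \<le> b + 1" for x
    using that H(3) by (intro agree_imp_mixed[OF agree']) (auto simp: b_def)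
  define I where "I m \<longleftrightarrow> c' < snd ((stair a s ^^ m) z) \<and> snd ((stair a s ^^ m) z) < c" for m
  obtain M where M: "\<And>m. m \<ge> M \<Longrightarrow> \<not> I m"
    using leaves unfolding I_def eventually_sequentially by blast
  have "finite {m. I m}" by (rule finite_subset[of _ "{..<M}"]) (use M in \<open>force simp: not_less[symmetric]\<close>)+
  moreover have "0 \<in> {m. I m}" using start by (simp add: I_def)
  ultimately obtain m where m: "I m" "\<And>l. I l \<Longrightarrow> l \<le> m"
    using Max_in[of "{m. I m}"] Max_ge[of "{m. I m}"] by blast
  define K where "K l = snd ((stair a s ^^ l) ((stair a s ^^ m) z))" for l
  have Keq: "K l = snd ((stair a s ^^ (m + l)) z)" for l
    by (simp add: K_def add.commute[of m] funpow_add)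
  have out: "\<not> (c' < K l \<and> K l < c)" if "l \<ge> 1" for l
    using m(2)[of "m + l"] that unfolding I_def Keq by auto
  have in0: "c' < K 0" "K 0 < c" using m(1) by (auto simp: I_def K_def)
  define y where "y = (stair a s ^^ m) z"
  have ysp: "y \<in> {0..<1} \<times> UNIV" unfolding y_def by (rule stair_space[OF z])
  have step: "\<exists>j. \<bar>j\<bar> \<le> J \<and> K (Suc l) = climb s j (K l)" for l
  proof -
    have "(stair a s ^^ l) y \<in> {0..<1} \<times> UNIV" by (rule stair_space[OF ysp])
    then have "\<bar>\<lfloor>fst ((stair a s ^^ l) y) + a\<rfloor>\<bar> \<le> J"
      unfolding J_def by (intro floor_bound) (auto simp: mem_Times_iff)
    then show ?thesis unfolding K_def y_def[symmetric] using snd_stair_funpow_Suc by blast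
  qed
  \<comment> \<open>Labels may jump far where \<open>s\<close> has long constant blocks. Around
    \<open>c\<close> and \<open>c'\<close> all windows are mixed, so whatever crosses one of these
    places does so in a step that starts and lands in a controlled way; the four estimates record
    this for both places and both directions.\<close>
  have from_below: "K (Suc l) < c" if "K l < c - b" for l
  proof -
    obtain j where j: "\<bar>j\<bar> \<le> J" "K (Suc l) = climb s j (K l)" using step by blast
    have "climb s j (K l) < c - b + (J + 1) * N"
      using that JN by (intro climb_up[OF s N0 j(1)] mx) auto
    then show ?thesis using j(2) by (simp add: bJ)
  qed
  have stay_above: "c - 1 - b < K (Suc l)" if "c \<le> K l" for l
  proof -
    obtain j where j: "\<bar>j\<bar> \<le> J" "K (Suc l) = climb s j (K l)" using step by blast
    have "c - 1 - (J + 1) * N < climb s j (K l)"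
      using that by (intro climb_down[OF s N0 j(1)] mx) (auto simp: bJ[symmetric])
    then show ?thesis using j(2) by (simp add: bJ)
  qed
  have from_above: "c' < K (Suc l)" if "c' + b < K l" for l
  proof -
    obtain j where j: "\<bar>j\<bar> \<le> J" "K (Suc l) = climb s j (K l)" using step by blast
    have "c' + b - (J + 1) * N < climb s j (K l)"
      using that by (intro climb_down[OF s N0 j(1)] mx') (auto simp: bJ[symmetric])
    then show ?thesis using j(2) by (simp add: bJ)
  qed
  have stay_below: "K (Suc l) < c' + 1 + b" if "K l \<le> c'" for l
  proof -
    obtain j where j: "\<bar>j\<bar> \<le> J" "K (Suc l) = climb s j (K l)" using step by blast
    have "climb s j (K l) < c' + 1 + (J + 1) * N"
      using that JN by (intro climb_up[OF s N0 j(1)] mx') auto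
    then show ?thesis using j(2) by (simp add: bJ)
  qed
  have K0: "K 0 = snd y" by (simp add: K_def y_def)
  have Ky: "K l = snd ((stair a s ^^ l) y)" for l by (simp add: K_def y_def)
  have "c \<le> K 1 \<or> K 1 \<le> c'" using out[of 1] by auto
  then have "translate c y \<in> escape a 1 n \<or> translate c' y \<in> escape a (- 1) n'"
  proof
    assume 1: "c \<le> K 1"
    \<comment> \<open>From \<open>c\<close> or beyond, a step lands above
      \<open>c - 1 - b > 0 > c'\<close>, so it cannot reach the other side, and the region in
      between is never visited again.\<close>
    have above: "c \<le> K l" if "l \<ge> 1" for l
      using that
    proof (induction l rule: nat_induct_at_least)
      case (Suc l)
      then show ?case using stay_above[of l] out[of "Suc l"] c c' by (auto simp: b_def)
    qed (use 1 in simp)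
    have "c - b \<le> K 0" using from_below[of 0] 1 by force
    then have "translate c y \<in> escape a 1 n"
      using in0 above Ky K0
      by (intro enters_escape[OF s ysp _ agree H(1)]) (auto simp: b_def)
    then show ?thesis ..
  next
    assume 1: "K 1 \<le> c'"
    have below: "K l \<le> c'" if "l \<ge> 1" for l
      using that
    proof (induction l rule: nat_induct_at_least)
      case (Suc l)
      then show ?case using stay_below[of l] out[of "Suc l"] c c' by (auto simp: b_def)
    qed (use 1 in simp)
    have "K 0 \<le> c' + b" using from_above[of 0] 1 by force
    then have "translate c' y \<in> escape a (- 1) n'"
      using in0 below Ky K0
      by (intro enters_escape[OF s ysp _ agree' H(2)]) (auto simp: b_def)
    then show ?thesis ..
  qed
  then show ?thesis unfolding y_def by blast
qed

text \<open>The order of choices is the point: first a bounded part \<open>WB B\<close> and an error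
  \<open>e\<close>, then \<open>n\<close> and \<open>n'\<close> making both escape sets smaller than
  \<open>e / 2\<close>, then the radius \<open>H\<close>, and only then copies on both sides of the
  labels up to \<open>B\<close>. Translation to the copies preserves measure, so \<open>C\<close>
  stays below \<open>e\<close> however far away they are, and \<open>wandering_measure_le\<close>
  bounds \<open>WB B\<close> by \<open>C\<close>.\<close>

theorem stair_conservative:
  assumes a: "often_well_spaced a" and s: "regular s"
    and right: "\<And>H B. \<exists>c>B. \<forall>i. \<bar>i\<bar> \<le> H \<longrightarrow> s (c + i) = p i"
    and left: "\<And>H B. \<exists>c<B. \<forall>i. \<bar>i\<bar> \<le> H \<longrightarrow> s (c + i) = p i"
  shows "conservative (strip UNIV) (stair a s)"
  unfolding conservative_def
proof (intro ballI impI)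
  fix W assume W: "W \<in> sets (strip UNIV)" and wand: "\<forall>x\<in>W. \<forall>n\<ge>1. (stair a s ^^ n) x \<notin> W"
  note mp = measure_preserving_stair[OF s, of a]
  define WB where "WB B = W \<inter> ({0..<1} \<times> {- int B..int B})" for B :: nat
  have WBs: "WB B \<in> sets (strip UNIV)" for B unfolding WB_def using W sets_strip_Times by auto
  have WBw: "(stair a s ^^ n) x \<notin> WB B" if "x \<in> WB B" "n \<ge> 1" for B x n
    using wand that by (auto simp: WB_def)
  have "emeasure (strip UNIV) (WB B) = 0" for B
  proof -
    have "emeasure (strip UNIV) (WB B) \<le> 0"
    proof (rule ennreal_le_epsilon)
      fix e :: real assume e: "0 < e"
      obtain n where n: "emeasure (strip UNIV) (escape a 1 n) < ennreal (e / 2)"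
        using escape_small[OF a, of 1 "ennreal (e / 2)"] e by auto
      obtain n' where n': "emeasure (strip UNIV) (escape a (- 1) n') < ennreal (e / 2)"
        using escape_small[OF a, of "- 1" "ennreal (e / 2)"] e by auto
      \<comment> \<open>One radius for three demands: following \<open>p\<close> for
        \<open>n\<close> and for \<open>n'\<close> steps, and mixed windows within one step of the
        centre.\<close>
      define H where "H = (int n + int n' + 2) * step_bound a + 1 + N"
      have "(int n + 2) * step_bound a \<le> (int n + int n' + 2) * step_bound a"
        "(int n' + 2) * step_bound a \<le> (int n + int n' + 2) * step_bound a"
        "1 * step_bound a \<le> (int n + int n' + 2) * step_bound a"
        using step_bound_pos[of a] by (intro mult_right_mono; simp)+
      then have H: "(int n + 2) * step_bound a + 1 \<le> H" "(int n' + 2) * step_bound a + 1 \<le> H"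
        "step_bound a + 1 + N \<le> H"
        using N_pos by (auto simp: H_def)
      obtain c where c: "c > int B + step_bound a + 1" "\<forall>i. \<bar>i\<bar> \<le> H \<longrightarrow> s (c + i) = p i"
        using right by blast
      obtain c' where c': "c' < - int B - step_bound a - 1" "\<forall>i. \<bar>i\<bar> \<le> H \<longrightarrow> s (c' + i) = p i"
        using left by blast
      define C where "C = (translate c -` escape a 1 n \<inter> space (strip UNIV)) \<union>
          (translate c' -` escape a (- 1) n' \<inter> space (strip UNIV))"
      note tm = measure_preserving_measurable[OF measure_preserving_translate]
      have C: "C \<in> sets (strip UNIV)"
        unfolding C_def by (intro sets.Un measurable_sets[OF tm] escape_measurable)
      have "emeasure (strip UNIV) C \<le>
          emeasure (strip UNIV) (translate c -` escape a 1 n \<inter> space (strip UNIV)) +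
          emeasure (strip UNIV) (translate c' -` escape a (- 1) n' \<inter> space (strip UNIV))"
        unfolding C_def by (intro emeasure_subadditive measurable_sets[OF tm] escape_measurable)
      also have "\<dots> = emeasure (strip UNIV) (escape a 1 n) + emeasure (strip UNIV) (escape a (- 1) n')"
        by (simp only: measure_preserving_emeasure[OF measure_preserving_translate escape_measurable])
      also have "\<dots> \<le> ennreal (e / 2) + ennreal (e / 2)"
        using n n' by (intro add_mono) auto
      also have "\<dots> = ennreal e" using e by (simp flip: ennreal_plus)
      finally have Ce: "emeasure (strip UNIV) C \<le> ennreal e" .
      have "AE z in strip UNIV. z \<in> WB B \<longrightarrow>
          (\<forall>\<^sub>F m in sequentially. (stair a s ^^ m) z \<notin> {0..<1} \<times> {c'..c})"
        by (rule wandering_leaves[OF mp WBs sets_strip_Times emeasure_strip_finite WBw]) simp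
      then have hit: "AE z in strip UNIV. z \<in> WB B \<longrightarrow> (\<exists>m. (stair a s ^^ m) z \<in> C)"
      proof (rule eventually_mono, intro impI)
        fix z assume *: "z \<in> WB B \<longrightarrow> (\<forall>\<^sub>F m in sequentially. (stair a s ^^ m) z \<notin> {0..<1} \<times> {c'..c})"
          and zW: "z \<in> WB B"
        have z: "z \<in> {0..<1} \<times> UNIV" "c' < snd z" "snd z < c"
          using zW c c' step_bound_pos[of a] by (auto simp: WB_def)
        have sp: "(stair a s ^^ m) z \<in> {0..<1} \<times> UNIV" for m by (rule stair_space[OF z(1)])
        have lv: "\<forall>\<^sub>F m in sequentially. \<not> (c' < snd ((stair a s ^^ m) z) \<and> snd ((stair a s ^^ m) z) < c)"
          using *[rule_format, OF zW]
        proof (rule eventually_mono)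
          fix m assume "(stair a s ^^ m) z \<notin> {0..<1} \<times> {c'..c}"
          then show "\<not> (c' < snd ((stair a s ^^ m) z) \<and> snd ((stair a s ^^ m) z) < c)"
            using sp[of m] by (auto simp: mem_Times_iff)
        qed
        obtain m where "translate c ((stair a s ^^ m) z) \<in> escape a 1 n \<or>
            translate c' ((stair a s ^^ m) z) \<in> escape a (- 1) n'"
          using last_exit_escapes[OF s z(1) _ _ H _ _ z(2,3) lv] c c' by auto
        then show "\<exists>m. (stair a s ^^ m) z \<in> C"
          using sp[of m] by (intro exI[of _ m]) (auto simp: C_def)
      qed
      have "emeasure (strip UNIV) (WB B) \<le> emeasure (strip UNIV) C"
        by (rule wandering_measure_le[OF mp WBs C _ hit]) (rule WBw)
      then show "emeasure (strip UNIV) (WB B) \<le> 0 + ennreal e" using Ce by simp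
    qed
    then show ?thesis by simp
  qed
  then have "(\<Union>B. WB B) \<in> null_sets (strip UNIV)" using WBs by (intro null_sets_UN null_setsI) auto
  moreover have "W \<subseteq> (\<Union>B. WB B)"
  proof
    fix z assume z: "z \<in> W"
    then have "z \<in> space (strip UNIV)" using sets.sets_into_space[OF W] by blast
    then have "z \<in> WB (nat \<bar>snd z\<bar>)" using z by (auto simp: WB_def)
    then show "z \<in> (\<Union>B. WB B)" by blast
  qed
  ultimately show "emeasure (strip UNIV) W = 0"
    using W null_sets_subset[of _ "strip UNIV" W] by blast
qed

end

section \<open>Copies of a periodic word\<close>

definition copy_at :: "(int \<Rightarrow> bool) \<Rightarrow> int \<Rightarrow> int \<Rightarrow> (int \<Rightarrow> bool) set" where
  "copy_at p H c = {s. \<forall>i. \<bar>i\<bar> \<le> H \<longrightarrow> s (c + i) = p i}"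

lemma open_copy_at: "open (copy_at p H c)"
proof -
  have op: "open {s :: int \<Rightarrow> bool. s n = b}" for n b
  proof -
    have "open ((\<lambda>s :: int \<Rightarrow> bool. s n) -` {b})"
      by (rule open_vimage) (simp_all add: open_discrete)
    moreover have "(\<lambda>s :: int \<Rightarrow> bool. s n) -` {b} = {s. s n = b}" by auto
    ultimately show ?thesis by simp
  qed
  have "copy_at p H c = (\<Inter>i\<in>{- H..H}. {s. s (c + i) = p i})"
    unfolding copy_at_def by (auto simp: abs_le_iff)
  then show ?thesis using op by (simp add: open_INT)
qed

lemma shift_copy_at: "shift -` copy_at p H c = copy_at p H (c + 1)"
  by (auto simp: copy_at_def shift_def algebra_simps)

text \<open>By invariance the limit superior of the translates of a cylinder set is not smaller than the cylinder.\<close>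

lemma AE_copies:
  fixes \<mu> :: "(int \<Rightarrow> bool) measure"
  assumes prob: "prob_space \<mu>" and sets: "sets \<mu> = sets borel"
    and inv: "shift_invariant \<mu>" and erg: "shift_ergodic \<mu>" and p: "p \<in> measure_support \<mu>"
    and \<sigma>: "\<sigma> = 1 \<or> \<sigma> = (- 1 :: int)"
  shows "AE s in \<mu>. \<forall>H B. \<exists>c>B. s \<in> copy_at p H (\<sigma> * c)"
proof -
  interpret prob_space \<mu> by (rule prob)
  have space: "space \<mu> = UNIV" using sets_eq_imp_space_eq[OF sets] by simp
  have cs: "copy_at p H c \<in> sets \<mu>" for H c
    unfolding sets by (rule borel_open[OF open_copy_at])
  have "shift \<in> borel_measurable (borel :: (int \<Rightarrow> bool) measure)"
  proof (rule borel_measurable_continuous_onI)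
    show "continuous_on UNIV shift"
      unfolding shift_def[abs_def]
      by (intro continuous_on_coordinatewise_then_product continuous_on_product_coordinates)
  qed
  then have sm: "shift \<in> measurable \<mu> \<mu>"
    by (simp add: measurable_cong_sets[OF sets sets])
  have step: "emeasure \<mu> (copy_at p H (c + 1)) = emeasure \<mu> (copy_at p H c)" for H c
  proof -
    have "emeasure \<mu> (copy_at p H c) = emeasure (distr \<mu> \<mu> shift) (copy_at p H c)"
      using inv by (simp add: shift_invariant_def)
    also have "\<dots> = emeasure \<mu> (shift -` copy_at p H c \<inter> space \<mu>)"
      by (rule emeasure_distr[OF sm cs])
    finally show ?thesis by (simp add: space shift_copy_at)
  qed
  have const: "emeasure \<mu> (copy_at p H c) = emeasure \<mu> (copy_at p H 0)" for H c
  proof (induction c rule: int_induct[where k = 0])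
    case (step2 i)
    then show ?case using step[of H "i - 1"] by simp
  qed (use step in auto)
  have pos: "emeasure \<mu> (copy_at p H 0) > 0" for H
    using p open_copy_at[of p H 0] unfolding measure_support_def by (auto simp: copy_at_def)
  have "AE s in \<mu>. \<forall>B. \<exists>c>B. s \<in> copy_at p H (\<sigma> * c)" for H
  proof -
    define E where "E B = (\<Union>c\<in>{B<..}. copy_at p H (\<sigma> * c))" for B :: int
    have Es: "E B \<in> sets \<mu>" for B
      unfolding E_def using cs by (intro sets.countable_UN') auto
    define A where "A = (\<Inter>n::nat. E (int n))"
    have As: "A \<in> sets \<mu>" unfolding A_def using Es by (intro sets.countable_INT) auto
    have Aiff: "s \<in> A \<longleftrightarrow> (\<forall>B. \<exists>c>B. s \<in> copy_at p H (\<sigma> * c))" for s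
    proof
      assume s: "s \<in> A"
      show "\<forall>B. \<exists>c>B. s \<in> copy_at p H (\<sigma> * c)"
      proof
        fix B :: int
        have "s \<in> E (int (nat \<bar>B\<bar>))" using s unfolding A_def by blast
        then obtain c where "c > \<bar>B\<bar>" "s \<in> copy_at p H (\<sigma> * c)" by (auto simp: E_def)
        then show "\<exists>c>B. s \<in> copy_at p H (\<sigma> * c)" by (intro exI[of _ c]) auto
      qed
    qed (auto simp: A_def E_def)
    have "emeasure \<mu> (copy_at p H 0) \<le> (INF n. emeasure \<mu> (E (int n)))"
    proof (rule INF_greatest)
      fix n :: nat
      have "emeasure \<mu> (copy_at p H 0) = emeasure \<mu> (copy_at p H (\<sigma> * (int n + 1)))"
        by (rule const[symmetric])
      also have "\<dots> \<le> emeasure \<mu> (E (int n))"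
      proof (rule emeasure_mono[OF _ Es])
        have "int n + 1 \<in> {int n<..}" by simp
        then show "copy_at p H (\<sigma> * (int n + 1)) \<subseteq> E (int n)" unfolding E_def by blast
      qed
      finally show "emeasure \<mu> (copy_at p H 0) \<le> emeasure \<mu> (E (int n))" .
    qed
    also have "\<dots> = emeasure \<mu> A"
      unfolding A_def
    proof (rule INF_emeasure_decseq)
      show "decseq (\<lambda>n. E (int n))"
      proof (rule decseq_SucI)
        fix n
        have "{int (Suc n)<..} \<subseteq> {int n<..}" by auto
        then show "E (int (Suc n)) \<subseteq> E (int n)"
          unfolding E_def by (rule UN_mono) (rule subset_refl)
      qed
    qed (use Es in \<open>auto simp: emeasure_eq_measure\<close>)
    finally have "emeasure \<mu> A \<noteq> 0" using pos[of H] by auto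
    moreover have "shift -` A \<inter> space \<mu> = A"
    proof -
      \<comment> \<open>As \<open>\<sigma> * \<sigma> = 1\<close>, a shift only moves the index by
        one, and having copies beyond every bound is insensitive to that.\<close>
      have sh: "shift s \<in> copy_at p H (\<sigma> * c) \<longleftrightarrow> s \<in> copy_at p H (\<sigma> * (c + \<sigma>))" for s c
      proof -
        have "\<sigma> * (c + \<sigma>) = \<sigma> * c + 1" using \<sigma> by (auto simp: algebra_simps)
        then show ?thesis using shift_copy_at[of p H "\<sigma> * c"] by auto
      qed
      have "shift s \<in> A \<longleftrightarrow> s \<in> A" for s
        unfolding Aiff sh
      proof (intro iffI allI)
        fix B assume "\<forall>B. \<exists>c>B. s \<in> copy_at p H (\<sigma> * (c + \<sigma>))"
        then obtain c where "c > B + 1" "s \<in> copy_at p H (\<sigma> * (c + \<sigma>))" by blast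
        then show "\<exists>c>B. s \<in> copy_at p H (\<sigma> * c)" using \<sigma> by (intro exI[of _ "c + \<sigma>"]) auto
      next
        fix B assume "\<forall>B. \<exists>c>B. s \<in> copy_at p H (\<sigma> * c)"
        then obtain c where "c > B + 1" "s \<in> copy_at p H (\<sigma> * c)" by blast
        then show "\<exists>c>B. s \<in> copy_at p H (\<sigma> * (c + \<sigma>))" using \<sigma> by (intro exI[of _ "c - \<sigma>"]) auto
      qed
      then show ?thesis by (auto simp: space)
    qed
    ultimately have "emeasure \<mu> (space \<mu> - A) = 0"
      using erg As unfolding shift_ergodic_def by blast
    then have "space \<mu> - A \<in> null_sets \<mu>" using As by (intro null_setsI) auto
    then show ?thesis
      by (rule AE_I') (use Aiff in auto)
  qed
  then show ?thesis unfolding AE_all_countable by blast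
qed

lemma periodic_point_iff: "periodic_point p \<longleftrightarrow> (\<exists>n>0. \<forall>i. p (i + int n) = p i)"
proof -
  have "(shift ^^ n) p = (\<lambda>i. p (i + int n))" for n
    by (induction n) (auto simp: shift_def algebra_simps)
  then show ?thesis by (auto simp: periodic_point_def fun_eq_iff)
qed

lemma periodic_word_of_periodic_point:
  assumes p: "periodic_point p" "p \<noteq> (\<lambda>_. False)" "p \<noteq> (\<lambda>_. True)"
  obtains N where "periodic_word p N"
proof -
  obtain n where n: "n > 0" "\<And>i. p (i + int n) = p i" using p(1) by (auto simp: periodic_point_iff)
  have mult: "p (i + t * int n) = p i" for i t
  proof (induction t rule: int_induct[where k = 0])
    case (step1 t)
    then show ?case using n(2)[of "i + t * int n"] by (simp add: algebra_simps)
  next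
    case (step2 t)
    then show ?case using n(2)[of "i + (t - 1) * int n"] by (simp add: algebra_simps)
  qed simp
  have ex: "\<exists>z\<in>{x..<x + int n}. p z = p i" for x i
  proof
    have "x + (i - x) mod int n = i + (- ((i - x) div int n)) * int n"
      by (simp add: minus_div_mult_eq_mod[symmetric])
    then show "p (x + (i - x) mod int n) = p i" by (simp only: mult)
    show "x + (i - x) mod int n \<in> {x..<x + int n}" using n(1) by simp
  qed
  obtain i j where "p i" "\<not> p j" using p(2,3) by (auto simp: fun_eq_iff)
  then have "mixed p (int n) x" for x
    using ex[of x i] ex[of x j] by (auto simp: mixed_def)
  then have "periodic_word p (int n)" using n(2) by unfold_locales
  then show thesis by (rule that)
qed

lemma (in periodic_word) regular_of_copies:
  assumes right: "\<And>B. \<exists>c>B. s \<in> copy_at p N c" and left: "\<And>B. \<exists>c<B. s \<in> copy_at p N c"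
  shows "regular s"
proof -
  obtain i j where ij: "i \<in> {0..<N}" "p i" "j \<in> {0..<N}" "\<not> p j"
    using mixed[of 0] by (auto simp: mixed_def)
  have sij: "s (c + i)" "\<not> s (c + j)" if "s \<in> copy_at p N c" for c
    using that ij by (auto simp: copy_at_def)
  have "\<exists>m\<ge>n. s m" "\<exists>m\<ge>n. \<not> s m" for n
  proof -
    obtain c where c: "c > n" "s \<in> copy_at p N c" using right by blast
    show "\<exists>m\<ge>n. s m" using sij(1)[OF c(2)] ij c by (intro exI[of _ "c + i"]) auto
    show "\<exists>m\<ge>n. \<not> s m" using sij(2)[OF c(2)] ij c by (intro exI[of _ "c + j"]) auto
  qed
  moreover have "\<exists>m\<le>n. s m" "\<exists>m\<le>n. \<not> s m" for n
  proof -
    obtain c where c: "c < n - N" "s \<in> copy_at p N c" using left by blast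
    show "\<exists>m\<le>n. s m" using sij(1)[OF c(2)] ij c by (intro exI[of _ "c + i"]) auto
    show "\<exists>m\<le>n. \<not> s m" using sij(2)[OF c(2)] ij c by (intro exI[of _ "c + j"]) auto
  qed
  ultimately show ?thesis by (simp add: regular_def zeros_unbounded_def)
qed

section \<open>Trajectories on the staircase\<close>

definition corner_point :: "int \<times> real \<times> real \<Rightarrow> bool" where
  "corner_point q \<longleftrightarrow> fst (snd q) \<in> {0, 1} \<and> snd (snd q) \<in> {0, 1}"

text \<open>
  Away from the corners every point of the staircase has exactly one representative on neither the
  right nor the top edge of its square.
\<close>

definition canonical :: "(int \<Rightarrow> bool) \<Rightarrow> int \<times> real \<times> real \<Rightarrow> int \<times> real \<times> real" where
  "canonical s q = (if fst (snd q) = 1 then (right_of s (fst q), 0, snd (snd q))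
     else if snd (snd q) = 1 then (above s (fst q), fst (snd q), 0) else q)"

lemma above_eq_iff: "regular s \<Longrightarrow> above s n = m \<longleftrightarrow> glued_top s n m"
  unfolding above_def glued_top_eq by (rule right_of_eq_iff) (simp add: regular_def)

lemma right_eq_iff: "regular s \<Longrightarrow> right_of s n = m \<longleftrightarrow> glued_right s n m"
  by (rule right_of_eq_iff) (simp add: regular_def)

lemma edge_gluing_canonical:
  assumes s: "regular s" and e: "(q, q') \<in> edge_gluing s"
  shows "corner_point q = corner_point q' \<and> (\<not> corner_point q \<longrightarrow> canonical s q = canonical s q')"
  using e right_eq_iff[OF s] above_eq_iff[OF s]
  unfolding edge_gluing_def corner_point_def canonical_def by auto

text \<open>A point that is not a corner lies on at most one edge, so both ends of a gluing have the
  same canonical representative, and a chain of gluings never passes between corner points and other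
  points.\<close>

lemma identified_canonical:
  assumes s: "regular s" and e: "(q, q') \<in> identified s"
  shows "corner_point q = corner_point q' \<and> (\<not> corner_point q \<longrightarrow> canonical s q = canonical s q')"
  using e unfolding identified_def
proof (induction rule: rtrancl_induct)
  case (step y z)
  then show ?case using edge_gluing_canonical[OF s, of y z] edge_gluing_canonical[OF s, of z y] by auto
qed simp

lemma equiv_identified: "equiv UNIV (identified s)"
proof (rule equivI)
  show "sym (identified s)"
    unfolding identified_def by (rule sym_rtrancl) (auto simp: sym_def)
qed (auto simp: identified_def refl_on_def trans_rtrancl)

lemma surface_class_eq_iff: "surface_class s q = surface_class s q' \<longleftrightarrow> (q, q') \<in> identified s"
  unfolding surface_class_def using eq_equiv_class_iff[OF equiv_identified] by auto

lemma surface_class_in_corners_iff: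
  assumes "regular s"
  shows "surface_class s q \<in> corners s \<longleftrightarrow> corner_point q"
proof
  assume "surface_class s q \<in> corners s"
  then obtain q' where "q' \<in> UNIV \<times> {0, 1} \<times> {0, 1}" "surface_class s q = surface_class s q'"
    unfolding corners_def by blast
  then show "corner_point q"
    using identified_canonical[OF assms, of q q'] by (auto simp: surface_class_eq_iff corner_point_def)
next
  assume "corner_point q"
  then have "q \<in> UNIV \<times> {0, 1} \<times> {0, 1}" by (cases q) (auto simp: corner_point_def)
  then show "surface_class s q \<in> corners s" unfolding corners_def by (rule imageI)
qed

lemma surface_class_glue_right:
  assumes "regular s" "y \<in> {0..1}"
  shows "surface_class s (n, 1, y) = surface_class s (right_of s n, 0, y)"
  unfolding surface_class_eq_iff identified_def edge_gluing_def
  using assms right_eq_iff[OF assms(1)] by (intro r_into_rtrancl) auto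

lemma surface_class_glue_top:
  assumes "regular s" "x \<in> {0..1}"
  shows "surface_class s (n, x, 1) = surface_class s (above s n, x, 0)"
  unfolding surface_class_eq_iff identified_def edge_gluing_def
  using assms above_eq_iff[OF assms(1)] by (intro r_into_rtrancl) auto

lemma surface_class_in_staircase: "p \<in> unit_square \<Longrightarrow> surface_class s (n, p) \<in> staircase s"
  unfolding staircase_def surface_class_def by (intro quotientI) auto

lemma surface_class_eq_imp_canonical_eq:
  assumes "regular s" "surface_class s q = surface_class s q'" "surface_class s q \<notin> corners s"
  shows "canonical s q = canonical s q'" "\<not> corner_point q" "\<not> corner_point q'"
  using identified_canonical[OF assms(1), of q q'] assms
  by (auto simp: surface_class_eq_iff[symmetric] surface_class_in_corners_iff)

text \<open>A point on a right or top edge has a canonical representative with a zero coordinate, so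
  it cannot share a class with an interior point.\<close>

lemma interior_class_eq:
  assumes s: "regular s" and q: "snd q \<in> {0<..<1} \<times> {0<..<1}" and eq: "surface_class s q = surface_class s q'"
  shows "q = q'"
proof -
  have "\<not> corner_point q" using q by (auto simp: corner_point_def)
  then have "canonical s q = canonical s q'"
    using identified_canonical[OF s, of q q'] eq by (simp add: surface_class_eq_iff)
  moreover have "canonical s q = q" using q by (auto simp: canonical_def)
  ultimately show ?thesis using q by (auto simp: canonical_def split: if_splits)
qed

lemma inj_gluing: "regular s \<Longrightarrow> inj (right_of s) \<and> inj (above s)"
  using bij_above[of s] bij_right_of[of s] by (auto simp: regular_def bij_is_inj)

text \<open>A segment moving right cannot start on a right edge, one moving left cannot start on a
  left edge, and likewise vertically. Hence both starting points use the same side of every edge,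
  where the injectivity of the gluings identifies them.\<close>

lemma segment_start_unique:
  assumes s: "regular s" and u: "u \<noteq> 0" and v: "v \<noteq> 0" and h: "h > 0"
    and p: "x \<in> {0..1}" "y \<in> {0..1}" "x + h * u \<in> {0..1}" "y + h * v \<in> {0..1}"
    and p': "x' \<in> {0..1}" "y' \<in> {0..1}" "x' + h * u \<in> {0..1}" "y' + h * v \<in> {0..1}"
    and eq: "surface_class s (n, x, y) = surface_class s (n', x', y')"
    and nc: "surface_class s (n, x, y) \<notin> corners s"
  shows "n = n' \<and> x = x' \<and> y = y'"
proof -
  note c = surface_class_eq_imp_canonical_eq[OF s eq nc]
  have xs: "(x \<noteq> 1 \<and> x' \<noteq> 1) \<or> (x \<noteq> 0 \<and> x' \<noteq> 0)"
  proof (cases "u > 0")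
    case True
    then have "h * u > 0" using h by simp
    then show ?thesis using p p' by auto
  next
    case False
    then have "h * u < 0" using h u by (simp add: mult_less_0_iff)
    then show ?thesis using p p' by auto
  qed
  have ys: "(y \<noteq> 1 \<and> y' \<noteq> 1) \<or> (y \<noteq> 0 \<and> y' \<noteq> 0)"
  proof (cases "v > 0")
    case True
    then have "h * v > 0" using h by simp
    then show ?thesis using p p' by auto
  next
    case False
    then have "h * v < 0" using h v by (simp add: mult_less_0_iff)
    then show ?thesis using p p' by auto
  qed
  show ?thesis
    using c xs ys inj_gluing[OF s]
    by (auto simp: canonical_def corner_point_def inj_eq split: if_splits)
qed

section \<open>Uniqueness of trajectories\<close>

lemma strictly_between:
  fixes x u e h :: real
  assumes "u \<noteq> 0" "- e < h" "h < 0" "x \<in> {0..1}" "x + (- e) * u \<in> {0..1}"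
  shows "x + h * u \<in> {0<..<1}"
proof (cases "u > 0")
  case True
  then have "h * u < 0" using assms(3) by (simp add: mult_neg_pos)
  moreover have "(- e) * u < h * u" using assms(2) True by (rule mult_strict_right_mono)
  ultimately show ?thesis using assms(4,5) by auto
next
  case False
  then have "u < 0" using assms(1) by simp
  then have "h * u > 0" using assms(3) by (simp add: mult_neg_neg)
  moreover have "h * u < (- e) * u" using assms(2) \<open>u < 0\<close> by (rule mult_strict_right_mono_neg)
  ultimately show ?thesis using assms(4,5) by auto
qed

lemma trajectory_forward:
  assumes s: "regular s" and u: "u \<noteq> 0" and v: "v \<noteq> 0"
    and \<gamma>: "is_trajectory s (u, v) \<gamma>" and \<gamma>': "is_trajectory s (u, v) \<gamma>'" and eq: "\<gamma> t = \<gamma>' t"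
  shows "\<exists>e>0. \<forall>h\<in>{0..e}. \<gamma> (t + h) = \<gamma>' (t + h)"
proof -
  obtain e n x y where e: "e > 0" and seg: "\<forall>h\<in>{0..e}. (x, y) + h *\<^sub>R (u, v) \<in> unit_square \<and>
      \<gamma> (t + h) = surface_class s (n, (x, y) + h *\<^sub>R (u, v))"
    using \<gamma> unfolding is_trajectory_def by (metis surj_pair)
  obtain e' n' x' y' where e': "e' > 0" and seg': "\<forall>h\<in>{0..e'}. (x', y') + h *\<^sub>R (u, v) \<in> unit_square \<and>
      \<gamma>' (t + h) = surface_class s (n', (x', y') + h *\<^sub>R (u, v))"
    using \<gamma>' unfolding is_trajectory_def by (metis surj_pair)
  define d where "d = min e e'"
  have d: "d > 0" "d \<le> e" "d \<le> e'" using e e' by (auto simp: d_def)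
  have nc: "\<gamma> t \<notin> corners s" using \<gamma> unfolding is_trajectory_def by blast
  have p0: "\<gamma> t = surface_class s (n, x, y)" "x \<in> {0..1}" "y \<in> {0..1}"
    using seg[rule_format, of 0] e by (auto simp: unit_square_def)
  have q0: "\<gamma>' t = surface_class s (n', x', y')" "x' \<in> {0..1}" "y' \<in> {0..1}"
    using seg'[rule_format, of 0] e' by (auto simp: unit_square_def)
  have p1: "x + d * u \<in> {0..1}" "y + d * v \<in> {0..1}"
    using seg[rule_format, of d] d by (auto simp: unit_square_def)
  have q1: "x' + d * u \<in> {0..1}" "y' + d * v \<in> {0..1}"
    using seg'[rule_format, of d] d by (auto simp: unit_square_def)
  have "n = n' \<and> x = x' \<and> y = y'"
    by (rule segment_start_unique[OF s u v d(1) p0(2,3) p1 q0(2,3) q1]) (use p0(1) q0(1) eq nc in auto)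
  then show ?thesis using seg seg' d by (intro exI[of _ d]) auto
qed

text \<open>Closedness of the agreement set is obtained without a topology on the surface: a little
  before \<open>t\<close> both backward segments pass through the same surface point, which on one
  of them is interior to a square. There the representative is unique, so the two segments coincide
  up to time \<open>t\<close>.\<close>

lemma trajectory_closed:
  assumes s: "regular s" and u: "u \<noteq> 0" and v: "v \<noteq> 0"
    and \<gamma>: "is_trajectory s (u, v) \<gamma>" and \<gamma>': "is_trajectory s (u, v) \<gamma>'"
    and l: "l < t" and eq: "\<And>r. l \<le> r \<Longrightarrow> r < t \<Longrightarrow> \<gamma> r = \<gamma>' r"
  shows "\<gamma> t = \<gamma>' t"
proof -
  obtain e n x y where e: "e > 0" and seg: "\<forall>h\<in>{-e..0}. (x, y) + h *\<^sub>R (u, v) \<in> unit_square \<and>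
      \<gamma> (t + h) = surface_class s (n, (x, y) + h *\<^sub>R (u, v))"
    using \<gamma> unfolding is_trajectory_def by (metis surj_pair)
  obtain e' n' x' y' where e': "e' > 0" and seg': "\<forall>h\<in>{-e'..0}. (x', y') + h *\<^sub>R (u, v) \<in> unit_square \<and>
      \<gamma>' (t + h) = surface_class s (n', (x', y') + h *\<^sub>R (u, v))"
    using \<gamma>' unfolding is_trajectory_def by (metis surj_pair)
  define h where "h = - (min (t - l) (min e e') / 2)"
  have h: "h < 0" "- e < h" "- e' < h" "l \<le> t + h" 
  proof -
    have "min (t - l) (min e e') > 0" using e e' l by simp
    moreover have "min (t - l) (min e e') \<le> t - l" "min (t - l) (min e e') \<le> e" "min (t - l) (min e e') \<le> e'"
      by auto
    ultimately show "h < 0" "- e < h" "- e' < h" "l \<le> t + h" unfolding h_def using l by linarith+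
  qed
  have seg0: "x \<in> {0..1}" "y \<in> {0..1}"
    using seg[rule_format, of 0] e by (auto simp: unit_square_def)
  have sege: "x + (- e) * u \<in> {0..1}" "y + (- e) * v \<in> {0..1}"
    using seg[rule_format, of "- e"] e by (auto simp: unit_square_def)
  have "x + h * u \<in> {0<..<1}" by (rule strictly_between[OF u h(2,1) seg0(1) sege(1)])
  moreover have "y + h * v \<in> {0<..<1}" by (rule strictly_between[OF v h(2,1) seg0(2) sege(2)])
  moreover have "surface_class s (n, x + h * u, y + h * v) = surface_class s (n', x' + h * u, y' + h * v)"
    using seg[rule_format, of h] seg'[rule_format, of h] eq[of "t + h"] h by auto
  ultimately have "(n, x + h * u, y + h * v) = (n', x' + h * u, y' + h * v)"
    by (intro interior_class_eq[OF s]) auto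
  then have "n = n' \<and> x = x' \<and> y = y'" by simp
  then show ?thesis using seg[rule_format, of 0] seg'[rule_format, of 0] e e' by auto
qed

text \<open>At the infimum of the times of disagreement the trajectories agree by
  \<open>trajectory_closed\<close>, hence also for a while afterwards by
  \<open>trajectory_forward\<close>.\<close>

lemma trajectory_unique:
  assumes s: "regular s" and u: "u \<noteq> 0" and v: "v \<noteq> 0"
    and \<gamma>: "is_trajectory s (u, v) \<gamma>" and \<gamma>': "is_trajectory s (u, v) \<gamma>'"
    and start: "\<gamma> 0 = \<gamma>' 0" and t: "t \<ge> 0"
  shows "\<gamma> t = \<gamma>' t"
proof (rule ccontr)
  assume ne: "\<gamma> t \<noteq> \<gamma>' t"
  define D where "D = {r. 0 \<le> r \<and> \<gamma> r \<noteq> \<gamma>' r}"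
  have D: "t \<in> D" "bdd_below D" using t ne by (auto simp: D_def bdd_below_def)
  define T where "T = Inf D"
  have T0: "0 \<le> T" unfolding T_def using D by (intro cInf_greatest) (auto simp: D_def)
  have before: "\<gamma> r = \<gamma>' r" if "0 \<le> r" "r < T" for r
    using that cInf_lower[of r D] D(2) by (force simp: T_def D_def)
  have "\<gamma> T = \<gamma>' T"
  proof (cases "T = 0")
    case False
    then have "0 < T" using T0 by simp
    then show ?thesis by (rule trajectory_closed[OF s u v \<gamma> \<gamma>' _ before])
  qed (use start in simp)
  then obtain e where e: "e > 0" "\<forall>h\<in>{0..e}. \<gamma> (T + h) = \<gamma>' (T + h)"
    using trajectory_forward[OF s u v \<gamma> \<gamma>'] by blast
  obtain r where r: "r \<in> D" "r < T + e"
    using cInf_lessD[of D "T + e"] D(1) e(1) by (auto simp: T_def)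
  have "T \<le> r" unfolding T_def using r D by (intro cInf_lower) auto
  then have "\<gamma> (T + (r - T)) = \<gamma>' (T + (r - T))" using r e by (intro e(2)[rule_format]) auto
  then show False using r by (simp add: D_def)
qed

lemma straight_line_flow_eq:
  assumes s: "regular s" and u: "u \<noteq> 0" and v: "v \<noteq> 0"
    and \<gamma>: "is_trajectory s (u, v) \<gamma>" and t: "t \<ge> 0"
  shows "straight_line_flow s (u, v) t (\<gamma> 0) = \<gamma> t"
  unfolding straight_line_flow_def
  by (rule the_equality) (use \<gamma> trajectory_unique[OF s u v _ \<gamma> _ t] in blast)+

text \<open>The crossings to be undone are those of the forward step, so their number is computed
  from the recovered abscissa \<open>frac (fst z - a)\<close>.\<close>

definition stair_inv :: "real \<Rightarrow> (int \<Rightarrow> bool) \<Rightarrow> real \<times> int \<Rightarrow> real \<times> int" where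
  "stair_inv a s z = (frac (fst z - a), inv (climb s \<lfloor>frac (fst z - a) + a\<rfloor>) (snd z))"

lemma stair_inv_space: "stair_inv a s z \<in> {0..<1} \<times> UNIV"
  by (simp add: stair_inv_def frac_lt_1)

lemma stair_stair_inv:
  assumes "regular s" "z \<in> {0..<1} \<times> UNIV"
  shows "stair a s (stair_inv a s z) = z"
proof -
  have "frac (frac (fst z - a) + a) = frac (fst z)"
    by (simp add: frac_def)
  also have 2: "\<dots> = fst z" using assms(2) by (auto simp: frac_eq)
  finally have 1: "frac (frac (fst z - a) + a) = fst z" .
  have "climb s j (inv (climb s j) k) = k" for j k
    using bij_climb[OF assms(1)] by (simp add: bij_is_surj surj_f_inv_f)
  then show ?thesis by (simp add: stair_def stair_inv_def skew_def 1 2 prod_eq_iff)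
qed

lemma stays_in_unit_interval:
  fixes X w :: real
  obtains c :: int and e where "e > 0" "\<And>h. 0 \<le> h \<Longrightarrow> h \<le> e \<Longrightarrow> c \<le> X + h * w \<and> X + h * w \<le> c + 1"
proof (cases "w \<ge> 0")
  case True
  \<comment> \<open>The denominator is \<open>w + 1\<close> because \<open>w\<close> may be
    0.\<close>
  define e where "e = (\<lfloor>X\<rfloor> + 1 - X) / (w + 1)"
  have e: "e > 0" using True unfolding e_def by (intro divide_pos_pos) linarith+
  have "\<lfloor>X\<rfloor> \<le> X + h * w \<and> X + h * w \<le> \<lfloor>X\<rfloor> + 1" if h: "0 \<le> h" "h \<le> e" for h
  proof -
    have "h * w \<le> e * (w + 1)" using h True e by (intro mult_mono) auto
    also have "\<dots> = \<lfloor>X\<rfloor> + 1 - X" using True by (simp add: e_def)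
    finally have "X + h * w \<le> \<lfloor>X\<rfloor> + 1" by simp
    moreover have "0 \<le> h * w" using h True by simp
    ultimately show ?thesis by linarith
  qed
  then show thesis using that[of e "\<lfloor>X\<rfloor>"] e by blast
next
  case False
  \<comment> \<open>With negative speed an integral \<open>X\<close> has to be seen as the right end
    of the interval to its left.\<close>
  define c where "c = \<lceil>X\<rceil> - 1"
  have c: "c < X" "X \<le> c + 1" unfolding c_def by linarith+
  define e where "e = (X - c) / (1 - w)"
  have e: "e > 0" using False c unfolding e_def by (intro divide_pos_pos) auto
  have "c \<le> X + h * w \<and> X + h * w \<le> c + 1" if h: "0 \<le> h" "h \<le> e" for h
  proof -
    have "h * (- w) \<le> e * (1 - w)" using h False e by (intro mult_mono) auto
    also have "\<dots> = X - c" using False by (simp add: e_def)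
    finally have "c \<le> X + h * w" by simp
    moreover have "h * w \<le> 0" using h False by (simp add: mult_nonneg_nonpos)
    ultimately show ?thesis using c by linarith
  qed
  then show thesis using that[of e c] e by blast
qed

text \<open>
  A line of slope \<open>1 / a\<close> in the plane, with abscissa \<open>x0\<close> at height 0, that avoids the integer
  lattice. At height \<open>j\<close> it lies in the column \<open>\<lfloor>x0 + a * j\<rfloor>\<close>, where the square above it has the label
  \<open>label j\<close>; \<open>cell c j\<close> is the label of the square lying over column \<open>c\<close> in the same row.
\<close>

locale generic_line =
  fixes s :: "int \<Rightarrow> bool" and a x0 :: real and k0 :: int
  assumes s: "regular s" and generic: "\<And>j::int. x0 + a * j \<notin> \<int>"
begin

definition orbit :: "int \<Rightarrow> real \<times> int" where
  "orbit j = ziter (stair a s) (stair_inv a s) j (frac x0, k0)"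

definition label :: "int \<Rightarrow> int" where
  "label j = snd (orbit j)"

definition cell :: "int \<Rightarrow> int \<Rightarrow> int" where
  "cell c j = zpow (right_of s) (c - \<lfloor>x0 + a * j\<rfloor>) (label j)"

lemma orbit_plus_1: "orbit (j + 1) = stair a s (orbit j)"
  unfolding orbit_def
  by (rule ziter_plus_1[of _ "{0..<1} \<times> UNIV"])
    (use stair_inv_space stair_stair_inv[OF s] in \<open>auto simp: frac_lt_1\<close>)

lemma orbit_0: "orbit 0 = (frac x0, k0)"
  by (simp add: orbit_def)

lemma orbit_space: "orbit j \<in> {0..<1} \<times> UNIV"
proof -
  have "orbit (j - 1 + 1) = stair a s (orbit (j - 1))" by (rule orbit_plus_1)
  then show ?thesis by (simp add: stair_def skew_def frac_lt_1)
qed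

lemma fst_orbit: "fst (orbit j) = frac (x0 + a * j)"
proof (induction j rule: int_induct[where k = 0])
  case (step1 j)
  have "fst (orbit (j + 1)) = frac (fst (orbit j) + a)"
    by (simp only: orbit_plus_1) (simp add: stair_def skew_def)
  also have "\<dots> = frac (x0 + a * real_of_int j + a)" using step1 by simp
  finally show ?case by (simp add: algebra_simps)
next
  case (step2 j)
  define f where "f = fst (orbit (j - 1))"
  have f: "frac f = f" using orbit_space[of "j - 1"] by (auto simp: f_def frac_eq mem_Times_iff)
  have "frac (f + a) = frac (x0 + a * j)"
    using orbit_plus_1[of "j - 1"] step2 by (simp add: stair_def skew_def f_def)
  then have "f = (x0 + a * real_of_int (j - 1)) + real_of_int (\<lfloor>f + a\<rfloor> - \<lfloor>x0 + a * j\<rfloor>)"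
    by (simp add: frac_def algebra_simps)
  then have "frac f = frac ((x0 + a * real_of_int (j - 1)) + real_of_int (\<lfloor>f + a\<rfloor> - \<lfloor>x0 + a * j\<rfloor>))"
    by (rule arg_cong)
  also have "\<dots> = frac (x0 + a * real_of_int (j - 1))" unfolding frac_def by (simp only: floor_add_int[symmetric])
  finally show ?case using f by (simp add: f_def)
qed (simp add: orbit_0)

lemma bij_right: "bij (right_of s)"
  using s by (simp add: bij_right_of regular_def)

lemma cell_right: "cell (c + 1) j = right_of s (cell c j)"
  unfolding cell_def using zpow_plus_1[OF bij_right, of "c - \<lfloor>x0 + a * j\<rfloor>"]
  by (simp add: algebra_simps)

text \<open>Rows \<open>j\<close> and \<open>j + 1\<close> are matched only in the column where the
  line crosses height \<open>j + 1\<close>; that is the one place where the trajectory passes from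
  one row to the other.\<close>

lemma cell_top: "cell \<lfloor>x0 + a * (j + 1)\<rfloor> (j + 1) = above s (cell \<lfloor>x0 + a * (j + 1)\<rfloor> j)"
proof -
  have "label (j + 1) = climb s \<lfloor>fst (orbit j) + a\<rfloor> (label j)"
    by (simp add: label_def orbit_plus_1 stair_def skew_def)
  also have "\<lfloor>fst (orbit j) + a\<rfloor> = \<lfloor>x0 + a * (j + 1)\<rfloor> - \<lfloor>x0 + a * j\<rfloor>"
  proof -
    have "fst (orbit j) + a = (x0 + a * (j + 1)) - \<lfloor>x0 + a * j\<rfloor>"
      by (simp add: fst_orbit frac_def algebra_simps)
    then show ?thesis by simp
  qed
  finally show ?thesis by (simp add: cell_def climb_def)
qed

definition point :: "real \<Rightarrow> surface_point" where
  "point Y = surface_class s (cell \<lfloor>x0 + a * Y\<rfloor> \<lfloor>Y\<rfloor>, frac (x0 + a * Y), frac Y)"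

text \<open>\<open>point\<close> uses the representative off the right and top edges. On these edges
  of the closed cell the formula is restored by one gluing; both cannot be needed at once, since a
  generic line has no integral abscissa at an integral height.\<close>

lemma point_in_cell:
  assumes X: "c \<le> x0 + a * Y" "x0 + a * Y \<le> c + 1" and Y: "j \<le> Y" "Y \<le> j + 1"
  shows "point Y = surface_class s (cell c j, x0 + a * Y - c, Y - j)"
proof (cases "Y = j + 1")
  case True
  have "x0 + a * Y \<noteq> c" "x0 + a * Y \<noteq> c + 1"
    using generic[of "j + 1"] True by (metis Ints_of_int of_int_1 of_int_add)+
  then have fX: "\<lfloor>x0 + a * Y\<rfloor> = c" using X by (intro floor_unique) auto
  have "point Y = surface_class s (cell c (j + 1), x0 + a * Y - c, 0)"
    using True fX by (simp add: point_def frac_def)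
  also have "cell c (j + 1) = above s (cell c j)"
    using cell_top[of j] fX True by (simp add: add.commute)
  finally show ?thesis
    using surface_class_glue_top[OF s, of "x0 + a * Y - c"] X True by simp
next
  case False
  then have fY: "\<lfloor>Y\<rfloor> = j" using Y by (intro floor_unique) auto
  show ?thesis
  proof (cases "x0 + a * Y = c + 1")
    case True
    then have "\<lfloor>x0 + a * Y\<rfloor> = c + 1" by (metis floor_of_int of_int_1 of_int_add)
    then have "point Y = surface_class s (right_of s (cell c j), 0, Y - j)"
      using True fY by (simp add: point_def frac_def cell_right)
    then show ?thesis
      using surface_class_glue_right[OF s, of "Y - j" "cell c j"] Y True by simp
  next
    case ne: False
    then have "\<lfloor>x0 + a * Y\<rfloor> = c" using X by (intro floor_unique) auto
    then show ?thesis using fY by (simp add: point_def frac_def)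
  qed
qed

lemma point_not_corner: "point Y \<in> staircase s - corners s"
proof -
  have "(frac (x0 + a * Y), frac Y) \<in> unit_square"
    by (simp add: unit_square_def frac_lt_1 less_imp_le)
  then have "point Y \<in> staircase s" unfolding point_def by (rule surface_class_in_staircase)
  moreover have "\<not> corner_point (n, frac (x0 + a * Y), frac Y)" for n
  proof
    assume "corner_point (n, frac (x0 + a * Y), frac Y)"
    then have "frac (x0 + a * Y) = 0" "frac Y = 0"
      using frac_lt_1[of Y] frac_lt_1[of "x0 + a * Y"] by (auto simp: corner_point_def)
    then have "x0 + a * Y \<in> \<int>" by (simp add: frac_eq_0_iff)
    moreover have "Y = real_of_int \<lfloor>Y\<rfloor>" using \<open>frac Y = 0\<close> by (simp add: frac_def)
    ultimately show False using generic[of "\<lfloor>Y\<rfloor>"] by metis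
  qed
  ultimately show ?thesis using surface_class_in_corners_iff[OF s] by (simp add: point_def)
qed

lemma point_segment:
  assumes av: "a * v = u"
  shows "\<exists>e>0. \<exists>n p. \<forall>h\<in>{0..e}. p + h *\<^sub>R (u, v) \<in> unit_square \<and>
    point (Y + h * v) = surface_class s (n, p + h *\<^sub>R (u, v))"
proof -
  define X where "X = x0 + a * Y"
  obtain c e1 where c: "e1 > 0" "\<And>h. 0 \<le> h \<Longrightarrow> h \<le> e1 \<Longrightarrow> real_of_int c \<le> X + h * u \<and> X + h * u \<le> real_of_int (c + 1)"
    using stays_in_unit_interval[of X u] by blast
  obtain j e2 where j: "e2 > 0" "\<And>h. 0 \<le> h \<Longrightarrow> h \<le> e2 \<Longrightarrow> real_of_int j \<le> Y + h * v \<and> Y + h * v \<le> real_of_int (j + 1)"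
    using stays_in_unit_interval[of Y v] by blast
  have "(X - c, Y - j) + h *\<^sub>R (u, v) \<in> unit_square \<and>
      point (Y + h * v) = surface_class s (cell c j, (X - c, Y - j) + h *\<^sub>R (u, v))"
    if h: "h \<in> {0..min e1 e2}" for h
  proof -
    have eq: "x0 + a * (Y + h * v) = X + h * u"
      using av by (simp add: X_def algebra_simps flip: av)
    have "c \<le> X + h * u \<and> X + h * u \<le> c + 1" "j \<le> Y + h * v \<and> Y + h * v \<le> j + 1"
      using c(2)[of h] j(2)[of h] h by auto
    then show ?thesis
      using point_in_cell[of c "Y + h * v" j] eq by (auto simp: unit_square_def algebra_simps)
  qed
  moreover have "0 < min e1 e2" using c(1) j(1) by simp
  ultimately show ?thesis by blast
qed

lemma trajectory_point:
  assumes av: "a * v = u"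
  shows "is_trajectory s (u, v) (\<lambda>t. point (y + t * v))"
  unfolding is_trajectory_def
proof (intro allI conjI)
  fix t
  show "point (y + t * v) \<in> staircase s - corners s" by (rule point_not_corner)
  have eq: "y + t * v + h * v = y + (t + h) * v" for h by (simp add: algebra_simps)
  show "\<exists>e>0. \<exists>n p. \<forall>h\<in>{0..e}. p + h *\<^sub>R (u, v) \<in> unit_square \<and>
      point (y + (t + h) * v) = surface_class s (n, p + h *\<^sub>R (u, v))"
    using point_segment[OF av, of "y + t * v"] unfolding eq .
  \<comment> \<open>The backward half of a trajectory is the forward half for the reversed
    direction.\<close>
  have "a * (- v) = - u" using av by simp
  from point_segment[OF this, of "y + t * v"] obtain e n p where e: "e > 0"
    and seg: "\<forall>h\<in>{0..e}. p + h *\<^sub>R (- u, - v) \<in> unit_square \<and>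
      point (y + t * v + h * (- v)) = surface_class s (n, p + h *\<^sub>R (- u, - v))" by blast
  have "p + h *\<^sub>R (u, v) \<in> unit_square \<and> point (y + (t + h) * v) = surface_class s (n, p + h *\<^sub>R (u, v))"
    if "h \<in> {- e..0}" for h
    using seg[rule_format, of "- h"] that by (simp add: algebra_simps)
  then show "\<exists>e>0. \<exists>n p. \<forall>h\<in>{- e..0}. p + h *\<^sub>R (u, v) \<in> unit_square \<and>
      point (y + (t + h) * v) = surface_class s (n, p + h *\<^sub>R (u, v))"
    using e by blast
qed

lemma point_at_level:
  assumes y: "y \<in> {0..<1}"
  shows "point (y + of_int j) = surface_class s
    (zpow (right_of s) \<lfloor>fst (orbit j) + a * y\<rfloor> (snd (orbit j)), frac (fst (orbit j) + a * y), y)"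
proof -
  have eq: "x0 + a * (y + of_int j) = (fst (orbit j) + a * y) + \<lfloor>x0 + a * j\<rfloor>"
    by (simp add: fst_orbit frac_def algebra_simps)
  have fy: "\<lfloor>y + of_int j\<rfloor> = j" using y by (intro floor_unique) auto
  have "frac (y + of_int j) = y" unfolding frac_def fy by simp
  moreover have "frac (x0 + a * (y + of_int j)) = frac (fst (orbit j) + a * y)"
    unfolding eq by (simp add: frac_def)
  moreover have "\<lfloor>x0 + a * (y + of_int j)\<rfloor> - \<lfloor>x0 + a * j\<rfloor> = \<lfloor>fst (orbit j) + a * y\<rfloor>"
    unfolding eq by simp
  ultimately show ?thesis by (simp add: point_def fy cell_def label_def)
qed

end

section \<open>Recurrence of the flow\<close>

lemma AE_strip_section:
  assumes P: "AE z in strip I. P z" and k: "k \<in> I"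
  shows "AE x in unit_interval. P (x, k)"
proof -
  obtain Z where Z: "Z \<in> null_sets (strip I)" "{z \<in> space (strip I). \<not> P z} \<subseteq> Z"
    using P by (auto simp only: eventually_ae_filter)
  have "AE x in unit_interval. (x, k) \<notin> Z"
    using emeasure_strip_eq_0_iff[of Z I] Z(1) k by (auto simp: null_sets_def)
  then show ?thesis
    using AE_space
  proof eventually_elim
    fix x assume x: "(x, k) \<notin> Z" "x \<in> space unit_interval"
    then have "(x, k) \<in> space (strip I)" using k by simp
    then show "P (x, k)" using Z(2) x(1) by blast
  qed
qed

lemma measurable_into_strip:
  assumes f: "f \<in> borel_measurable M" "\<And>x. x \<in> space M \<Longrightarrow> f x \<in> {0..<1}"
    and g: "g \<in> measurable M (count_space UNIV)"
  shows "(\<lambda>x. (f x, g x)) \<in> measurable M (strip UNIV)"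
  unfolding strip_def using measurable_into_unit_interval[OF f] g by (rule measurable_Pair)

lemma stair_inv_measurable: "stair_inv a s \<in> measurable (strip UNIV) (strip UNIV)"
proof -
  have fl: "(\<lambda>z. \<lfloor>frac (fst z - a) + a\<rfloor>) \<in> measurable (strip UNIV) (count_space UNIV)"
    by measurable
  have "(\<lambda>z. inv (climb s \<lfloor>frac (fst z - a) + a\<rfloor>) (snd z)) \<in> measurable (strip UNIV) (count_space UNIV)"
    using measurable_discrete2[OF fl measurable_snd_strip, of "\<lambda>j. inv (climb s j)"] .
  then show ?thesis
    unfolding stair_inv_def[abs_def] by (intro measurable_into_strip) (auto simp: frac_lt_1)
qed

lemma stair_inv_stair:
  assumes s: "regular s" and z: "z \<in> {0..<1} \<times> UNIV"
  shows "stair_inv a s (stair a s z) = z"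
proof -
  have f: "frac (frac (fst z + a) - a) = fst z"
  proof -
    have "frac (frac (fst z + a) - a) = frac (fst z + real_of_int (- \<lfloor>fst z + a\<rfloor>))"
      by (simp add: frac_def)
    also have "\<dots> = frac (fst z)" unfolding frac_def by (simp only: floor_add_int[symmetric])
    also have "\<dots> = fst z" using z by (auto simp: frac_eq)
    finally show ?thesis .
  qed
  have "inv (climb s j) (climb s j k) = k" for j k
    using bij_climb[OF s] by (simp add: bij_is_inj inv_f_f)
  then show ?thesis by (simp add: stair_def skew_def stair_inv_def f prod_eq_iff)
qed

lemma measure_preserving_stair_inv:
  assumes s: "regular s"
  shows "measure_preserving (strip UNIV) (stair_inv a s)"
proof -
  note m = stair_inv_measurable[of a s]
  have "distr (strip UNIV) (strip UNIV) (stair_inv a s) = strip UNIV"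
  proof (rule measure_eqI)
    fix A assume "A \<in> sets (distr (strip UNIV) (strip UNIV) (stair_inv a s))"
    then have A: "A \<in> sets (strip UNIV)" by simp
    have pre: "stair_inv a s -` A \<inter> space (strip UNIV) \<in> sets (strip UNIV)" by (rule measurable_sets[OF m A])
    have "emeasure (strip UNIV) (stair_inv a s -` A \<inter> space (strip UNIV)) =
        emeasure (strip UNIV) (stair a s -` (stair_inv a s -` A \<inter> space (strip UNIV)) \<inter> space (strip UNIV))"
      by (rule measure_preserving_emeasure[OF measure_preserving_stair[OF s] pre, symmetric])
    also have "stair a s -` (stair_inv a s -` A \<inter> space (strip UNIV)) \<inter> space (strip UNIV) = A"
    proof (rule set_eqI)
      fix z
      show "z \<in> stair a s -` (stair_inv a s -` A \<inter> space (strip UNIV)) \<inter> space (strip UNIV) \<longleftrightarrow> z \<in> A"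
      proof (cases "z \<in> space (strip UNIV)")
        case True
        then have z: "z \<in> {0..<1} \<times> UNIV" by simp
        have "stair a s z \<in> space (strip UNIV)" by (simp add: stair_def skew_def frac_lt_1)
        then show ?thesis using True stair_inv_stair[OF s z, of a] by (simp only: vimage_eq Int_iff simp_thms)
      qed (use sets.sets_into_space[OF A] in blast)
    qed
    finally show "emeasure (distr (strip UNIV) (strip UNIV) (stair_inv a s)) A = emeasure (strip UNIV) A"
      using emeasure_distr[OF m A] by simp
  qed simp
  then show ?thesis using m by (simp add: measure_preserving_def)
qed

lemma conservative_stair_inv:
  assumes s: "regular s" and cons: "conservative (strip UNIV) (stair a s)"
  shows "conservative (strip UNIV) (stair_inv a s)"
  unfolding conservative_def
proof (intro ballI impI)
  fix W assume W: "W \<in> sets (strip UNIV)" and wand: "\<forall>x\<in>W. \<forall>n\<ge>1. (stair_inv a s ^^ n) x \<notin> W"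
  have undo: "(stair_inv a s ^^ n) ((stair a s ^^ n) z) = z" if "z \<in> {0..<1} \<times> UNIV" for n z
  proof (induction n)
    case (Suc n)
    have "(stair_inv a s ^^ Suc n) ((stair a s ^^ Suc n) z) =
        (stair_inv a s ^^ n) (stair_inv a s (stair a s ((stair a s ^^ n) z)))"
      by (simp add: funpow_swap1)
    then show ?case using Suc stair_inv_stair[OF s stair_space[OF that]] by simp
  qed simp
  have "(stair a s ^^ n) x \<notin> W" if x: "x \<in> W" "n \<ge> 1" for x n
  proof
    assume "(stair a s ^^ n) x \<in> W"
    then have "(stair_inv a s ^^ n) ((stair a s ^^ n) x) \<notin> W" using wand x by blast
    moreover have "x \<in> {0..<1} \<times> UNIV" using sets.sets_into_space[OF W] x by auto
    ultimately show False using undo x by simp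
  qed
  then show "emeasure (strip UNIV) W = 0" using cons W unfolding conservative_def by blast
qed

text \<open>The squares at height \<open>y\<close>, in coordinates obtained by flowing back to height 0.\<close>

definition slide_up :: "real \<Rightarrow> (int \<Rightarrow> bool) \<Rightarrow> real \<Rightarrow> real \<times> int \<Rightarrow> int \<times> real \<times> real" where
  "slide_up a s y z = (zpow (right_of s) \<lfloor>fst z + a * y\<rfloor> (snd z), frac (fst z + a * y), y)"

definition slide_down :: "real \<Rightarrow> (int \<Rightarrow> bool) \<Rightarrow> real \<Rightarrow> real \<times> int \<Rightarrow> real \<times> int" where
  "slide_down a s y = skew (- (a * y)) (zpow (right_of s))"

lemma slide_up_down:
  assumes s: "regular s" and x: "x \<in> {0..<1}"
  shows "slide_up a s y (slide_down a s y (x, k)) = (k, x, y)"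
proof -
  have eq: "frac (x - a * y) + a * y = x + real_of_int (- \<lfloor>x - a * y\<rfloor>)" by (simp add: frac_def)
  have fx: "\<lfloor>x\<rfloor> = 0" using x by (auto simp: floor_eq_iff)
  have "\<lfloor>x + real_of_int (- \<lfloor>x - a * y\<rfloor>)\<rfloor> = - \<lfloor>x - a * y\<rfloor>"
    unfolding floor_add_int[symmetric] fx by simp
  moreover have "frac (x + real_of_int (- \<lfloor>x - a * y\<rfloor>)) = x"
    unfolding frac_def floor_add_int[symmetric] fx by simp
  moreover have "bij (right_of s)" using s by (simp add: bij_right_of regular_def)
  ultimately show ?thesis
    by (simp add: slide_up_def slide_down_def skew_def eq zpow_uminus del: of_int_minus)
qed

text \<open>Recurrence is shown for one height at a time. Integration over the heights requires the
  returning points to form a Borel set in both coordinates jointly.\<close>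

lemma returning_points_measurable:
  fixes B :: "int \<Rightarrow> (real \<times> real) set"
  assumes B: "\<And>k. B k \<in> sets borel" and T: "T \<in> measurable (strip UNIV) (strip UNIV)"
  shows "{p :: real \<times> real. case slide_up a s (snd p) (T (slide_down a s (snd p) (fst p, k))) of (l, q) \<Rightarrow> q \<in> B l}
    \<in> sets borel"
proof -
  define f where "f p = T (slide_down a s (snd p) (fst p, k))" for p :: "real \<times> real"
  have fst': "fst \<in> borel_measurable (borel :: (real \<times> real) measure)"
    and snd': "snd \<in> borel_measurable (borel :: (real \<times> real) measure)"
    by (intro borel_measurable_continuous_onI continuous_intros)+
  note [measurable] = fst' snd'
  have sd: "(\<lambda>p. slide_down a s (snd p) (fst p, k)) \<in> measurable borel (strip UNIV)"
  proof -
    have fl: "(\<lambda>p. \<lfloor>fst p + - (a * snd p)\<rfloor>) \<in> measurable (borel :: (real \<times> real) measure) (count_space UNIV)"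
      by measurable
    have 1: "(\<lambda>p. zpow (right_of s) \<lfloor>fst p + - (a * snd p)\<rfloor> k) \<in> measurable (borel :: (real \<times> real) measure) (count_space UNIV)"
      using fl by (rule measurable_compose) simp
    have 2: "(\<lambda>p. frac (fst p + - (a * snd p))) \<in> borel_measurable (borel :: (real \<times> real) measure)"
      by measurable
    show ?thesis
      using measurable_into_strip[OF 2 _ 1] by (simp add: slide_down_def skew_def frac_lt_1)
  qed
  then have f: "f \<in> measurable borel (strip UNIV)"
    unfolding f_def by (rule measurable_compose[OF _ T])
  have [measurable]: "(\<lambda>p. fst (f p)) \<in> borel_measurable borel"
    using f measurable_fst_strip by (rule measurable_compose)
  have m2: "(\<lambda>p. snd (f p)) \<in> measurable borel (count_space UNIV)"
    using f measurable_snd_strip by (rule measurable_compose)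
  have fl: "(\<lambda>p. \<lfloor>fst (f p) + a * snd p\<rfloor>) \<in> measurable borel (count_space UNIV)"
    by measurable
  define l where "l p = zpow (right_of s) \<lfloor>fst (f p) + a * snd p\<rfloor> (snd (f p))" for p
  have lm: "l \<in> measurable borel (count_space UNIV)"
    unfolding l_def using measurable_discrete2[OF fl m2, of "zpow (right_of s)"] .
  define q where "q p = (frac (fst (f p) + a * snd p), snd p)" for p
  have qm: "q \<in> borel_measurable borel"
    unfolding q_def by measurable
  have "{p. case slide_up a s (snd p) (f p) of (l, q) \<Rightarrow> q \<in> B l} = (\<Union>i. (l -` {i} \<inter> space borel) \<inter> (q -` B i \<inter> space borel))"
    by (auto simp: slide_up_def l_def q_def)
  also have "\<dots> \<in> sets borel"
  proof (rule sets.countable_UN'')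
    fix i
    have "l -` {i} \<inter> space borel \<in> sets borel" by (rule measurable_sets[OF lm]) simp
    moreover have "q -` B i \<inter> space borel \<in> sets borel" by (rule measurable_sets[OF qm B])
    ultimately show "(l -` {i} \<inter> space borel) \<inter> (q -` B i \<inter> space borel) \<in> sets borel"
      by (rule sets.Int)
  qed simp
  finally show ?thesis unfolding f_def .
qed

lemma null_set_by_slices:
  fixes N :: "(real \<times> real) set"
  assumes N: "N \<in> sets borel" and sl: "AE y in lborel. AE x in lborel. (x, y) \<notin> N"
  shows "N \<in> null_sets lborel"
proof -
  have Np: "N \<in> sets (lborel \<Otimes>\<^sub>M lborel)"
    unfolding lborel_prod using N by simp
  have "emeasure (lborel \<Otimes>\<^sub>M lborel) N = (\<integral>\<^sup>+y. emeasure lborel ((\<lambda>x. (x, y)) -` N) \<partial>lborel)"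
    by (rule lborel_pair.emeasure_pair_measure_alt2[OF Np])
  also have "\<dots> = (\<integral>\<^sup>+(y::real). 0 \<partial>lborel)"
  proof (rule nn_integral_cong_AE)
    show "AE y in lborel. emeasure lborel ((\<lambda>x. (x, y)) -` N) = 0"
      using sl
    proof (rule eventually_mono)
      fix y assume y: "AE x in lborel. (x, y) \<notin> N"
      have "(\<lambda>x. (x, y)) -` N \<in> sets lborel" by (rule sets_Pair2[OF Np])
      then show "emeasure lborel ((\<lambda>x. (x, y)) -` N) = 0"
        using y by (subst (asm) AE_iff_measurable[where N = "(\<lambda>x. (x, y)) -` N"]) auto
    qed
  qed
  finally have "emeasure lborel N = 0" unfolding lborel_prod by simp
  then show ?thesis using N by (intro null_setsI) auto
qed

text \<open>\<open>fst p - a * snd p\<close> is the abscissa at height 0 of the line through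
  \<open>p\<close>; the condition is the genericity required by \<open>generic_line\<close>.\<close>

definition lattice_free :: "real \<Rightarrow> real \<times> real \<Rightarrow> bool" where
  "lattice_free a p \<longleftrightarrow> (\<forall>(j::int) (m::int). fst p - a * snd p + a * j \<noteq> m)"

text \<open>Returns are counted at the height of \<open>p\<close> itself, where they are given by
  iterates of the map. The inverse map is included since it describes the directions with negative
  vertical component. \<open>B\<close> is a family of Borel sets, one in each square.\<close>

definition recurrent_point ::
    "real \<Rightarrow> (int \<Rightarrow> bool) \<Rightarrow> (int \<Rightarrow> (real \<times> real) set) \<Rightarrow> int \<Rightarrow> real \<times> real \<Rightarrow> bool" where
  "recurrent_point a s B k p \<longleftrightarrow> (p \<in> B k \<longrightarrow> (\<forall>T\<in>{stair a s, stair_inv a s}.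
    \<exists>\<^sub>\<infinity>n. case slide_up a s (snd p) ((T ^^ n) (slide_down a s (snd p) (fst p, k))) of (l, q) \<Rightarrow> q \<in> B l))"

text \<open>\<open>S\<close> is the part of \<open>B\<close> at height \<open>y\<close>, in the
  coordinates at height 0. Conservativity of the map and of its inverse gives infinitely many
  returns to \<open>S\<close>, and \<open>slide_down\<close>, which preserves measure, carries this
  to the abscissa at height \<open>y\<close>.\<close>

lemma AE_recurrent_point:
  assumes s: "regular s" and cons: "conservative (strip UNIV) (stair a s)"
    and B: "\<And>k. B k \<in> sets borel"
  shows "AE x in unit_interval. recurrent_point a s B k (x, y)"
proof -
  define S where "S = {z \<in> space (strip UNIV). case slide_up a s y z of (l, q) \<Rightarrow> q \<in> B l}"
  have S: "S \<in> sets (strip UNIV)"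
  proof -
    have fl: "(\<lambda>z. \<lfloor>fst z + a * y\<rfloor>) \<in> measurable (strip UNIV) (count_space UNIV)"
      by measurable
    define l where "l z = zpow (right_of s) \<lfloor>fst z + a * y\<rfloor> (snd z)" for z :: "real \<times> int"
    have lm: "l \<in> measurable (strip UNIV) (count_space UNIV)"
      unfolding l_def using measurable_discrete2[OF fl measurable_snd_strip, of "zpow (right_of s)"] .
    define q where "q z = (frac (fst z + a * y), y)" for z :: "real \<times> int"
    have qm: "q \<in> borel_measurable (strip UNIV)"
      unfolding q_def by measurable
    have "S = (\<Union>i. (l -` {i} \<inter> space (strip UNIV)) \<inter> (q -` B i \<inter> space (strip UNIV)))"
      unfolding S_def by (auto simp: slide_up_def l_def q_def)
    also have "\<dots> \<in> sets (strip UNIV)"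
    proof (rule sets.countable_UN'')
      fix i
      have "l -` {i} \<inter> space (strip UNIV) \<in> sets (strip UNIV)" by (rule measurable_sets[OF lm]) simp
      moreover have "q -` B i \<inter> space (strip UNIV) \<in> sets (strip UNIV)" by (rule measurable_sets[OF qm B])
      ultimately show "(l -` {i} \<inter> space (strip UNIV)) \<inter> (q -` B i \<inter> space (strip UNIV)) \<in> sets (strip UNIV)"
        by (rule sets.Int)
    qed simp
    finally show ?thesis .
  qed
  have sp: "(T ^^ n) z \<in> space (strip UNIV)"
    if "T \<in> {stair a s, stair_inv a s}" "z \<in> space (strip UNIV)" for T n z
    using that stair_space[where a = a and s = s and n = 1] stair_inv_space[of a s] by (induction n) auto
  have "AE z in strip UNIV. z \<in> S \<longrightarrow> (\<exists>\<^sub>\<infinity>n. (T ^^ n) z \<in> S)" if "T \<in> {stair a s, stair_inv a s}" for T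
    using that conservative_infinitely_often[OF measure_preserving_stair[OF s] cons S]
      conservative_infinitely_often[OF measure_preserving_stair_inv[OF s] conservative_stair_inv[OF s cons] S]
    by auto
  then have AE: "AE z in strip UNIV. \<forall>T\<in>{stair a s, stair_inv a s}. z \<in> S \<longrightarrow> (\<exists>\<^sub>\<infinity>n. (T ^^ n) z \<in> S)"
    by (intro AE_ball_countable') auto
  have "bij (right_of s)" using s by (simp add: bij_right_of regular_def)
  then have "measure_preserving (strip UNIV) (slide_down a s y)"
    unfolding slide_down_def using bij_zpow by (intro measure_preserving_skew) auto
  from AE_strip_section[OF measure_preserving_AE[OF this AE], of k]
  have "AE x in unit_interval. \<forall>T\<in>{stair a s, stair_inv a s}. slide_down a s y (x, k) \<in> S \<longrightarrow>
      (\<exists>\<^sub>\<infinity>n. (T ^^ n) (slide_down a s y (x, k)) \<in> S)" by simp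
  then show ?thesis
    using AE_space
  proof eventually_elim
    fix x assume *: "\<forall>T\<in>{stair a s, stair_inv a s}. slide_down a s y (x, k) \<in> S \<longrightarrow>
        (\<exists>\<^sub>\<infinity>n. (T ^^ n) (slide_down a s y (x, k)) \<in> S)" and x: "x \<in> space unit_interval"
    have z: "slide_down a s y (x, k) \<in> space (strip UNIV)"
      by (simp add: slide_down_def skew_def frac_lt_1)
    have "slide_down a s y (x, k) \<in> S" if "(x, y) \<in> B k"
      unfolding S_def using z slide_up_down[OF s, of x a y k] x that by simp
    then show "recurrent_point a s B k (x, y)"
      using * unfolding recurrent_point_def S_def by (auto elim: frequently_elim1)
  qed
qed

text \<open>Fubini over the heights: for a fixed height off the edges, the lines that meet the
  lattice start at countably many abscissas, and non-recurrent points are null by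
  \<open>AE_recurrent_point\<close>.\<close>

lemma exceptional_points_null:
  assumes s: "regular s" and cons: "conservative (strip UNIV) (stair a s)"
    and B: "\<And>k. B k \<in> sets borel"
  shows "{p \<in> unit_square. p \<notin> {0<..<1} \<times> {0<..<1} \<or> \<not> lattice_free a p \<or> \<not> recurrent_point a s B k p}
    \<in> null_sets lborel" (is "?N \<in> _")
proof (rule null_set_by_slices)
  define G where "G T n = {p. case slide_up a s (snd p) ((T ^^ n) (slide_down a s (snd p) (fst p, k))) of (l, q) \<Rightarrow> q \<in> B l}"
    for T n
  have Gm: "G T n \<in> sets borel" if "T \<in> {stair a s, stair_inv a s}" for T n
  proof -
    have "measure_preserving (strip UNIV) T"
      using that measure_preserving_stair[OF s] measure_preserving_stair_inv[OF s] by auto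
    then have "T ^^ n \<in> measurable (strip UNIV) (strip UNIV)"
      by (intro measure_preserving_measurable measure_preserving_funpow)
    then show ?thesis unfolding G_def by (rule returning_points_measurable[OF B])
  qed
  define R where "R T = (\<Inter>m. \<Union>n\<in>{m..}. G T n)" for T
  have Rm: "R T \<in> sets borel" if "T \<in> {stair a s, stair_inv a s}" for T
    unfolding R_def using Gm[OF that] by (intro sets.countable_INT'' sets.countable_UN') auto
  define L where "L = (\<Union>j::int. \<Union>m::int. {p :: real \<times> real. fst p - a * snd p + a * j = m})"
  have Lm: "L \<in> sets borel"
  proof -
    have "{p :: real \<times> real. fst p - a * snd p + a * j = m} \<in> sets borel" for j m :: int
      by (intro borel_closed closed_Collect_eq continuous_intros)
    then show ?thesis unfolding L_def by (intro sets.countable_UN'') simp_all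
  qed
  have "?N = (unit_square - {0<..<1} \<times> {0<..<1}) \<union> (unit_square \<inter> L) \<union>
      ((unit_square \<inter> B k) - (R (stair a s) \<inter> R (stair_inv a s)))"
  proof -
    have "p \<in> L \<longleftrightarrow> \<not> lattice_free a p" for p by (auto simp: L_def lattice_free_def)
    moreover have "p \<in> R T \<longleftrightarrow> (\<exists>\<^sub>\<infinity>n. p \<in> G T n)" for p T
      by (auto simp: R_def INFM_nat_le)
    then have "recurrent_point a s B k p \<longleftrightarrow> (p \<in> B k \<longrightarrow> p \<in> R (stair a s) \<and> p \<in> R (stair_inv a s))" for p
      by (simp add: recurrent_point_def G_def)
    ultimately show ?thesis by blast
  qed
  also have "\<dots> \<in> sets borel"
  proof -
    have "unit_square \<in> sets borel" unfolding unit_square_def by (intro borel_closed closed_Times) auto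
    moreover have "{0<..<1::real} \<times> {0<..<1::real} \<in> sets borel" by (intro borel_open open_Times) auto
    ultimately show ?thesis using Lm Rm B by (intro sets.Un sets.Diff sets.Int) auto
  qed
  finally show "?N \<in> sets borel" .
  have "AE y in lborel. y \<notin> {0, 1 :: real}"
    by (rule AE_not_in) (simp add: countable_imp_null_set_lborel)
  then show "AE y in lborel. AE x in lborel. (x, y) \<notin> ?N"
  proof (rule eventually_mono)
    fix y :: real assume y: "y \<notin> {0, 1}"
    have "AE x in unit_interval. recurrent_point a s B k (x, y)" by (rule AE_recurrent_point[OF s cons B])
    then have 1: "AE x in lborel. x \<in> {0..<1} \<longrightarrow> recurrent_point a s B k (x, y)"
      unfolding unit_interval_def by (subst (asm) AE_restrict_space_iff) auto
    have 2: "AE x in lborel. x \<notin> {0, 1 :: real}"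
      by (rule AE_not_in) (simp add: countable_imp_null_set_lborel)
    have "countable (\<Union>j::int. \<Union>m::int. {a * y - a * real_of_int j + real_of_int m})" by auto
    then have 3: "AE x in lborel. x \<notin> (\<Union>j::int. \<Union>m::int. {a * y - a * real_of_int j + real_of_int m})"
      by (intro AE_not_in countable_imp_null_set_lborel)
    show "AE x in lborel. (x, y) \<notin> ?N"
      using 1 2 3
    proof eventually_elim
      fix x :: real
      assume x: "x \<in> {0..<1} \<longrightarrow> recurrent_point a s B k (x, y)" "x \<notin> {0, 1}"
        "x \<notin> (\<Union>j::int. \<Union>m::int. {a * y - a * real_of_int j + real_of_int m})"
      have "lattice_free a (x, y)"
        unfolding lattice_free_def
      proof (intro allI notI)
        fix j m :: int assume "fst (x, y) - a * snd (x, y) + a * real_of_int j = real_of_int m"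
        then have "x = a * y - a * real_of_int j + real_of_int m" by simp
        then show False using x(3) by blast
      qed
      then show "(x, y) \<notin> ?N" using x y by (auto simp: unit_square_def)
    qed
  qed
qed

text \<open>The trajectory through \<open>p\<close> is again at the height of \<open>p\<close>
  whenever it has risen or fallen by an integer, that is at the times
  \<open>n / \<bar>v\<bar>\<close>; infinitely many such returns exceed any given
  \<open>T\<close>.\<close>

lemma flow_returns:
  assumes s: "regular s" and a: "a \<noteq> 0" and v: "v \<noteq> 0" and u: "a * v = u"
    and p: "p \<in> {0<..<1} \<times> {0<..<1}" and free: "lattice_free a p" and rec: "recurrent_point a s B k p"
    and pB: "p \<in> B k" and BA: "\<And>l q. q \<in> B l \<Longrightarrow> surface_class s (l, q) \<in> A"
  shows "surface_class s (k, p) \<in> flow_domain s (u, v) \<and>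
    (\<forall>T. \<exists>t>T. straight_line_flow s (u, v) t (surface_class s (k, p)) \<in> A)"
proof -
  obtain x y where xy: "p = (x, y)" by (cases p)
  have x: "x \<in> {0..<1}" and y: "y \<in> {0..<1}" using p by (auto simp: xy)
  interpret generic_line s a "x - a * y" "zpow (right_of s) \<lfloor>x - a * y\<rfloor> k"
  proof
    fix j :: int
    show "x - a * y + a * j \<notin> \<int>"
      using free unfolding lattice_free_def xy by (auto elim: Ints_cases)
  qed (rule s)
  define z where "z = slide_down a s y (x, k)"
  have z: "z = (frac (x - a * y), zpow (right_of s) \<lfloor>x - a * y\<rfloor> k)"
    by (simp add: z_def slide_down_def skew_def)
  define \<gamma> where "\<gamma> t = point (y + t * v)" for t
  have \<gamma>: "is_trajectory s (u, v) \<gamma>" unfolding \<gamma>_def by (rule trajectory_point[OF u])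
  have at: "\<gamma> (real_of_int j / v) = surface_class s (slide_up a s y (orbit j))" for j
    using point_at_level[OF y, of j] v by (simp add: \<gamma>_def slide_up_def)
  have "orbit 0 = z" by (simp add: orbit_0 z)
  then have start: "\<gamma> 0 = surface_class s (k, p)"
    using at[of 0] slide_up_down[OF s x] by (simp add: z_def xy)
  have u0: "u \<noteq> 0" using a v u by auto
  have flow: "straight_line_flow s (u, v) t (surface_class s (k, p)) = \<gamma> t" if "t \<ge> 0" for t
    using straight_line_flow_eq[OF s u0 v \<gamma> that] start by simp
  have "\<exists>t>T. straight_line_flow s (u, v) t (surface_class s (k, p)) \<in> A" for T
  proof -
    \<comment> \<open>Positive time means forward iteration for upward directions and backward
      iteration for downward ones.\<close>
    define \<epsilon> where "\<epsilon> = (if v > 0 then 1 else - 1 :: int)"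
    define F where "F = (if v > 0 then stair a s else stair_inv a s)"
    have orb: "orbit (\<epsilon> * int n) = (F ^^ n) z" for n
      by (simp add: orbit_def ziter_def z \<epsilon>_def F_def)
    define P where "P n \<longleftrightarrow> (case slide_up a s y ((F ^^ n) z) of (l, q) \<Rightarrow> q \<in> B l)" for n
    have "\<exists>\<^sub>\<infinity>n. P n"
      using rec pB unfolding recurrent_point_def xy z_def F_def P_def by auto
    then obtain n where n: "n > nat \<lceil>\<bar>T\<bar> * \<bar>v\<bar>\<rceil>" "P n"
      unfolding INFM_nat by blast
    define t where "t = real_of_int (\<epsilon> * int n) / v"
    have t: "t = real n / \<bar>v\<bar>" using v by (auto simp: t_def \<epsilon>_def)
    have "\<bar>T\<bar> * \<bar>v\<bar> < real n" using n(1) by linarith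
    then have "\<bar>T\<bar> < t" using v by (simp add: t pos_less_divide_eq)
    moreover have "\<gamma> t \<in> A"
    proof -
      have "\<gamma> t = surface_class s (slide_up a s y ((F ^^ n) z))"
        unfolding t_def at orb ..
      then show ?thesis using n(2) BA unfolding P_def by (auto split: prod.splits)
    qed
    ultimately show ?thesis using flow[of t] by (intro exI[of _ t]) auto
  qed
  moreover have "surface_class s (k, p) \<in> flow_domain s (u, v)"
    unfolding flow_domain_def using \<gamma> start by blast
  ultimately show ?thesis by blast
qed

section \<open>From the squares to the surface\<close>

lemma unit_square_lebesgue: "unit_square \<in> lmeasurable"
proof -
  have "unit_square = cbox (0, 0) (1, 1)" by (simp add: unit_square_def cbox_Pair_eq)
  then show ?thesis by (metis lmeasurable_cbox)
qed

lemma space_squares_area: "space squares_area = UNIV \<times> unit_square"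
  by (simp add: squares_area_def space_pair_measure)

lemma null_sets_squares_area:
  assumes N: "\<And>k. negligible (N k)" "\<And>k. N k \<subseteq> unit_square"
  shows "(SIGMA k:UNIV. N k) \<in> null_sets squares_area"
proof -
  have fin: "finite_measure (lebesgue_on unit_square)"
    using unit_square_lebesgue by (rule finite_measure_lebesgue_on)
  then interpret L: finite_measure "lebesgue_on unit_square" .
  have "{k} \<times> N k \<in> null_sets squares_area" for k
  proof -
    have Nk: "N k \<in> null_sets (lebesgue_on unit_square)"
      using N[of k] unit_square_lebesgue
      by (subst null_sets_restrict_space) (auto simp: negligible_iff_null_sets fmeasurableD)
    have "emeasure squares_area ({k} \<times> N k) = emeasure (count_space UNIV) {k} * emeasure (lebesgue_on unit_square) (N k)"
      unfolding squares_area_def using Nk by (intro L.emeasure_pair_measure_Times) auto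
    then show ?thesis using Nk by (auto simp: null_sets_def squares_area_def)
  qed
  then have "(\<Union>k. {k} \<times> N k) \<in> null_sets squares_area" by (rule null_sets_UN)
  moreover have "(\<Union>k. {k} \<times> N k) = (SIGMA k:UNIV. N k)" by auto
  ultimately show ?thesis by simp
qed

lemma measurable_surface_class:
  "surface_class s \<in> measurable squares_area
    (sigma (staircase s) {A. A \<subseteq> staircase s \<and> surface_class s -` A \<inter> space squares_area \<in> sets squares_area})"
proof (rule measurable_measure_of)
  show "surface_class s \<in> space squares_area \<rightarrow> staircase s"
    by (auto simp: space_squares_area surface_class_in_staircase)
qed auto

text \<open>All exceptional points are collected upstairs, in the disjoint union of squares, into a
  null set \<open>Q\<close>. It includes the edges of the squares, so that it is a union of classes
  and its image on the surface is null.\<close>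

theorem recurrent_in_direction_if_conservative:
  assumes s: "regular s" and cons: "conservative (strip UNIV) (stair a s)"
    and a: "a \<noteq> 0" and v: "v \<noteq> 0" and u: "a * v = u"
  shows "recurrent_in_direction s (u, v)"
  unfolding recurrent_in_direction_def
proof (intro ballI impI)
  fix A assume A: "A \<in> sets (staircase_area s)"
  define A' where "A' = surface_class s -` A \<inter> space squares_area"
  have A': "A' \<in> sets squares_area"
    unfolding A'_def using A by (intro measurable_sets[OF measurable_surface_class]) (simp add: staircase_area_def)
  have sl: "Pair k -` A' \<in> sets lebesgue" for k
  proof -
    have "Pair k -` A' \<in> sets (lebesgue_on unit_square)"
      using A' unfolding squares_area_def by (rule sets_Pair1)
    then show ?thesis
      using unit_square_lebesgue by (subst (asm) sets_restrict_space_iff) (auto simp: fmeasurableD)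
  qed
  \<comment> \<open>The set \<open>A\<close> is only Lebesgue measurable in each square; its Borel
    part is kept and the remainder goes into \<open>N\<close>.\<close>
  define B where "B k = main_part lborel (Pair k -` A')" for k
  have B: "B k \<in> sets borel" for k
    using main_part_sets[OF sl, of k] by (simp add: B_def)
  have BA': "B k \<union> null_part lborel (Pair k -` A') = Pair k -` A'" for k
    unfolding B_def by (rule main_part_null_part_Un[OF sl])
  define E where "E k = {p \<in> unit_square. p \<notin> {0<..<1} \<times> {0<..<1} \<or> \<not> lattice_free a p \<or> \<not> recurrent_point a s B k p}" for k
  define N where "N k = E k \<union> (null_part lborel (Pair k -` A') \<inter> unit_square)" for k
  have negN: "negligible (N k)" for k
  proof -
    have "E k \<in> null_sets lborel"
      unfolding E_def by (rule exceptional_points_null[OF s cons B])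
    then have "negligible (E k)" by (simp add: negligible_iff_null_sets null_sets_completionI)
    moreover obtain Z where Z: "Z \<in> null_sets lborel" "null_part lborel (Pair k -` A') \<subseteq> Z"
      using null_part[OF sl] by blast
    have "negligible Z" unfolding negligible_iff_null_sets by (rule null_sets_completionI[OF Z(1)])
    then have "negligible (null_part lborel (Pair k -` A') \<inter> unit_square)"
      by (rule negligible_subset) (use Z(2) in blast)
    ultimately show ?thesis unfolding N_def by (rule negligible_Un)
  qed
  define Q where "Q = (SIGMA k:UNIV. N k)"
  have Nsq: "N k \<subseteq> unit_square" for k by (auto simp: N_def E_def)
  have Q: "Q \<in> null_sets squares_area"
    unfolding Q_def by (rule null_sets_squares_area[OF negN Nsq])
  have interior: "snd q \<in> {0<..<1} \<times> {0<..<1}" if "q \<in> UNIV \<times> unit_square" "q \<notin> Q" for q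
    using that by (cases q) (auto simp: Q_def N_def E_def)
  \<comment> \<open>Saturation: a point outside \<open>Q\<close> is interior to its square, hence
    the only representative of its class.\<close>
  have Qpre: "surface_class s -` (surface_class s ` Q) \<inter> space squares_area = Q"
  proof (intro equalityI subsetI)
    fix q assume q: "q \<in> surface_class s -` (surface_class s ` Q) \<inter> space squares_area"
    then obtain q' where q': "q' \<in> Q" "surface_class s q = surface_class s q'" by blast
    show "q \<in> Q"
    proof (rule ccontr)
      assume nQ: "q \<notin> Q"
      then have "snd q \<in> {0<..<1} \<times> {0<..<1}" using q by (intro interior) (auto simp: space_squares_area)
      then have "q = q'" by (rule interior_class_eq[OF s _ q'(2)])
      then show False using q'(1) nQ by simp
    qed
  next
    fix q assume "q \<in> Q"
    then show "q \<in> surface_class s -` (surface_class s ` Q) \<inter> space squares_area"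
      using Nsq by (auto simp: space_squares_area Q_def)
  qed
  define \<A> where "\<A> = {A. A \<subseteq> staircase s \<and> surface_class s -` A \<inter> space squares_area \<in> sets squares_area}"
  have area: "staircase_area s = distr squares_area (sigma (staircase s) \<A>) (surface_class s)"
    by (simp add: staircase_area_def \<A>_def)
  have mc: "surface_class s \<in> measurable squares_area (sigma (staircase s) \<A>)"
    unfolding \<A>_def by (rule measurable_surface_class)
  have pow: "\<A> \<subseteq> Pow (staircase s)" by (auto simp: \<A>_def)
  have "surface_class s ` Q \<subseteq> staircase s"
    using Nsq by (auto simp: Q_def intro!: surface_class_in_staircase)
  then have "surface_class s ` Q \<in> \<A>"
    using Q Qpre by (auto simp: \<A>_def)
  then have cQ: "surface_class s ` Q \<in> sets (sigma (staircase s) \<A>)"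
    using pow by (simp add: sets_measure_of)
  have null: "surface_class s ` Q \<in> null_sets (staircase_area s)"
  proof (rule null_setsI)
    show "emeasure (staircase_area s) (surface_class s ` Q) = 0"
      unfolding area using emeasure_distr[OF mc cQ] Q Qpre by auto
  qed (use cQ in \<open>simp add: area\<close>)
  show "AE x in staircase_area s. x \<in> A \<longrightarrow>
      x \<in> flow_domain s (u, v) \<and> (\<forall>T. \<exists>t>T. straight_line_flow s (u, v) t x \<in> A)"
  proof (rule AE_I'[OF null], rule subsetI, rule ccontr)
    fix x assume x: "x \<in> {x \<in> space (staircase_area s). \<not> (x \<in> A \<longrightarrow>
      x \<in> flow_domain s (u, v) \<and> (\<forall>T. \<exists>t>T. straight_line_flow s (u, v) t x \<in> A))}"
      and nx: "x \<notin> surface_class s ` Q"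
    have "x \<in> staircase s" using x pow by (simp add: area)
    then obtain k p where p: "p \<in> unit_square" "x = surface_class s (k, p)"
      unfolding staircase_def quotient_def surface_class_def by auto
    have nQ: "(k, p) \<notin> Q" using nx p(2) by blast
    have "(k, p) \<in> A'" using x p by (auto simp: A'_def space_squares_area)
    then have pB: "p \<in> B k"
      using BA'[of k] nQ p(1) by (auto simp: Q_def N_def)
    have "surface_class s (l, q) \<in> A" if "q \<in> B l" for l q
    proof -
      have "q \<in> Pair l -` A'" using BA'[of l] that by blast
      then show ?thesis by (simp add: A'_def)
    qed
    moreover have "p \<in> {0<..<1} \<times> {0<..<1}" "lattice_free a p" "recurrent_point a s B k p"
      using nQ p(1) by (auto simp: Q_def N_def E_def)
    ultimately have "surface_class s (k, p) \<in> flow_domain s (u, v) \<and>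
        (\<forall>T. \<exists>t>T. straight_line_flow s (u, v) t (surface_class s (k, p)) \<in> A)"
      using flow_returns[OF s a v u, of p B k A] pB by blast
    then show False using x p(2) by blast
  qed
qed

section \<open>From slopes to angles\<close>

lemma cot_eq_imp:
  assumes \<alpha>: "\<alpha> \<in> {0..<2 * pi}" and s0: "sin \<alpha> \<noteq> 0"
  shows "\<alpha> = pi / 2 - arctan (cos \<alpha> / sin \<alpha>) \<or> \<alpha> = 3 * pi / 2 - arctan (cos \<alpha> / sin \<alpha>)"
proof -
  have tan: "tan (pi / 2 - \<beta>) = cos \<beta> / sin \<beta>" for \<beta> :: real
    unfolding tan_def by (simp add: sin_diff cos_diff)
  have "\<alpha> \<noteq> 0" "\<alpha> \<noteq> pi" using s0 by auto
  then consider "0 < \<alpha>" "\<alpha> < pi" | "pi < \<alpha>" "\<alpha> < 2 * pi" using \<alpha> by force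
  then show ?thesis
  proof cases
    case 1
    have "arctan (tan (pi / 2 - \<alpha>)) = pi / 2 - \<alpha>" using 1 by (intro arctan_tan) auto
    then show ?thesis unfolding tan by simp
  next
    case 2
    have "arctan (tan (pi / 2 - (\<alpha> - pi))) = pi / 2 - (\<alpha> - pi)" using 2 by (intro arctan_tan) auto
    then have "arctan (cos \<alpha> / sin \<alpha>) = pi / 2 - (\<alpha> - pi)" unfolding tan by simp
    then show ?thesis by linarith
  qed
qed

text \<open>The bad angles are the images of the null set of bad slopes under the two branches of
  the inverse cotangent, together with the horizontal directions; differentiable maps preserve null
  sets.\<close>

lemma AE_slope_often_well_spaced:
  "AE \<alpha> in lebesgue_on {0..<2 * pi}. sin \<alpha> \<noteq> 0 \<and> often_well_spaced (cos \<alpha> / sin \<alpha>)"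
proof -
  define Z where "Z = {x. \<not> often_well_spaced x}"
  have Z: "negligible Z"
  proof -
    obtain M where M: "M \<in> null_sets lborel" "{x \<in> space lborel. \<not> often_well_spaced x} \<subseteq> M"
      using AE_often_well_spaced by (auto simp only: eventually_ae_filter)
    have "negligible M" unfolding negligible_iff_null_sets by (rule null_sets_completionI[OF M(1)])
    then show ?thesis
      by (rule negligible_subset) (use M(2) in \<open>simp add: Z_def\<close>)
  qed
  have img: "negligible ((\<lambda>t. c - arctan t) ` Z)" for c
  proof (rule negligible_differentiable_image_negligible[OF _ Z])
    have "arctan differentiable (at t)" for t
      using DERIV_arctan[of t] by (auto simp: real_differentiable_def)
    then show "(\<lambda>t. c - arctan t) differentiable_on Z"
      by (intro differentiable_at_imp_differentiable_on derivative_intros)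
  qed simp
  define U where "U = (\<lambda>t. pi / 2 - arctan t) ` Z \<union> (\<lambda>t. 3 * pi / 2 - arctan t) ` Z \<union> {0, pi}"
  have "negligible U"
    unfolding U_def by (intro negligible_Un img negligible_finite) simp
  then have "AE \<alpha> in lebesgue. \<alpha> \<notin> U"
    by (intro AE_not_in) (simp add: negligible_iff_null_sets)
  then have "AE \<alpha> in lebesgue. \<alpha> \<in> {0..<2 * pi} \<longrightarrow> sin \<alpha> \<noteq> 0 \<and> often_well_spaced (cos \<alpha> / sin \<alpha>)"
  proof (rule eventually_mono, intro impI)
    fix \<alpha> :: real assume nU: "\<alpha> \<notin> U" and \<alpha>: "\<alpha> \<in> {0..<2 * pi}"
    have s0: "sin \<alpha> \<noteq> 0"
    proof
      assume "sin \<alpha> = 0"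
      then have "\<alpha> = 0 \<or> \<alpha> = pi"
        using \<alpha> sin_gt_zero[of \<alpha>] sin_lt_zero[of \<alpha>] by force
      then show False using nU by (auto simp: U_def)
    qed
    have "cos \<alpha> / sin \<alpha> \<notin> Z"
      using cot_eq_imp[OF \<alpha> s0] nU unfolding U_def by blast
    then show "sin \<alpha> \<noteq> 0 \<and> often_well_spaced (cos \<alpha> / sin \<alpha>)" using s0 by (simp add: Z_def)
  qed
  then show ?thesis by (subst AE_restrict_space_iff) auto
qed

theorem theorem2:
  fixes \<mu> :: "(int \<Rightarrow> bool) measure"
  assumes "prob_space \<mu>"
    and "sets \<mu> = sets borel"
    and "shift_invariant \<mu>"
    and "shift_ergodic \<mu>"
    and "\<exists>p\<in>measure_support \<mu>. periodic_point p \<and> p \<noteq> (\<lambda>_. False) \<and> p \<noteq> (\<lambda>_. True)"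
  shows "AE s in \<mu>. recurrent s"
proof -
  obtain p where p: "p \<in> measure_support \<mu>" "periodic_point p" "p \<noteq> (\<lambda>_. False)" "p \<noteq> (\<lambda>_. True)"
    using assms(5) by blast
  obtain N where "periodic_word p N" using periodic_word_of_periodic_point[OF p(2-4)] by blast
  then interpret periodic_word p N .
  note copies = AE_copies[OF assms(1-4) p(1)]
  have "AE s in \<mu>. \<forall>H B. \<exists>c>B. s \<in> copy_at p H (1 * c)" by (rule copies) simp
  moreover have "AE s in \<mu>. \<forall>H B. \<exists>c>B. s \<in> copy_at p H (- 1 * c)" by (rule copies) simp
  ultimately show ?thesis
  proof eventually_elim
    fix s assume r: "\<forall>H B. \<exists>c>B. s \<in> copy_at p H (1 * c)" and l: "\<forall>H B. \<exists>c>B. s \<in> copy_at p H (- 1 * c)"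
    have right: "\<exists>c>B. s \<in> copy_at p H c" for H B using r by simp
    have left: "\<exists>c<B. s \<in> copy_at p H c" for H B
    proof -
      obtain c where "c > - B" "s \<in> copy_at p H (- 1 * c)" using l by blast
      then show ?thesis by (intro exI[of _ "- c"]) auto
    qed
    have s: "regular s" by (rule regular_of_copies[OF right left])
    show "recurrent s"
      unfolding recurrent_def using AE_slope_often_well_spaced
    proof (rule eventually_mono)
      fix \<alpha> assume \<alpha>: "sin \<alpha> \<noteq> 0 \<and> often_well_spaced (cos \<alpha> / sin \<alpha>)"
      have "conservative (strip UNIV) (stair (cos \<alpha> / sin \<alpha>) s)"
        using right left \<alpha> by (intro stair_conservative s) (auto simp: copy_at_def)
      \<comment> \<open>A well spaced slope is not an integer, which excludes vertical directions;
        uniqueness of trajectories relies on both components being nonzero.\<close>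
      moreover have "cos \<alpha> / sin \<alpha> \<noteq> 0" using often_well_spaced_not_Ints[of "cos \<alpha> / sin \<alpha>"] \<alpha> by (metis Ints_0)
      ultimately show "recurrent_in_direction s (cos \<alpha>, sin \<alpha>)"
        using \<alpha> by (intro recurrent_in_direction_if_conservative[OF s, where a = "cos \<alpha> / sin \<alpha>"]) auto
    qed
  qed
qed

end
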